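(* Let $\alpha>0$, $K_\Sigma>0$, $0\le p^*<1$. Let $u$ be a function whose Fourier transform $\phi_u$ is symmetric, real-valued, continuous in some neighbourhood of zero and supported on $[-1,1]$, with $$\int_{-1}^1\phi_u(t)\,dt=2,\qquad \left|\frac{\phi_u(t)}{|t|^{\alpha}}\right|\le U\quad\text{for all }t\in\mathbb R,$$ where $U>0$ is a constant and at $t=0$ the ratio is defined as $\lim_{t\to0}\phi_u(t)|t|^{-\alpha}$, which is assumed to exist. Let $w$ be a kernel whose Fourier transform $\phi_w$ is symmetric, real-valued, supported on $[-1,1]$, and satisfies $$\phi_w(0)=1,\qquad|\phi_w(t)-1|\le W|t|^\alpha\ \text{ for all }t\in\mathbb R,\qquad\int_{-1}^1|\phi_w(t)|^2\,dt<\infty,$$ where $W>0$ is a constant. Let $n\ge2$ and $\epsilon_n=(\log 3n)^{-1}$. (i) Suppose $\phi_Z(t)\ne0$ for all $t\in\mathbb R$, $\phi_Z$ is integrable, and there are constants $d_0,\beta>0$ such that $d_0|t|^{-\beta}\le|\phi_Z(t)|$ for all $|t|$ sufficiently large. Let $h_n=d\,(n-\lfloor n/2\rfloor)^{-1/(2\alpha+2\beta+1)}$ and $g_n=d\,\lfloor n/2\rfloor^{-1/(2\alpha+2\beta)}$ for some $d>0$, and let $f_{nh_ng_n}$ be the sample-splitting estimator defined in the context. Then $$\sup_{f\in\Sigma(\alpha,K_\Sigma),\,p\in[0,p^*]}\mathbb E_{p,f}\left[\int_{-\infty}^\infty(f_{nh_ng_n}(x)-f(x))^2\,dx\right]\lesssim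 n^{-2\alpha/(2\alpha+2\beta+1)}.$$ (ii) Suppose $\phi_Z(t)\ne0$ for all $t\in\mathbb R$, $\phi_Z$ is integrable, and there are constants $\beta_0\in\mathbb R$ and $d_0,\beta,\gamma>0$ such that $d_0|t|^{\beta_0}e^{-|t|^{\beta}/\gamma}\le|\phi_Z(t)|$ for all $|t|$ sufficiently large. Let $h_n=g_n=(4/\gamma)^{1/\beta}(\log n)^{-1/\beta}$ and let $f_{nh_ng_n}$ be the full-sample estimator defined in the context. Then $$\sup_{f\in\Sigma(\alpha,K_\Sigma),\,p\in[0,p^*]}\mathbb E_{p,f}\left[\int_{-\infty}^\infty(f_{nh_ng_n}(x)-f(x))^2\,dx\right]\lesssim(\log n)^{-2\alpha/\beta}.$$
   Context: Model: $X_1,\dots,X_n$ are i.i.d. copies of $X=Y+Z$, where $Y$ and $Z$ are independent, $Y=AV$ with $A$ and $V$ independent, $A$ Bernoulli with $P(A=1)=1-p$, $V$ has probability density $f$ on $\mathbb R$, and $Z$ has a known distribution with density $k$. $\mathbb E_{p,f}$ denotes expectation under the parameter $(p,f)$. $\phi_\xi$ is the characteristic function of a random variable $\xi$ and $\phi_g(t)=\int_{-\infty}^\infty e^{itx}g(x)\,dx$ is the Fourier transform of a function $g$. Class of densities: $\Sigma(\alpha,K_\Sigma)=\{f \text{ probability density}:\int_{-\infty}^\infty|\phi_f(t)|^2(1+|t|^{2\alpha})\,dt\le K_\Sigma\}$. Full-sample estimator (used in (ii)): with $\phi_{emp}(t)=\frac1n\sum_{j=1}^ne^{itX_j}$, $$p_{ng_n}=\frac{g_n}{2}\int_{-1/g_n}^{1/g_n}\frac{\phi_{emp}(t)\phi_u(g_nt)}{\phi_Z(t)}\,dt,\qquad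 \hat p_{ng_n}=\max(-1+\epsilon_n,\min(p_{ng_n},1-\epsilon_n)),$$ $$f_{nh_ng_n}(x)=\frac1{2\pi}\int_{-\infty}^\infty e^{-itx}\,\frac{\phi_{emp}(t)-\hat p_{ng_n}\phi_Z(t)}{(1-\hat p_{ng_n})\phi_Z(t)}\,\phi_w(h_nt)\,dt.$$ Sample-splitting estimator (used in (i)): $p_{ng_n}$ and $\hat p_{ng_n}$ are defined by the same formulas but with $\phi_{emp}(t)$ replaced by the empirical characteristic function $\frac1{\lfloor n/2\rfloor}\sum_{j=1}^{\lfloor n/2\rfloor}e^{itX_j}$ of the first part of the sample, and $$f_{nh_ng_n}(x)=\frac1{2\pi}\int_{-\infty}^\infty e^{-itx}\,\frac{\widetilde\phi_{emp}(t)-\hat p_{ng_n}\phi_Z(t)}{(1-\hat p_{ng_n})\phi_Z(t)}\,\phi_w(h_nt)\,dt,\qquad\widetilde\phi_{emp}(t)=\frac1{n-\lfloor n/2\rfloor}\sum_{j=\lfloor n/2\rfloor+1}^ne^{itX_j}.$$ $a_n\lesssim b_n$ means $a_n\le C b_n$ for all $n\ge 2$, with a constant $C$ not depending on $n$. *)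

theory Defs
  imports "HOL-Probability.Probability"
begin

definition prob_density :: "(real \<Rightarrow> real) \<Rightarrow> bool" where
  "prob_density f \<longleftrightarrow> f \<in> borel_measurable borel \<and> (\<forall>x. 0 \<le> f x) \<and>
     (\<integral>\<^sup>+x. ennreal (f x) \<partial>lborel) = 1"

definition fourier :: "(real \<Rightarrow> real) \<Rightarrow> real \<Rightarrow> complex" where
  "fourier g t = (CLINT x|lborel. iexp (t * x) * complex_of_real (g x))"

text \<open>
  Fourier transform on L1 or L2.  In the L2 case it is the limit in mean of the transforms of
  the truncations, so \<open>\<phi>\<close> may be any Borel version; this admits for instance the sinc
  kernel, whose transform is discontinuous.
\<close>
definition is_fourier_transform :: "(real \<Rightarrow> real) \<Rightarrow> (real \<Rightarrow> complex) \<Rightarrow> bool" where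
  "is_fourier_transform g \<phi> \<longleftrightarrow>
     (integrable lborel g \<and> \<phi> = fourier g) \<or>
     (g \<in> borel_measurable borel \<and> integrable lborel (\<lambda>x. (g x)\<^sup>2) \<and>
      \<phi> \<in> borel_measurable borel \<and>
      ((\<lambda>R. \<integral>\<^sup>+t. ennreal ((cmod (\<phi> t - fourier (\<lambda>x. indicator {-R..R} x * g x) t))\<^sup>2) \<partial>lborel)
         \<longlongrightarrow> 0) at_top)"

definition density_class :: "real \<Rightarrow> real \<Rightarrow> (real \<Rightarrow> real) set" where
  "density_class \<alpha> K = {f. prob_density f \<and>
     (\<integral>\<^sup>+t. ennreal ((cmod (fourier f t))\<^sup>2 * (1 + \<bar>t\<bar> powr (2 * \<alpha>))) \<partial>lborel) \<le> ennreal K}"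

definition law_Y :: "real \<Rightarrow> (real \<Rightarrow> real) \<Rightarrow> real measure" where
  "law_Y p f =
     distr (measure_pmf (bernoulli_pmf (1 - p)) \<Otimes>\<^sub>M density lborel (\<lambda>v. ennreal (f v))) borel
       (\<lambda>(a, v). of_bool a * v)"

definition law_Z :: "(real \<Rightarrow> real) \<Rightarrow> real measure" where
  "law_Z k = density lborel (\<lambda>z. ennreal (k z))"

text \<open>The convolution is the law of the sum of independent \<open>Y\<close> and \<open>Z\<close>.\<close>
definition law_X :: "(real \<Rightarrow> real) \<Rightarrow> real \<Rightarrow> (real \<Rightarrow> real) \<Rightarrow> real measure" where
  "law_X k p f = convolution (law_Y p f) (law_Z k)"

definition sample_law :: "(real \<Rightarrow> real) \<Rightarrow> real \<Rightarrow> (real \<Rightarrow> real) \<Rightarrow> nat \<Rightarrow> (nat \<Rightarrow> real) measure" where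
  "sample_law k p f n = PiM {1..n} (\<lambda>_. law_X k p f)"

definition emp_char :: "nat set \<Rightarrow> (nat \<Rightarrow> real) \<Rightarrow> real \<Rightarrow> complex" where
  "emp_char J x t = (\<Sum>j\<in>J. iexp (t * x j)) / of_nat (card J)"

text \<open>
  In the following estimators \<open>\<psi>\<close> is an empirical characteristic function.  The complex integrals
  \<open>atom_integral\<close> and \<open>dens_integral\<close> are real for real and symmetric \<open>\<phi>u\<close>, \<open>\<phi>w\<close>
  (lemmas below), so taking the real part is only a type conversion.
\<close>
definition atom_integral ::
  "(real \<Rightarrow> complex) \<Rightarrow> (real \<Rightarrow> complex) \<Rightarrow> real \<Rightarrow> (real \<Rightarrow> complex) \<Rightarrow> complex" where
  "atom_integral \<phi>u \<phi>Z g \<psi> =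
     complex_of_real (g / 2) * (CLINT t:{-(1/g)..1/g}|lborel. \<psi> t * \<phi>u (g * t) / \<phi>Z t)"

definition atom_est ::
  "(real \<Rightarrow> complex) \<Rightarrow> (real \<Rightarrow> complex) \<Rightarrow> real \<Rightarrow> real \<Rightarrow> (real \<Rightarrow> complex) \<Rightarrow> real" where
  "atom_est \<phi>u \<phi>Z \<epsilon> g \<psi> = max (- 1 + \<epsilon>) (min (Re (atom_integral \<phi>u \<phi>Z g \<psi>)) (1 - \<epsilon>))"

definition dens_integral ::
  "(real \<Rightarrow> complex) \<Rightarrow> (real \<Rightarrow> complex) \<Rightarrow> real \<Rightarrow> real \<Rightarrow> (real \<Rightarrow> complex) \<Rightarrow> real \<Rightarrow> complex" where
  "dens_integral \<phi>w \<phi>Z h q \<psi> y = complex_of_real (1 / (2 * pi)) *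
     (CLINT t|lborel. iexp (- (t * y)) *
        ((\<psi> t - complex_of_real q * \<phi>Z t) / (complex_of_real (1 - q) * \<phi>Z t)) * \<phi>w (h * t))"

definition full_est ::
  "(real \<Rightarrow> complex) \<Rightarrow> (real \<Rightarrow> complex) \<Rightarrow> (real \<Rightarrow> complex) \<Rightarrow> real \<Rightarrow> real \<Rightarrow> real \<Rightarrow> nat
     \<Rightarrow> (nat \<Rightarrow> real) \<Rightarrow> real \<Rightarrow> real" where
  "full_est \<phi>u \<phi>w \<phi>Z \<epsilon> h g n x y =
     Re (dens_integral \<phi>w \<phi>Z h (atom_est \<phi>u \<phi>Z \<epsilon> g (emp_char {1..n} x)) (emp_char {1..n} x) y)"

definition split_est ::
  "(real \<Rightarrow> complex) \<Rightarrow> (real \<Rightarrow> complex) \<Rightarrow> (real \<Rightarrow> complex) \<Rightarrow> real \<Rightarrow> real \<Rightarrow> real \<Rightarrow> nat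
     \<Rightarrow> (nat \<Rightarrow> real) \<Rightarrow> real \<Rightarrow> real" where
  "split_est \<phi>u \<phi>w \<phi>Z \<epsilon> h g n x y =
     Re (dens_integral \<phi>w \<phi>Z h (atom_est \<phi>u \<phi>Z \<epsilon> g (emp_char {1..n div 2} x))
       (emp_char {n div 2 + 1..n} x) y)"

definition mise ::
  "(real \<Rightarrow> real) \<Rightarrow> nat \<Rightarrow> ((nat \<Rightarrow> real) \<Rightarrow> real \<Rightarrow> real) \<Rightarrow> real \<Rightarrow> (real \<Rightarrow> real) \<Rightarrow> ennreal" where
  "mise k n est p f =
     (\<integral>\<^sup>+x. (\<integral>\<^sup>+y. ennreal ((est x y - f y)\<^sup>2) \<partial>lborel) \<partial>sample_law k p f n)"

lemma prob_space_density: "prob_density f \<Longrightarrow> prob_space (density lborel (\<lambda>v. ennreal (f v)))"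
  by (rule prob_spaceI) (auto simp: prob_density_def emeasure_density)

lemma prob_space_law_Y:
  assumes "prob_density f"
  shows "prob_space (law_Y p f)"
proof -
  interpret V: prob_space "density lborel (\<lambda>v. ennreal (f v))"
    by (rule prob_space_density[OF assms])
  interpret pair_prob_space "measure_pmf (bernoulli_pmf (1 - p))" "density lborel (\<lambda>v. ennreal (f v))" ..
  have "(\<lambda>(a, v). of_bool a * v :: real)
      \<in> borel_measurable (measure_pmf (bernoulli_pmf (1 - p)) \<Otimes>\<^sub>M density lborel (\<lambda>v. ennreal (f v)))"
    by measurable
  then show ?thesis
    unfolding law_Y_def by (rule prob_space_distr)
qed

lemma sets_law_Y [simp, measurable_cong]: "sets (law_Y p f) = sets borel"
  by (simp add: law_Y_def)

lemma sets_law_Z [simp, measurable_cong]: "sets (law_Z k) = sets borel"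
  by (simp add: law_Z_def)

lemma prob_space_law_X:
  assumes "prob_density k" "prob_density f"
  shows "prob_space (law_X k p f)"
proof -
  interpret Y: prob_space "law_Y p f" by (rule prob_space_law_Y[OF assms(2)])
  interpret Z: prob_space "law_Z k" unfolding law_Z_def by (rule prob_space_density[OF assms(1)])
  interpret pair_prob_space "law_Y p f" "law_Z k" ..
  show ?thesis
    unfolding law_X_def convolution_def by (rule prob_space_distr) measurable
qed

lemma prob_space_sample_law:
  assumes "prob_density k" "prob_density f"
  shows "prob_space (sample_law k p f n)"
  unfolding sample_law_def by (intro prob_space_PiM prob_space_law_X assms)

lemma Im_integral_hermitian:
  fixes F :: "real \<Rightarrow> complex"
  assumes "\<And>t. F (- t) = cnj (F t)"
  shows "Im (integral\<^sup>L lborel F) = 0"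
proof -
  have "integral\<^sup>L lborel F = (CLINT t|lborel. F (- t))"
    using lborel_integral_real_affine[of "-1" F 0] by simp
  also have "\<dots> = cnj (integral\<^sup>L lborel F)"
    by (simp add: assms)
  finally show ?thesis
    by (metis complex_cnj Im_complex_of_real Reals_cases Reals_cnj_iff)
qed

lemma emp_char_minus: "emp_char J x (- t) = cnj (emp_char J x t)"
  by (simp add: emp_char_def exp_cnj)

lemma char_minus: "char M (- t) = cnj (char M t)"
  unfolding char_def Bochner_Integration.integral_cnj[symmetric]
  by (simp add: exp_cnj del: Bochner_Integration.integral_cnj)

lemma Im_atom_integral:
  assumes "\<And>t. \<phi>u t \<in> \<real>" "\<And>t. \<phi>u (- t) = \<phi>u t"
  shows "Im (atom_integral \<phi>u (char M) g (emp_char J x)) = 0"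
proof -
  have "Im (CLINT t:{-(1/g)..1/g}|lborel. emp_char J x t * \<phi>u (g * t) / char M t) = 0"
    unfolding set_lebesgue_integral_def
    by (rule Im_integral_hermitian)
       (use assms in \<open>auto simp: emp_char_minus char_minus Reals_cnj_iff indicator_def\<close>)
  then show ?thesis
    by (simp add: atom_integral_def)
qed

lemma Im_dens_integral:
  assumes "\<And>t. \<phi>w t \<in> \<real>" "\<And>t. \<phi>w (- t) = \<phi>w t"
  shows "Im (dens_integral \<phi>w (char M) h q (emp_char J x) y) = 0"
proof -
  have "Im (CLINT t|lborel. iexp (- (t * y)) *
        ((emp_char J x t - complex_of_real q * char M t) / (complex_of_real (1 - q) * char M t)) *
        \<phi>w (h * t)) = 0"
    by (rule Im_integral_hermitian)
       (use assms in \<open>simp add: emp_char_minus char_minus Reals_cnj_iff exp_cnj\<close>)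
  then show ?thesis
    by (simp add: dens_integral_def)
qed

end

theory Submission
  imports Defs
begin

text \<open>
  Write \<open>q\<close> for the clipped estimator of the atom, \<open>r = (p - q) / (1 - q)\<close> and \<open>\<psi>\<close> for the empirical
  characteristic function.  By Plancherel the error is governed by the transform of
  \<open>f\<^sub>n - f\<close>, which splits as
  \<open>\<phi>f (\<phi>w(ht) - 1) + r (1 - \<phi>f) \<phi>w(ht) + (\<psi> - \<phi>X) \<phi>w(ht) / ((1 - q) \<phi>Z)\<close>.
  The first term is a bias of order \<open>h\<^bsup>2\<alpha>\<^esup>\<close>.  The third has variance of order
  \<open>sup |\<phi>Z|\<^bsup>-2\<^esup> / (n h)\<close>, up to the factor \<open>1/(1 - q)\<^sup>2\<close>, which under sample splitting is independent
  of \<open>\<psi>\<close> and satisfies \<open>1/(1 - q) = (1 - r)/(1 - p)\<close>.  For the second term, \<open>E r\<^sup>2\<close> is bounded by the squared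
  bias \<open>g\<^bsup>2\<alpha>+1\<^esup>\<close> of the atom estimator plus \<open>(log n)\<^sup>2\<close> times its variance: the clipping only
  costs the logarithm when the estimator deviates by a constant, and then the deviation is all
  stochastic.  The variance gains a factor \<open>g\<close> over the trivial bound because \<open>\<phi>Z\<close> is integrable:
  for any law \<open>\<mu>\<close>, \<open>\<integral>|G^|\<^sup>2 d\<mu> \<le> \<parallel>char \<mu>\<parallel>\<^sub>1 \<parallel>G\<parallel>\<^sub>2\<^sup>2\<close>.  The same inequality with Gaussian \<open>\<mu>\<close> of growing
  variance yields Plancherel's inequality.
\<close>

subsection \<open>Fourier analysis\<close>

text \<open>The second term of the splitting shapes the proof. Since \<open>1 - \<phi>f\<close> does
  not decay, it contributes about \<open>r\<^sup>2 / h\<close>, so the mean of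
  \<open>r\<^sup>2\<close> has to reach the order \<open>h powr (2 * \<alpha> + 1)\<close>. In the
  polynomial case \<open>1 / n\<close> is of order
  \<open>g powr (2 * \<alpha> + 2 * \<beta>)\<close>: the variance with the extra factor
  \<open>g\<close> is then of order \<open>g powr (2 * \<alpha> + 1)\<close>, like the squared bias,
  while the trivial bound would leave \<open>g powr (2 * \<alpha>)\<close>, which is too large after
  division by \<open>h\<close>. As a power of \<open>n\<close>,
  \<open>g powr (2 * \<alpha> + 1)\<close> is strictly smaller than
  \<open>h powr (2 * \<alpha> + 1)\<close>, and this slack pays for the squared logarithm. The noise
  term has no slack: its bound already has the claimed order, so the factor
  \<open>1 / (1 - q)\<^sup>2\<close> may not cost a logarithm there, and sample splitting prevents
  that. In the exponential case all variances are below a negative power of \<open>n\<close>, so the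
  worst value \<open>1 / \<epsilon>\<^sup>2\<close> is harmless and the whole sample is used
  twice.\<close>

lemma norm_integral_le_nn_integral:
  fixes F :: "'a \<Rightarrow> 'b::{banach, second_countable_topology}"
  shows "ennreal (norm (integral\<^sup>L M F)) \<le> (\<integral>\<^sup>+x. ennreal (norm (F x)) \<partial>M)"
  \<comment> \<open>A non-integrable \<open>F\<close> has Bochner integral 0.\<close>
  by (cases "integrable M F")
     (auto intro: integral_norm_bound_ennreal simp: not_integrable_integral_eq)

text \<open>Fubini between a frequency integral and an arbitrary sigma-finite measure. The weight
  \<open>b\<close> lets one statement serve probability laws, where bounded functions are
  integrable, and Lebesgue measure, where \<open>b\<close> supplies the decay.\<close>

lemma integral_fourier_swap:
  fixes G b :: "real \<Rightarrow> complex" and \<mu> :: "real measure"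
  assumes "sigma_finite_measure \<mu>" and [measurable_cong]: "sets \<mu> = sets borel"
    and b: "integrable \<mu> b" and G: "integrable lborel G"
  shows "(CLINT x|\<mu>. b x * (CLINT t|lborel. iexp (t * x) * G t))
       = (CLINT t|lborel. G t * (CLINT x|\<mu>. b x * iexp (t * x)))"
proof -
  interpret M: sigma_finite_measure \<mu> by fact
  interpret pair_sigma_finite \<mu> lborel ..
  note [measurable] = borel_measurable_integrable[OF b] borel_measurable_integrable[OF G]
  have "integrable (\<mu> \<Otimes>\<^sub>M lborel) (\<lambda>(x, t). b x * (iexp (t * x) * G t))"
  proof (subst integrable_iff_bounded, safe)
    show "(\<lambda>(x, t). b x * (iexp (t * x) * G t)) \<in> borel_measurable (\<mu> \<Otimes>\<^sub>M lborel)"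
      by measurable
    have "(\<integral>\<^sup>+ x. ennreal (norm (case x of (x, t) \<Rightarrow> b x * (iexp (t * x) * G t))) \<partial>(\<mu> \<Otimes>\<^sub>M lborel))
        = (\<integral>\<^sup>+ x. \<integral>\<^sup>+ t. ennreal (norm (b x)) * ennreal (norm (G t)) \<partial>lborel \<partial>\<mu>)"
      by (subst lborel.nn_integral_fst[symmetric]) (auto simp: norm_mult ennreal_mult split_beta')
    also have "\<dots> = (\<integral>\<^sup>+ x. ennreal (norm (b x)) \<partial>\<mu>) * (\<integral>\<^sup>+ t. ennreal (norm (G t)) \<partial>lborel)"
      by (simp add: nn_integral_cmult nn_integral_multc)
    also have "\<dots> < \<infinity>"
      using b G by (simp add: integrable_iff_bounded ennreal_mult_less_top)
    finally show "(\<integral>\<^sup>+ x. ennreal (norm (case x of (x, t) \<Rightarrow> b x * (iexp (t * x) * G t))) \<partial>(\<mu> \<Otimes>\<^sub>M lborel)) < \<infinity>" .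
  qed
  from Fubini_integral[OF this]
  have "(CLINT x|\<mu>. CLINT t|lborel. b x * (iexp (t * x) * G t))
      = (CLINT t|lborel. CLINT x|\<mu>. b x * (iexp (t * x) * G t))"
    by (simp add: case_prod_unfold)
  also have "(\<lambda>t. CLINT x|\<mu>. b x * (iexp (t * x) * G t)) = (\<lambda>t. G t * (CLINT x|\<mu>. b x * iexp (t * x)))"
    by (subst integral_mult_right_zero[symmetric]) (simp add: mult_ac)
  finally show ?thesis
    by simp
qed

lemma borel_measurable_fourier_integral [measurable]:
  fixes G :: "real \<Rightarrow> complex"
  assumes [measurable]: "G \<in> borel_measurable borel"
  shows "(\<lambda>x. CLINT t|lborel. iexp (t * x) * G t) \<in> borel_measurable borel"
  by (rule sigma_finite_measure.borel_measurable_lebesgue_integral) (auto intro: sigma_finite_lborel)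

lemma cmod_fourier_integral_le:
  fixes G :: "real \<Rightarrow> complex"
  shows "cmod (CLINT t|lborel. iexp (t * x) * G t) \<le> (\<integral>t. cmod (G t) \<partial>lborel)"
  by (rule order_trans[OF integral_norm_bound]) (simp add: norm_mult)

text \<open>
  Squaring the transform turns the left side into the double integral of
  \<open>G(t) cnj(G(s)) char(t - s)\<close>, which Young's inequality \<open>2ab \<le> a\<^sup>2 + b\<^sup>2\<close> bounds by the right side.
\<close>
lemma fourier_L2_bound:
  fixes G :: "real \<Rightarrow> complex"
  assumes \<mu>: "real_distribution \<mu>" and G: "integrable lborel G"
    and ch: "integrable lborel (char \<mu>)"
  shows "(\<integral>\<^sup>+x. ennreal ((cmod (CLINT t|lborel. iexp (t * x) * G t))\<^sup>2) \<partial>\<mu>)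
     \<le> (\<integral>\<^sup>+t. ennreal (cmod (char \<mu> t)) \<partial>lborel) * (\<integral>\<^sup>+t. ennreal ((cmod (G t))\<^sup>2) \<partial>lborel)"
proof -
  interpret \<mu>: real_distribution \<mu> by fact
  note [measurable] = borel_measurable_integrable[OF G] \<mu>.char_measurable
  define H where "H x = (CLINT t|lborel. iexp (t * x) * G t)" for x
  have [measurable]: "H \<in> borel_measurable borel" unfolding H_def by measurable
  have H_le: "cmod (H x) \<le> (\<integral>t. cmod (G t) \<partial>lborel)" for x
    unfolding H_def by (rule cmod_fourier_integral_le)
  have iH': "integrable \<mu> H"
    by (rule \<mu>.integrable_const_bound[where B = "\<integral>t. cmod (G t) \<partial>lborel"]) (auto intro: H_le)
  then have iH: "integrable \<mu> (\<lambda>x. cnj (H x))"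
    by simp
  note [measurable] = borel_measurable_integrable[OF iH]
  have iH2: "integrable \<mu> (\<lambda>x. cnj (H x) * H x)"
    by (rule \<mu>.integrable_const_bound[where B = "(\<integral>t. cmod (G t) \<partial>lborel)\<^sup>2"])
       (auto intro!: H_le mult_mono simp: norm_mult power2_eq_square)
  \<comment> \<open>The second swap: integrating the conjugate transform against
    \<open>iexp (t * x)\<close> merges the exponentials into
    \<open>char \<mu> (t - s)\<close>.\<close>
  have inner: "(CLINT x|\<mu>. cnj (H x) * iexp (t * x)) = (CLINT s|lborel. cnj (G s) * char \<mu> (t - s))" for t
  proof -
    have ib: "integrable \<mu> (\<lambda>x. iexp (- (t * x)))"
      by (rule \<mu>.integrable_const_bound[where B = 1]) auto
    have "(CLINT x|\<mu>. cnj (H x) * iexp (t * x)) = cnj (CLINT x|\<mu>. iexp (- (t * x)) * H x)"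
      by (subst Bochner_Integration.integral_cnj[symmetric]) (simp add: exp_cnj mult.commute)
    also have "\<dots> = cnj (CLINT s|lborel. G s * (CLINT x|\<mu>. iexp (- (t * x)) * iexp (s * x)))"
      unfolding H_def
      by (subst integral_fourier_swap[OF _ _ ib G]) (auto intro: \<mu>.sigma_finite_measure_axioms)
    also have "\<dots> = (CLINT s|lborel. cnj (G s) * cnj (CLINT x|\<mu>. iexp (- (t * x)) * iexp (s * x)))"
      by (subst Bochner_Integration.integral_cnj[symmetric]) simp
    also have "(\<lambda>s. cnj (CLINT x|\<mu>. iexp (- (t * x)) * iexp (s * x))) = (\<lambda>s. char \<mu> (t - s))"
      unfolding char_def
      by (subst Bochner_Integration.integral_cnj[symmetric])
         (simp add: exp_cnj mult_exp_exp algebra_simps)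
    finally show ?thesis .
  qed
  have "(\<integral>\<^sup>+x. ennreal ((cmod (H x))\<^sup>2) \<partial>\<mu>) = (\<integral>\<^sup>+x. ennreal (cmod (cnj (H x) * H x)) \<partial>\<mu>)"
    by (simp add: norm_mult power2_eq_square)
  also have "\<dots> = (\<integral>\<^sup>+x. ennreal (Re (cnj (H x) * H x)) \<partial>\<mu>)"
    by (intro nn_integral_cong arg_cong[where f=ennreal])
       (simp add: norm_mult cmod_def power2_eq_square[symmetric] flip: power2_eq_square)
  also have "\<dots> = ennreal (\<integral>x. Re (cnj (H x) * H x) \<partial>\<mu>)"
    by (rule nn_integral_eq_integral[OF integrable_Re[OF iH2]]) auto
  also have "(\<integral>x. Re (cnj (H x) * H x) \<partial>\<mu>) = Re (CLINT x|\<mu>. cnj (H x) * H x)"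
    by (rule integral_Re[OF iH2])
  also have "(CLINT x|\<mu>. cnj (H x) * H x)
      = (CLINT t|lborel. G t * (CLINT x|\<mu>. cnj (H x) * iexp (t * x)))"
    unfolding H_def
    by (rule integral_fourier_swap) (use iH G in \<open>auto simp: H_def intro: \<mu>.sigma_finite_measure_axioms\<close>)
  also have "\<dots> = (CLINT t|lborel. G t * (CLINT s|lborel. cnj (G s) * char \<mu> (t - s)))"
    by (simp only: inner)
  also have "ennreal (Re \<dots>) \<le> ennreal (cmod \<dots>)"
    by (intro ennreal_leI complex_Re_le_cmod)
  also have "\<dots> \<le> (\<integral>\<^sup>+t. ennreal (cmod (G t) * cmod (CLINT s|lborel. cnj (G s) * char \<mu> (t - s))) \<partial>lborel)"
    by (rule order_trans[OF norm_integral_le_nn_integral]) (simp add: norm_mult)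
  also have "\<dots> \<le> (\<integral>\<^sup>+t. \<integral>\<^sup>+s. ennreal ((cmod (G t))\<^sup>2 / 2 * cmod (char \<mu> (t - s)))
        + ennreal ((cmod (G s))\<^sup>2 / 2 * cmod (char \<mu> (t - s))) \<partial>lborel \<partial>lborel)"
  proof (intro nn_integral_mono)
    fix t
    have "ennreal (cmod (G t) * cmod (CLINT s|lborel. cnj (G s) * char \<mu> (t - s)))
        \<le> ennreal (cmod (G t)) * (\<integral>\<^sup>+s. ennreal (cmod (G s) * cmod (char \<mu> (t - s))) \<partial>lborel)"
      by (subst ennreal_mult, simp, simp, intro mult_left_mono order_trans[OF norm_integral_le_nn_integral])
         (auto simp: norm_mult)
    also have "\<dots> = (\<integral>\<^sup>+s. ennreal (cmod (G t) * (cmod (G s) * cmod (char \<mu> (t - s)))) \<partial>lborel)"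
      by (subst nn_integral_cmult[symmetric]) (auto simp: ennreal_mult)
    also have "\<dots> \<le> (\<integral>\<^sup>+s. ennreal ((cmod (G t))\<^sup>2 / 2 * cmod (char \<mu> (t - s)))
        + ennreal ((cmod (G s))\<^sup>2 / 2 * cmod (char \<mu> (t - s))) \<partial>lborel)"
    proof (intro nn_integral_mono)
      fix s
      have "cmod (G t) * cmod (G s) \<le> (cmod (G t))\<^sup>2 / 2 + (cmod (G s))\<^sup>2 / 2"
        using sum_squares_bound[of "cmod (G t)" "cmod (G s)"] by (simp add: field_simps)
      then have "cmod (G t) * cmod (G s) * cmod (char \<mu> (t - s))
          \<le> ((cmod (G t))\<^sup>2 / 2 + (cmod (G s))\<^sup>2 / 2) * cmod (char \<mu> (t - s))"
        by (rule mult_right_mono) simp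
      then show "ennreal (cmod (G t) * (cmod (G s) * cmod (char \<mu> (t - s))))
        \<le> ennreal ((cmod (G t))\<^sup>2 / 2 * cmod (char \<mu> (t - s)))
          + ennreal ((cmod (G s))\<^sup>2 / 2 * cmod (char \<mu> (t - s)))"
        by (simp add: algebra_simps flip: ennreal_plus)
    qed
    finally show "ennreal (cmod (G t) * cmod (CLINT s|lborel. cnj (G s) * char \<mu> (t - s))) \<le> \<dots>" .
  qed
  \<comment> \<open>With the order swapped in the second summand only, each square stands outside
    and the remaining integral of \<open>cmod (char \<mu> (t - s))\<close> is the same by reflection
    or translation; the two halves then coincide.\<close>
  also have "\<dots> = (\<integral>\<^sup>+t. \<integral>\<^sup>+s. ennreal ((cmod (G t))\<^sup>2 / 2 * cmod (char \<mu> (t - s))) \<partial>lborel \<partial>lborel)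
      + (\<integral>\<^sup>+s. \<integral>\<^sup>+t. ennreal ((cmod (G s))\<^sup>2 / 2 * cmod (char \<mu> (t - s))) \<partial>lborel \<partial>lborel)"
    by (subst lborel_pair.Fubini') (auto simp: nn_integral_add)
  also have "(\<lambda>t. \<integral>\<^sup>+s. ennreal ((cmod (G t))\<^sup>2 / 2 * cmod (char \<mu> (t - s))) \<partial>lborel)
      = (\<lambda>t. ennreal ((cmod (G t))\<^sup>2 / 2) * (\<integral>\<^sup>+t. ennreal (cmod (char \<mu> t)) \<partial>lborel))"
  proof
    fix t
    show "(\<integral>\<^sup>+s. ennreal ((cmod (G t))\<^sup>2 / 2 * cmod (char \<mu> (t - s))) \<partial>lborel)
      = ennreal ((cmod (G t))\<^sup>2 / 2) * (\<integral>\<^sup>+t. ennreal (cmod (char \<mu> t)) \<partial>lborel)"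
      using nn_integral_real_affine[of "\<lambda>s. ennreal (cmod (char \<mu> s))" "-1" t]
      by (simp add: ennreal_mult nn_integral_cmult del: times_divide_eq_left)
  qed
  also have "(\<lambda>s. \<integral>\<^sup>+t. ennreal ((cmod (G s))\<^sup>2 / 2 * cmod (char \<mu> (t - s))) \<partial>lborel)
      = (\<lambda>s. ennreal ((cmod (G s))\<^sup>2 / 2) * (\<integral>\<^sup>+t. ennreal (cmod (char \<mu> t)) \<partial>lborel))"
  proof
    fix s
    show "(\<integral>\<^sup>+t. ennreal ((cmod (G s))\<^sup>2 / 2 * cmod (char \<mu> (t - s))) \<partial>lborel)
      = ennreal ((cmod (G s))\<^sup>2 / 2) * (\<integral>\<^sup>+t. ennreal (cmod (char \<mu> t)) \<partial>lborel)"
      using nn_integral_real_affine[of "\<lambda>t. ennreal (cmod (char \<mu> t))" 1 "- s"]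
      by (simp add: ennreal_mult nn_integral_cmult del: times_divide_eq_left)
  qed
  also have "(\<integral>\<^sup>+t. ennreal ((cmod (G t))\<^sup>2 / 2) * (\<integral>\<^sup>+t. ennreal (cmod (char \<mu> t)) \<partial>lborel) \<partial>lborel)
      + (\<integral>\<^sup>+t. ennreal ((cmod (G t))\<^sup>2 / 2) * (\<integral>\<^sup>+t. ennreal (cmod (char \<mu> t)) \<partial>lborel) \<partial>lborel)
      = (\<integral>\<^sup>+t. ennreal ((cmod (G t))\<^sup>2 / 2) + ennreal ((cmod (G t))\<^sup>2 / 2) \<partial>lborel)
        * (\<integral>\<^sup>+t. ennreal (cmod (char \<mu> t)) \<partial>lborel)"
    by (simp add: nn_integral_multc nn_integral_add distrib_right)
  also have "(\<lambda>t. ennreal ((cmod (G t))\<^sup>2 / 2) + ennreal ((cmod (G t))\<^sup>2 / 2)) = (\<lambda>t. ennreal ((cmod (G t))\<^sup>2))"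
    by (simp flip: ennreal_plus)
  finally show ?thesis
    by (simp add: H_def mult.commute)
qed

section \<open>Gaussian transforms and Plancherel's inequality\<close>

lemma gaussian_fourier:
  assumes "\<sigma> > 0"
  shows "integrable lborel (\<lambda>t. complex_of_real (exp (- (\<sigma> * t)\<^sup>2 / 2)))"
    and "(CLINT t|lborel. complex_of_real (exp (- (\<sigma> * t)\<^sup>2 / 2)) * iexp (t * w))
      = complex_of_real (2 * pi * (std_normal_density (w / \<sigma>) / \<sigma>))"
proof -
  have *: "complex_of_real (exp (- t\<^sup>2 / 2)) = complex_of_real (sqrt (2 * pi) * std_normal_density t)" for t
    by (simp add: std_normal_density_def)
  have "integrable lborel (\<lambda>t. complex_of_real (exp (- t\<^sup>2 / 2)))"
    unfolding * by (intro integrable_of_real integrable_mult_right) auto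
  from lborel_integrable_real_affine[OF this, of \<sigma> 0]
  show "integrable lborel (\<lambda>t. complex_of_real (exp (- (\<sigma> * t)\<^sup>2 / 2)))"
    using assms by simp
  have "complex_of_real (exp (- (w / \<sigma>)\<^sup>2 / 2)) = char std_normal_distribution (w / \<sigma>)"
    by (simp add: char_std_normal_distribution)
  also have "\<dots> = (CLINT x|lborel. std_normal_density x *\<^sub>R iexp (w / \<sigma> * x))"
    unfolding char_def by (subst integral_density) (auto simp: normal_density_nonneg)
  also have "\<dots> = \<sigma> *\<^sub>R (CLINT x|lborel. std_normal_density (\<sigma> * x) *\<^sub>R iexp (w * x))"
    using assms by (subst lborel_integral_real_affine[of \<sigma> _ 0]) auto
  also have "(CLINT x|lborel. std_normal_density (\<sigma> * x) *\<^sub>R iexp (w * x))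
    = (CLINT x|lborel. complex_of_real (1 / sqrt (2 * pi)) *
        (complex_of_real (exp (- (\<sigma> * x)\<^sup>2 / 2)) * iexp (x * w)))"
    by (rule Bochner_Integration.integral_cong)
       (auto simp: std_normal_density_def scaleR_conv_of_real mult_ac)
  also have "\<dots> = complex_of_real (1 / sqrt (2 * pi)) *
      (CLINT x|lborel. complex_of_real (exp (- (\<sigma> * x)\<^sup>2 / 2)) * iexp (x * w))"
    by (rule integral_mult_right_zero)
  finally have "(CLINT x|lborel. complex_of_real (exp (- (\<sigma> * x)\<^sup>2 / 2)) * iexp (x * w))
    = complex_of_real (sqrt (2 * pi) / \<sigma> * exp (- (w / \<sigma>)\<^sup>2 / 2))"
    using assms by (simp add: scaleR_conv_of_real field_simps)
  \<comment> \<open>Written as a normal density, so that integrals against it are recognised as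
    averages over a Gaussian of standard deviation \<open>\<sigma>\<close>.\<close>
  also have "sqrt (2 * pi) / \<sigma> * exp (- (w / \<sigma>)\<^sup>2 / 2) = 2 * pi * (std_normal_density (w / \<sigma>) / \<sigma>)"
    using real_sqrt_mult_self[of "2 * pi"] assms
    by (simp add: std_normal_density_def field_simps del: real_sqrt_mult_self)
  finally show "(CLINT t|lborel. complex_of_real (exp (- (\<sigma> * t)\<^sup>2 / 2)) * iexp (t * w))
      = complex_of_real (2 * pi * (std_normal_density (w / \<sigma>) / \<sigma>))" .
qed

lemma nn_integral_gaussian:
  assumes "\<sigma> > 0"
  shows "(\<integral>\<^sup>+t. ennreal (exp (- (\<sigma> * t)\<^sup>2 / 2)) \<partial>lborel) = ennreal (sqrt (2 * pi) / \<sigma>)"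
proof -
  have i: "integrable lborel (\<lambda>t. exp (- (\<sigma> * t)\<^sup>2 / 2))"
    using integrable_Re[OF gaussian_fourier(1)[OF assms]] by simp
  have "(CLINT t|lborel. complex_of_real (exp (- (\<sigma> * t)\<^sup>2 / 2)))
      = complex_of_real (2 * pi * (std_normal_density 0 / \<sigma>))"
    using gaussian_fourier(2)[OF assms, of 0] by simp
  then have "(\<integral>t. exp (- (\<sigma> * t)\<^sup>2 / 2) \<partial>lborel) = 2 * pi * (std_normal_density 0 / \<sigma>)"
    by (simp only: integral_complex_of_real of_real_eq_iff)
  also have "\<dots> = sqrt (2 * pi) / \<sigma>"
    using real_sqrt_mult_self[of "2 * pi"] assms
    by (simp add: std_normal_density_def field_simps del: real_sqrt_mult_self)
  finally show ?thesis
    using i by (subst nn_integral_eq_integral) auto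
qed

text \<open>The normal law of variance \<open>\<sigma>\<^sup>2\<close> has density
  \<open>exp (- (x / \<sigma>)\<^sup>2 / 2)\<close> divided by
  \<open>\<sigma> * sqrt (2 * pi)\<close>, and its characteristic function has integral
  \<open>sqrt (2 * pi) / \<sigma>\<close>. The product of these two constants is
  \<open>2 * pi\<close> for every \<open>\<sigma>\<close>, so the bound survives the limit by
  Fatou's lemma.\<close>

lemma plancherel_le:
  fixes G :: "real \<Rightarrow> complex"
  assumes G: "integrable lborel G"
  shows "(\<integral>\<^sup>+x. ennreal ((cmod (CLINT t|lborel. iexp (t * x) * G t))\<^sup>2) \<partial>lborel)
     \<le> ennreal (2 * pi) * (\<integral>\<^sup>+t. ennreal ((cmod (G t))\<^sup>2) \<partial>lborel)"
proof -
  note [measurable] = borel_measurable_integrable[OF G]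
  define H where "H x = (CLINT t|lborel. iexp (t * x) * G t)" for x
  have [measurable]: "H \<in> borel_measurable borel" unfolding H_def by measurable
  define I where "I = (\<integral>\<^sup>+t. ennreal ((cmod (G t))\<^sup>2) \<partial>lborel)"
  have step: "(\<integral>\<^sup>+x. ennreal ((cmod (H x))\<^sup>2 * exp (- (x / \<sigma>)\<^sup>2 / 2)) \<partial>lborel) \<le> ennreal (2 * pi) * I"
    if \<sigma>: "\<sigma> > 0" for \<sigma>
  proof -
    interpret N: real_distribution std_normal_distribution
      by (rule real_dist_normal_dist)
    let ?\<mu> = "distr std_normal_distribution borel (\<lambda>x. \<sigma> * x)"
    have \<mu>: "real_distribution ?\<mu>"
      by (intro N.real_distribution_distr) auto
    have ch: "char ?\<mu> t = complex_of_real (exp (- (\<sigma> * t)\<^sup>2 / 2))" for t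
    proof -
      have "char ?\<mu> t = char std_normal_distribution (\<sigma> * t)"
        unfolding char_def by (subst integral_distr) (auto simp: mult_ac)
      then show ?thesis by (simp add: char_std_normal_distribution)
    qed
    have ich: "integrable lborel (char ?\<mu>)"
      unfolding ch by (rule gaussian_fourier(1)[OF \<sigma>])
    have "(\<integral>\<^sup>+x. ennreal ((cmod (H x))\<^sup>2 * exp (- (x / \<sigma>)\<^sup>2 / 2)) \<partial>lborel)
      = ennreal \<sigma> * (\<integral>\<^sup>+x. ennreal ((cmod (H (\<sigma> * x)))\<^sup>2 * exp (- x\<^sup>2 / 2)) \<partial>lborel)"
      using \<sigma> by (subst nn_integral_real_affine[where c=\<sigma> and t=0]) auto
    also have "\<dots> = ennreal \<sigma> * (\<integral>\<^sup>+x. ennreal (sqrt (2 * pi)) *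
        (ennreal (std_normal_density x) * ennreal ((cmod (H (\<sigma> * x)))\<^sup>2)) \<partial>lborel)"
      by (intro arg_cong2[where f="(*)"] refl nn_integral_cong)
         (simp add: std_normal_density_def ennreal_mult[symmetric] mult_ac)
    also have "\<dots> = ennreal (\<sigma> * sqrt (2 * pi)) * (\<integral>\<^sup>+x. ennreal ((cmod (H (\<sigma> * x)))\<^sup>2) \<partial>std_normal_distribution)"
      using \<sigma> by (simp add: nn_integral_cmult nn_integral_density ennreal_mult mult.assoc)
    also have "(\<integral>\<^sup>+x. ennreal ((cmod (H (\<sigma> * x)))\<^sup>2) \<partial>std_normal_distribution)
       = (\<integral>\<^sup>+x. ennreal ((cmod (H x))\<^sup>2) \<partial>?\<mu>)"
      by (subst nn_integral_distr) auto
    also have "\<dots> \<le> ennreal (sqrt (2 * pi) / \<sigma>) * I"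
      using fourier_L2_bound[OF \<mu> G ich] nn_integral_gaussian[OF \<sigma>]
      by (simp add: ch H_def I_def)
    also have "ennreal (\<sigma> * sqrt (2 * pi)) * \<dots> = ennreal (2 * pi) * I"
      using \<sigma> by (simp add: mult.assoc[symmetric] ennreal_mult[symmetric])
    finally show ?thesis by (simp add: mult_left_mono)
  qed
  \<comment> \<open>Along \<open>\<sigma> = Suc n\<close> the Gaussian weights tend to 1
    pointwise.\<close>
  have "(\<integral>\<^sup>+x. ennreal ((cmod (H x))\<^sup>2) \<partial>lborel)
      = (\<integral>\<^sup>+x. liminf (\<lambda>n. ennreal ((cmod (H x))\<^sup>2 * exp (- (x / real (Suc n))\<^sup>2 / 2))) \<partial>lborel)"
  proof (intro nn_integral_cong)
    fix x
    have "(\<lambda>n. x * inverse (real (Suc n))) \<longlonglongrightarrow> x * 0"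
      by (intro tendsto_intros LIMSEQ_inverse_real_of_nat)
    then have 0: "(\<lambda>n. x / real (Suc n)) \<longlonglongrightarrow> 0" by (simp add: divide_inverse)
    have "(\<lambda>n. ennreal ((cmod (H x))\<^sup>2 * exp (- (x / real (Suc n))\<^sup>2 / 2)))
        \<longlonglongrightarrow> ennreal ((cmod (H x))\<^sup>2 * exp (- 0\<^sup>2 / 2))"
      by (intro tendsto_intros 0) auto
    then show "ennreal ((cmod (H x))\<^sup>2)
        = liminf (\<lambda>n. ennreal ((cmod (H x))\<^sup>2 * exp (- (x / real (Suc n))\<^sup>2 / 2)))"
      by (intro lim_imp_Liminf[symmetric]) (simp_all del: of_nat_Suc)
  qed
  also have "\<dots> \<le> liminf (\<lambda>n. \<integral>\<^sup>+x. ennreal ((cmod (H x))\<^sup>2 * exp (- (x / real (Suc n))\<^sup>2 / 2)) \<partial>lborel)"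
    by (rule nn_integral_liminf) measurable
  also have "\<dots> \<le> liminf (\<lambda>n. ennreal (2 * pi) * I)"
    by (intro Liminf_mono always_eventually allI step) simp
  finally show ?thesis
    by (simp add: H_def I_def Liminf_const)
qed

section \<open>Recovering a density from an approximate Fourier transform\<close>

lemma real_distribution_density: "prob_density f \<Longrightarrow> real_distribution (density lborel (\<lambda>v. ennreal (f v)))"
  by (auto simp: real_distribution_def real_distribution_axioms_def intro: prob_space_density)

lemma char_density_eq_fourier:
  assumes "prob_density f"
  shows "char (density lborel (\<lambda>v. ennreal (f v))) = fourier f"
proof
  fix t
  have [measurable]: "f \<in> borel_measurable borel" and nn: "\<And>x. 0 \<le> f x"
    using assms by (auto simp: prob_density_def)
  show "char (density lborel (\<lambda>v. ennreal (f v))) t = fourier f t"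
    unfolding char_def fourier_def
    by (subst integral_density) (auto simp: nn scaleR_conv_of_real mult.commute)
qed

lemma prob_density_integrable:
  assumes "prob_density f"
  shows "integrable lborel f"
  using assms by (intro integrableI_nonneg) (auto simp: prob_density_def)

text \<open>Parseval by hand: the error \<open>Re (F x) - f x\<close> paired with a test function
  \<open>c\<close> is, up to \<open>2 * pi\<close>, the pairing of \<open>\<Phi> - fourier f\<close>
  with the transform of \<open>c\<close>, and Cauchy-Schwarz with \<open>plancherel_le\<close> for
  \<open>c\<close> bounds the latter. Since \<open>fourier f\<close> times the transform of
  \<open>c\<close> is not known to be integrable, the pairing is damped by Gaussians that tend to
  1.\<close>

lemma fourier_inversion_tested:
  fixes \<Phi> :: "real \<Rightarrow> complex" and f c :: "real \<Rightarrow> real"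
  defines "F \<equiv> \<lambda>x. complex_of_real (1 / (2 * pi)) * (CLINT t|lborel. iexp (- (t * x)) * \<Phi> t)"
  assumes f: "prob_density f" and \<Phi>: "integrable lborel \<Phi>" and B: "0 \<le> B"
    and le: "(\<integral>\<^sup>+t. ennreal ((cmod (\<Phi> t - fourier f t))\<^sup>2) \<partial>lborel) \<le> ennreal B"
    and c: "continuous_on UNIV c" "\<And>x. \<bar>c x\<bar> \<le> M" "integrable lborel c"
  shows "(\<integral>x. (Re (F x) - f x) * c x \<partial>lborel)\<^sup>2 \<le> B / (2 * pi) * (\<integral>x. (c x)\<^sup>2 \<partial>lborel)"
proof -
  let ?V = "density lborel (\<lambda>v. ennreal (f v))"
  interpret V: real_distribution ?V by (rule real_distribution_density[OF f])
  have f_int: "integrable lborel f" by (rule prob_density_integrable[OF f])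
  have f_nn: "0 \<le> f x" for x using f by (auto simp: prob_density_def)
  have M0: "0 \<le> M" using c(2)[of 0] by linarith
  note [measurable] = borel_measurable_integrable[OF \<Phi>] borel_measurable_integrable[OF c(3)]
    borel_measurable_integrable[OF f_int] V.char_measurable[unfolded char_density_eq_fourier[OF f]]
  have cc: "integrable lborel (\<lambda>x. complex_of_real (c x))" using c(3) by simp
  define ch where "ch t = (CLINT x|lborel. iexp (x * t) * complex_of_real (c x))" for t
  have [measurable]: "ch \<in> borel_measurable borel" unfolding ch_def by measurable
  have cnj_meas [measurable]: "cnj \<in> borel_measurable borel"
    by (intro borel_measurable_continuous_onI continuous_intros)
  define C1 where "C1 = (\<integral>x. \<bar>c x\<bar> \<partial>lborel)"
  have C1: "0 \<le> C1" by (simp add: C1_def)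
  have ch_le: "cmod (ch t) \<le> C1" for t
    unfolding ch_def C1_def using cmod_fourier_integral_le[of t "\<lambda>x. complex_of_real (c x)"] by simp
  define s where "s m = inverse (real (Suc m))" for m
  have s: "s m > 0" for m by (simp add: s_def)
  have s_lim: "s \<longlonglongrightarrow> 0" unfolding s_def by (rule LIMSEQ_inverse_real_of_nat)
  define e where "e m t = complex_of_real (exp (- (s m * t)\<^sup>2 / 2))" for m t
  have e_int: "integrable lborel (e m)" for m
    unfolding e_def by (rule gaussian_fourier(1)[OF s])
  have [measurable]: "e m \<in> borel_measurable borel" for m
    using borel_measurable_integrable[OF e_int[of m]] by simp
  have e_le: "cmod (e m t) \<le> 1" for m t by (simp add: e_def)
  define A where "A m = (CLINT t|lborel. (\<Phi> t - fourier f t) * (cnj (ch t) * e m t))" for m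
  have G_int: "integrable lborel (\<lambda>t. cnj (ch t) * e m t)" for m
    by (rule Bochner_Integration.integrable_bound[where f="\<lambda>t. C1 *\<^sub>R e m t"])
       (use e_int ch_le C1 in \<open>auto simp: norm_mult intro!: mult_right_mono\<close>)
  have c2_le: "(c x)\<^sup>2 \<le> M * \<bar>c x\<bar>" for x
    using mult_right_mono[OF c(2)[of x] abs_ge_zero[of "c x"]] by (simp add: power2_eq_square)
  have c2_int: "integrable lborel (\<lambda>x. (c x)\<^sup>2)"
    by (rule Bochner_Integration.integrable_bound[where f="\<lambda>t. M *\<^sub>R c t"])
       (use c(3) c2_le M0 in \<open>auto simp: abs_mult\<close>)

  \<comment> \<open>Uniform in \<open>m\<close>, because damping only decreases the transform of
    \<open>c\<close>.\<close>
  have A_le: "(cmod (A m))\<^sup>2 \<le> B * (2 * pi) * (\<integral>x. (c x)\<^sup>2 \<partial>lborel)" for m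
  proof -
    have "ennreal ((cmod (A m))\<^sup>2) = (ennreal (cmod (A m)))\<^sup>2"
      by (simp add: ennreal_power)
    also have "\<dots> \<le> (\<integral>\<^sup>+t. ennreal (cmod (\<Phi> t - fourier f t)) * ennreal (cmod (ch t)) \<partial>lborel)\<^sup>2"
      unfolding A_def
    proof (intro power_mono order_trans[OF norm_integral_le_nn_integral] nn_integral_mono)
      fix t
      have "cmod (ch t) * cmod (e m t) \<le> cmod (ch t)"
        using mult_left_mono[OF e_le norm_ge_zero] by simp
      then show "ennreal (cmod ((\<Phi> t - fourier f t) * (cnj (ch t) * e m t)))
           \<le> ennreal (cmod (\<Phi> t - fourier f t)) * ennreal (cmod (ch t))"
        by (auto simp: norm_mult ennreal_mult[symmetric] intro!: ennreal_leI mult_left_mono)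
    qed auto
    also have "\<dots> \<le> (\<integral>\<^sup>+t. (ennreal (cmod (\<Phi> t - fourier f t)))\<^sup>2 \<partial>lborel) * (\<integral>\<^sup>+t. (ennreal (cmod (ch t)))\<^sup>2 \<partial>lborel)"
      by (rule Cauchy_Schwarz_nn_integral) measurable
    also have "\<dots> \<le> ennreal B * (ennreal (2 * pi) * (\<integral>\<^sup>+x. ennreal ((c x)\<^sup>2) \<partial>lborel))"
      using le plancherel_le[OF cc]
      by (intro mult_mono) (auto simp: ennreal_power ch_def)
    also have "(\<integral>\<^sup>+x. ennreal ((c x)\<^sup>2) \<partial>lborel) = ennreal (\<integral>x. (c x)\<^sup>2 \<partial>lborel)"
      by (rule nn_integral_eq_integral[OF c2_int]) auto
    finally have "ennreal ((cmod (A m))\<^sup>2) \<le> ennreal (B * (2 * pi) * (\<integral>x. (c x)\<^sup>2 \<partial>lborel))"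
      using B by (simp add: ennreal_mult mult.assoc)
    then show ?thesis
      using B by (subst (asm) ennreal_le_iff) auto
  qed

  have Phi_e_le: "cmod (\<Phi> t) * (cmod (ch t) * cmod (e m t)) \<le> C1 * cmod (\<Phi> t)" for t m
    using mult_left_mono[OF mult_mono[OF ch_le[of t] e_le[of m t]], of "cmod (\<Phi> t)"] C1
    by (simp add: mult.commute)
  have Phi_lim: "(\<lambda>m. CLINT t|lborel. \<Phi> t * (cnj (ch t) * e m t)) \<longlonglongrightarrow> (CLINT t|lborel. \<Phi> t * cnj (ch t))"
  proof (rule integral_dominated_convergence[where w="\<lambda>t. C1 * cmod (\<Phi> t)"])
    show "AE t in lborel. (\<lambda>m. \<Phi> t * (cnj (ch t) * e m t)) \<longlonglongrightarrow> \<Phi> t * cnj (ch t)"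
    proof (intro AE_I2)
      fix t
      have "(\<lambda>m. \<Phi> t * (cnj (ch t) * e m t)) \<longlonglongrightarrow> \<Phi> t * (cnj (ch t) * complex_of_real (exp (- (0 * t)\<^sup>2 / 2)))"
        unfolding e_def by (intro tendsto_intros s_lim) simp
      then show "(\<lambda>m. \<Phi> t * (cnj (ch t) * e m t)) \<longlonglongrightarrow> \<Phi> t * cnj (ch t)" by simp
    qed
    show "AE t in lborel. cmod (\<Phi> t * (cnj (ch t) * e m t)) \<le> C1 * cmod (\<Phi> t)" for m
      using Phi_e_le by (auto simp: norm_mult)
  qed (use \<Phi> in auto)
  have F_bound: "cmod (CLINT t|lborel. iexp (- (t * x)) * \<Phi> t) \<le> (\<integral>t. cmod (\<Phi> t) \<partial>lborel)" for x
    by (rule order_trans[OF integral_norm_bound]) (simp add: norm_mult)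
  have F_eq: "(CLINT t|lborel. iexp (- (t * x)) * \<Phi> t) = cnj (CLINT t|lborel. iexp (t * x) * cnj (\<Phi> t))" for x
    by (subst Bochner_Integration.integral_cnj[symmetric]) (simp add: exp_cnj)
  have F_meas [measurable]: "F \<in> borel_measurable borel"
    unfolding F_def F_eq by measurable
  \<comment> \<open>For the integrable \<open>\<Phi>\<close> the order of integration can be
    exchanged in the undamped limit.\<close>
  have Phi_val: "(CLINT t|lborel. \<Phi> t * cnj (ch t)) = 2 * pi * (CLINT x|lborel. complex_of_real (c x) * F x)"
  proof -
    have "(CLINT t|lborel. \<Phi> t * cnj (ch t)) = cnj (CLINT t|lborel. cnj (\<Phi> t) * ch t)"
      by (subst Bochner_Integration.integral_cnj[symmetric]) simp
    also have "(CLINT t|lborel. cnj (\<Phi> t) * ch t)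
        = (CLINT x|lborel. complex_of_real (c x) * (CLINT t|lborel. iexp (t * x) * cnj (\<Phi> t)))"
      unfolding ch_def
      by (subst integral_fourier_swap[OF _ _ cc]) (use \<Phi> in \<open>auto simp: mult.commute intro: sigma_finite_lborel\<close>)
    also have "cnj \<dots> = (CLINT x|lborel. complex_of_real (c x) * (CLINT t|lborel. iexp (- (t * x)) * \<Phi> t))"
      unfolding F_eq by (subst Bochner_Integration.integral_cnj[symmetric]) simp
    also have "\<dots> = (CLINT x|lborel. 2 * pi * (complex_of_real (c x) * F x))"
      by (simp add: F_def)
    finally show ?thesis by (simp only: integral_mult_right_zero)
  qed

  \<comment> \<open>\<open>k m\<close> is \<open>c\<close> smoothed by a centred Gaussian of
    standard deviation \<open>s m\<close>. Continuity and boundedness of \<open>c\<close> make it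
    converge to \<open>c\<close> pointwise and boundedly.\<close>
  define k where "k m v = (\<integral>z. std_normal_density z * c (v + s m * z) \<partial>lborel)" for m v
  have nc_le: "\<bar>std_normal_density z * c (v + s m * z)\<bar> \<le> M * std_normal_density z" for m v z
    using mult_right_mono[OF c(2)[of "v + s m * z"] normal_density_nonneg[of 0 1 z]]
    by (simp add: abs_mult mult.commute normal_density_nonneg)
  have k_bound: "integrable lborel (\<lambda>z. std_normal_density z * c (v + s m * z))"
      "\<bar>k m v\<bar> \<le> M" for m v
  proof -
    show *: "integrable lborel (\<lambda>z. std_normal_density z * c (v + s m * z))"
      by (rule Bochner_Integration.integrable_bound[where f="\<lambda>z. M * std_normal_density z"])
         (use nc_le M0 in \<open>auto simp: normal_density_nonneg intro!: AE_I2 intro: order_trans\<close>)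
    have "\<bar>k m v\<bar> \<le> (\<integral>z. M * std_normal_density z \<partial>lborel)"
      unfolding k_def real_norm_def[symmetric]
      by (rule Bochner_Integration.integral_norm_bound_integral[OF *]) (use nc_le in auto)
    then show "\<bar>k m v\<bar> \<le> M" by simp
  qed
  have k_lim: "(\<lambda>m. k m v) \<longlonglongrightarrow> c v" for v
  proof -
    have "(\<lambda>m. k m v) \<longlonglongrightarrow> (\<integral>z. std_normal_density z * c v \<partial>lborel)"
      unfolding k_def
    proof (rule integral_dominated_convergence[where w="\<lambda>z. M * std_normal_density z"])
      show "AE z in lborel. (\<lambda>m. std_normal_density z * c (v + s m * z)) \<longlonglongrightarrow> std_normal_density z * c v"
      proof (intro AE_I2 tendsto_intros)
        fix z
        have "(\<lambda>m. v + s m * z) \<longlonglongrightarrow> v + 0 * z" by (intro tendsto_intros s_lim)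
        then show "(\<lambda>m. c (v + s m * z)) \<longlonglongrightarrow> c v"
          using c(1) by (auto intro: continuous_on_tendsto_compose)
      qed
    qed (use nc_le in auto)
    then show ?thesis by simp
  qed
  have kV_lim: "(\<lambda>m. \<integral>v. k m v \<partial>?V) \<longlonglongrightarrow> (\<integral>v. c v \<partial>?V)"
  proof (rule integral_dominated_convergence[where w="\<lambda>_. M"])
    show "k m \<in> borel_measurable ?V" for m
      unfolding k_def[abs_def] by measurable
  qed (use k_lim k_bound in auto)

  \<comment> \<open>The damped pairing acts on \<open>f\<close> through the smoothing of
    \<open>c\<close>: the frequency integral of the damping factor is again a Gaussian
    kernel.\<close>
  have f_val: "(CLINT t|lborel. fourier f t * (cnj (ch t) * e m t)) = complex_of_real (2 * pi * (\<integral>v. k m v \<partial>?V))" for m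
  proof -
    have K: "(CLINT t|lborel. iexp (t * v) * (cnj (ch t) * e m t)) = complex_of_real (2 * pi * k m v)" for v
    proof -
      have ib: "integrable lborel (\<lambda>t. e m t * iexp (- (t * v)))"
        by (rule Bochner_Integration.integrable_bound[OF e_int[of m]]) (auto simp: norm_mult)
      have "(CLINT t|lborel. iexp (t * v) * (cnj (ch t) * e m t))
          = cnj (CLINT t|lborel. (e m t * iexp (- (t * v))) * ch t)"
        by (subst Bochner_Integration.integral_cnj[symmetric]) (simp add: exp_cnj mult_ac e_def)
      also have "(CLINT t|lborel. (e m t * iexp (- (t * v))) * ch t)
          = (CLINT y|lborel. complex_of_real (c y) * (CLINT t|lborel. e m t * iexp (- (t * v)) * iexp (y * t)))"
        unfolding ch_def
        by (rule integral_fourier_swap[OF _ _ ib cc]) (auto intro: sigma_finite_lborel)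
      also have "\<dots> = (CLINT y|lborel. complex_of_real (c y) * (CLINT t|lborel. e m t * iexp (t * (y - v))))"
        by (simp add: mult.assoc mult_exp_exp algebra_simps)
      also have "\<dots> = (CLINT y|lborel. complex_of_real (c y * (2 * pi * (std_normal_density ((y - v) / s m) / s m))))"
        unfolding e_def gaussian_fourier(2)[OF s] by simp
      also have "\<dots> = complex_of_real (\<integral>y. c y * (2 * pi * (std_normal_density ((y - v) / s m) / s m)) \<partial>lborel)"
        by (rule integral_complex_of_real)
      also have "(\<integral>y. c y * (2 * pi * (std_normal_density ((y - v) / s m) / s m)) \<partial>lborel)
          = s m * (\<integral>z. c (v + s m * z) * (2 * pi * (std_normal_density z / s m)) \<partial>lborel)"
        using s[of m] by (subst lborel_integral_real_affine[where c="s m" and t=v]) auto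
      also have "\<dots> = s m * (\<integral>z. (2 * pi / s m) * (std_normal_density z * c (v + s m * z)) \<partial>lborel)"
        by (intro arg_cong[where f="(*) _"] Bochner_Integration.integral_cong) (auto simp: mult_ac)
      also have "\<dots> = 2 * pi * k m v"
        using s[of m] by (simp add: k_def)
      finally show ?thesis by simp
    qed
    have "(CLINT t|lborel. fourier f t * (cnj (ch t) * e m t))
        = (CLINT t|lborel. (cnj (ch t) * e m t) * (CLINT v|?V. 1 * iexp (t * v)))"
      by (simp add: char_density_eq_fourier[OF f, symmetric] char_def mult_ac)
    also have "\<dots> = (CLINT v|?V. 1 * (CLINT t|lborel. iexp (t * v) * (cnj (ch t) * e m t)))"
      by (rule integral_fourier_swap[symmetric]) (use G_int in \<open>auto intro: V.sigma_finite_measure_axioms\<close>)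
    also have "\<dots> = (CLINT v|?V. complex_of_real (2 * pi * k m v))"
      by (simp only: K mult_1)
    also have "\<dots> = complex_of_real (\<integral>v. 2 * pi * k m v \<partial>?V)"
      by (rule integral_complex_of_real)
    finally show ?thesis by simp
  qed

  have A_eq: "A m = (CLINT t|lborel. \<Phi> t * (cnj (ch t) * e m t)) - complex_of_real (2 * pi * (\<integral>v. k m v \<partial>?V))" for m
  proof -
    have fle: "cmod (fourier f t) \<le> 1" for t
      using V.cmod_char_le_1 by (simp add: char_density_eq_fourier[OF f])
    have "integrable lborel (\<lambda>t. \<Phi> t * (cnj (ch t) * e m t))"
      by (rule Bochner_Integration.integrable_bound[where f="\<lambda>t. C1 *\<^sub>R \<Phi> t"])
         (use \<Phi> Phi_e_le C1 in \<open>auto simp: norm_mult\<close>)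
    moreover have "integrable lborel (\<lambda>t. fourier f t * (cnj (ch t) * e m t))"
      by (rule Bochner_Integration.integrable_bound[OF G_int[of m]])
         (use mult_right_mono[OF fle] in \<open>auto simp: norm_mult\<close>)
    ultimately show ?thesis
      by (simp add: A_def left_diff_distrib f_val)
  qed
  \<comment> \<open>The limit of \<open>A\<close>; its real part is \<open>2 * pi\<close> times the
    tested error.\<close>
  define S where "S = 2 * pi * (CLINT x|lborel. complex_of_real (c x) * F x) - complex_of_real (2 * pi * (\<integral>v. c v \<partial>?V))"
  have "A \<longlonglongrightarrow> S"
    unfolding A_eq S_def Phi_val[symmetric]
    by (intro tendsto_intros Phi_lim kV_lim)
  then have "(\<lambda>m. (cmod (A m))\<^sup>2) \<longlonglongrightarrow> (cmod S)\<^sup>2"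
    by (intro tendsto_intros)
  then have S_le: "(cmod S)\<^sup>2 \<le> B * (2 * pi) * (\<integral>x. (c x)\<^sup>2 \<partial>lborel)"
    by (rule LIMSEQ_le_const2) (use A_le in auto)
  have cF_le: "cmod (complex_of_real (c x) * F x) \<le> \<bar>(1 / (2 * pi) * (\<integral>t. cmod (\<Phi> t) \<partial>lborel)) * c x\<bar>" for x
  proof -
    have "cmod (complex_of_real (c x) * F x) = \<bar>c x\<bar> / (2 * pi) * cmod (CLINT t|lborel. iexp (- (t * x)) * \<Phi> t)"
      by (simp add: F_def norm_mult norm_divide)
    also have "\<dots> \<le> \<bar>c x\<bar> / (2 * pi) * (\<integral>t. cmod (\<Phi> t) \<partial>lborel)"
      by (intro mult_left_mono F_bound) auto
    finally show ?thesis by (simp add: abs_mult mult.commute)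
  qed
  have iF: "integrable lborel (\<lambda>x. complex_of_real (c x) * F x)"
    by (rule Bochner_Integration.integrable_bound[where f="\<lambda>x. (1 / (2 * pi) * (\<integral>t. cmod (\<Phi> t) \<partial>lborel)) *\<^sub>R c x"])
       (use c(3) cF_le in auto)
  have ifc: "integrable lborel (\<lambda>x. f x * c x)"
    by (rule Bochner_Integration.integrable_bound[where f="\<lambda>t. M *\<^sub>R f t"])
       (use c f_int f_nn M0 mult_left_mono[OF c(2) f_nn] in \<open>auto simp: abs_mult mult.commute[of M]\<close>)
  have "(\<integral>v. c v \<partial>?V) = (\<integral>v. f v * c v \<partial>lborel)"
    by (subst integral_density) (auto simp: f_nn)
  then have "Re S = 2 * pi * ((\<integral>x. Re (complex_of_real (c x) * F x) \<partial>lborel) - (\<integral>v. f v * c v \<partial>lborel))"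
    unfolding S_def integral_Re[OF iF] by (simp add: algebra_simps)
  also have "(\<integral>x. Re (complex_of_real (c x) * F x) \<partial>lborel) - (\<integral>v. f v * c v \<partial>lborel)
      = (\<integral>x. Re (complex_of_real (c x) * F x) - f x * c x \<partial>lborel)"
    by (rule Bochner_Integration.integral_diff[symmetric, OF integrable_Re[OF iF] ifc])
  also have "\<dots> = (\<integral>x. (Re (F x) - f x) * c x \<partial>lborel)"
    by (simp add: algebra_simps)
  finally have "(2 * pi * (\<integral>x. (Re (F x) - f x) * c x \<partial>lborel))\<^sup>2 \<le> (cmod S)\<^sup>2"
    using abs_Re_le_cmod[of S] by (metis abs_le_square_iff abs_of_nonneg norm_ge_zero)
  with S_le have "(2 * pi)\<^sup>2 * (\<integral>x. (Re (F x) - f x) * c x \<partial>lborel)\<^sup>2 \<le> B * (2 * pi) * (\<integral>x. (c x)\<^sup>2 \<partial>lborel)"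
    by (simp add: power_mult_distrib)
  then show ?thesis
    by (simp add: power2_eq_square field_simps)
qed

text \<open>
  \<open>fourier f\<close> need not be integrable, so \<open>f\<close> is only recovered weakly: the error is tested against its own
  bounded truncations, which are a.e. limits of continuous functions.
\<close>
theorem fourier_inversion_L2_error:
  fixes \<Phi> :: "real \<Rightarrow> complex" and f :: "real \<Rightarrow> real"
  defines "F \<equiv> \<lambda>x. complex_of_real (1 / (2 * pi)) * (CLINT t|lborel. iexp (- (t * x)) * \<Phi> t)"
  assumes f: "prob_density f" and \<Phi>: "integrable lborel \<Phi>"
  shows "ennreal (2 * pi) * (\<integral>\<^sup>+x. ennreal ((Re (F x) - f x)\<^sup>2) \<partial>lborel)
       \<le> (\<integral>\<^sup>+t. ennreal ((cmod (\<Phi> t - fourier f t))\<^sup>2) \<partial>lborel)"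
proof (cases "(\<integral>\<^sup>+t. ennreal ((cmod (\<Phi> t - fourier f t))\<^sup>2) \<partial>lborel)" rule: ennreal_cases)
  case (real B)
  note [measurable] = borel_measurable_integrable[OF \<Phi>]
    borel_measurable_integrable[OF prob_density_integrable[OF f]]
  have cnj_meas [measurable]: "cnj \<in> borel_measurable borel"
    by (intro borel_measurable_continuous_onI continuous_intros)
  have F_eq: "(CLINT t|lborel. iexp (- (t * x)) * \<Phi> t) = cnj (CLINT t|lborel. iexp (t * x) * cnj (\<Phi> t))" for x
    by (subst Bochner_Integration.integral_cnj[symmetric]) (simp add: exp_cnj)
  have F_meas [measurable]: "F \<in> borel_measurable borel"
    unfolding F_def F_eq by measurable
  define F1 where "F1 = (\<integral>t. cmod (\<Phi> t) \<partial>lborel)"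
  have F_bound: "\<bar>Re (F x)\<bar> \<le> F1" for x
  proof -
    have "cmod (F x) \<le> 1 / (2 * pi) * F1"
      unfolding F_def F1_def norm_mult
      by (intro mult_mono order_trans[OF integral_norm_bound]) (auto simp: norm_mult norm_divide)
    also have "\<dots> \<le> 1 * F1"
      using pi_gt3 by (intro mult_right_mono) (auto simp: F1_def)
    finally show ?thesis using abs_Re_le_cmod[of "F x"] by simp
  qed
  define D where "D x = Re (F x) - f x" for x
  have [measurable]: "D \<in> borel_measurable borel" unfolding D_def by measurable
  \<comment> \<open>Truncation in space and in height makes the error square integrable without
    assuming what is to be shown, and still
    \<open>D x * \<eta> N x = (\<eta> N x)\<^sup>2\<close>.\<close>
  define \<eta> where "\<eta> N x = (if \<bar>x\<bar> \<le> real N \<and> \<bar>D x\<bar> \<le> real N then D x else 0)" for N :: nat and x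
  have [measurable]: "\<eta> N \<in> borel_measurable borel" for N unfolding \<eta>_def by measurable
  have \<eta>_le: "(\<integral>\<^sup>+x. ennreal ((\<eta> N x)\<^sup>2) \<partial>lborel) \<le> ennreal (B / (2 * pi))" for N
  proof -
    have "\<eta> N \<in> borel_measurable lebesgue"
      by (rule measurable_completion) measurable
    then have "\<eta> N measurable_on UNIV"
      by (rule lebesgue_measurable_imp_measurable_on) auto
    then obtain S g where S: "negligible S" and g: "\<And>m. continuous_on UNIV (g m)"
      and g_lim: "\<And>x. x \<notin> S \<Longrightarrow> (\<lambda>m. g m x) \<longlonglongrightarrow> \<eta> N x"
      unfolding measurable_on_def by auto
    have "AE x in lebesgue. x \<notin> S"
      using S by (simp add: negligible_iff_null_sets AE_not_in)
    then have AE_S: "AE x in lborel. x \<notin> S"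
      by (simp add: AE_completion_iff)
    \<comment> \<open>\<open>\<kappa>\<close> is 1 for \<open>\<bar>x\<bar> \<le> N\<close> and
      vanishes beyond \<open>N + 1\<close>. With the clipping at height \<open>N\<close> it makes
      the approximants continuous, bounded and integrable; the limit is unchanged because
      \<open>\<eta> N\<close> already obeys both cuts.\<close>
    define \<kappa> where "\<kappa> x = max 0 (min 1 (real N + 1 - \<bar>x\<bar>))" for x
    define c where "c m x = \<kappa> x * max (- real N) (min (real N) (g m x))" for m x
    have c_cont: "continuous_on UNIV (c m)" for m
      unfolding c_def \<kappa>_def by (intro continuous_intros g)
    have [measurable]: "c m \<in> borel_measurable borel" for m
      by (rule borel_measurable_continuous_onI[OF c_cont])
    have c_le: "\<bar>c m x\<bar> \<le> real N * indicator {- (real N + 1)..real N + 1} x" for m x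
    proof (cases "x \<in> {- (real N + 1)..real N + 1}")
      case True
      have "\<bar>\<kappa> x\<bar> * \<bar>max (- real N) (min (real N) (g m x))\<bar> \<le> 1 * real N"
        by (rule mult_mono) (auto simp: \<kappa>_def)
      with True show ?thesis by (simp add: c_def abs_mult)
    qed (auto simp: c_def \<kappa>_def)
    have ind_int: "integrable lborel (\<lambda>x. a * indicator {- (real N + 1)..real N + 1} x :: real)" for a
      by (intro integrable_mult_right integrable_real_indicator) auto
    have c_int: "integrable lborel (c m)" for m
      by (rule Bochner_Integration.integrable_bound[OF ind_int[of "real N"]])
         (use c_le in \<open>auto intro!: AE_I2 simp: abs_mult\<close>)
    have c_leN: "\<bar>c m x\<bar> \<le> real N" for m x
      using c_le[of m x] by (cases "x \<in> {- (real N + 1)..real N + 1}") auto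
    have c_lim: "AE x in lborel. (\<lambda>m. c m x) \<longlonglongrightarrow> \<eta> N x"
      using AE_S
    proof eventually_elim
      case (elim x)
      have "(\<lambda>m. c m x) \<longlonglongrightarrow> \<kappa> x * max (- real N) (min (real N) (\<eta> N x))"
        unfolding c_def by (intro tendsto_intros g_lim elim)
      also have "\<kappa> x * max (- real N) (min (real N) (\<eta> N x)) = \<eta> N x"
        by (auto simp: \<eta>_def \<kappa>_def max_def min_def)
      finally show ?case .
    qed
    have sq_lim: "(\<lambda>m. \<integral>x. (c m x)\<^sup>2 \<partial>lborel) \<longlonglongrightarrow> (\<integral>x. (\<eta> N x)\<^sup>2 \<partial>lborel)"
    proof (rule integral_dominated_convergence[where w="\<lambda>x. (real N)\<^sup>2 * indicator {- (real N + 1)..real N + 1} x"])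
      show "AE x in lborel. (\<lambda>m. (c m x)\<^sup>2) \<longlonglongrightarrow> (\<eta> N x)\<^sup>2"
        using c_lim by eventually_elim (intro tendsto_intros)
      have "(c m x)\<^sup>2 \<le> (real N)\<^sup>2 * indicator {- (real N + 1)..real N + 1} x" for m x
        using power_mono[OF c_le[of m x] abs_ge_zero, of 2]
        by (auto simp: power_mult_distrib indicator_def split: if_splits)
      then show "AE x in lborel. norm ((c m x)\<^sup>2) \<le> (real N)\<^sup>2 * indicator {- (real N + 1)..real N + 1} x" for m
        by auto
    qed (use ind_int in auto)
    have prod_lim: "(\<lambda>m. \<integral>x. D x * c m x \<partial>lborel) \<longlonglongrightarrow> (\<integral>x. D x * \<eta> N x \<partial>lborel)"
    proof (rule integral_dominated_convergence[where
          w="\<lambda>x. F1 * real N * indicator {- (real N + 1)..real N + 1} x + real N * \<bar>f x\<bar>"])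
      show "AE x in lborel. (\<lambda>m. D x * c m x) \<longlonglongrightarrow> D x * \<eta> N x"
        using c_lim by eventually_elim (intro tendsto_intros)
      have "\<bar>D x * c m x\<bar> \<le> F1 * real N * indicator {- (real N + 1)..real N + 1} x + real N * \<bar>f x\<bar>" for m x
      proof -
        have "\<bar>D x * c m x\<bar> \<le> (F1 + \<bar>f x\<bar>) * \<bar>c m x\<bar>"
          unfolding abs_mult using F_bound[of x] by (intro mult_right_mono) (auto simp: D_def)
        also have "\<dots> \<le> F1 * (real N * indicator {- (real N + 1)..real N + 1} x) + \<bar>f x\<bar> * real N"
          unfolding distrib_right
          by (intro add_mono mult_left_mono c_le c_leN) (auto simp: F1_def)
        finally show ?thesis by (simp add: mult_ac)
      qed
      then show "AE x in lborel. norm (D x * c m x) \<le> F1 * real N * indicator {- (real N + 1)..real N + 1} x + real N * \<bar>f x\<bar>" for m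
        by auto
    qed (use ind_int prob_density_integrable[OF f] in auto)
    have "(\<integral>x. D x * c m x \<partial>lborel)\<^sup>2 \<le> B / (2 * pi) * (\<integral>x. (c m x)\<^sup>2 \<partial>lborel)" for m
      using fourier_inversion_tested[OF f \<Phi> real(1) _ c_cont c_leN c_int] real(2)
      by (simp add: D_def F_def)
    then have "(\<integral>x. D x * \<eta> N x \<partial>lborel)\<^sup>2 \<le> B / (2 * pi) * (\<integral>x. (\<eta> N x)\<^sup>2 \<partial>lborel)"
      by (intro LIMSEQ_le[OF tendsto_power[OF prod_lim] tendsto_mult_left[OF sq_lim]]) auto
    moreover have "(\<lambda>x. D x * \<eta> N x) = (\<lambda>x. (\<eta> N x)\<^sup>2)"
      by (auto simp: \<eta>_def power2_eq_square)
    \<comment> \<open>With \<open>\<eta> N\<close> as its own test function the bound has the form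
      \<open>x * x \<le> a * x\<close>, hence \<open>x \<le> a\<close>.\<close>
    ultimately have *: "(\<integral>x. (\<eta> N x)\<^sup>2 \<partial>lborel) * (\<integral>x. (\<eta> N x)\<^sup>2 \<partial>lborel) \<le> B / (2 * pi) * (\<integral>x. (\<eta> N x)\<^sup>2 \<partial>lborel)"
      by (simp add: power2_eq_square)
    have **: "(\<integral>x. (\<eta> N x)\<^sup>2 \<partial>lborel) \<le> B / (2 * pi)"
    proof (cases "(\<integral>x. (\<eta> N x)\<^sup>2 \<partial>lborel) = 0")
      case False
      moreover have "0 \<le> (\<integral>x. (\<eta> N x)\<^sup>2 \<partial>lborel)" by simp
      ultimately have "0 < (\<integral>x. (\<eta> N x)\<^sup>2 \<partial>lborel)" by linarith
      with * show ?thesis by (rule mult_right_le_imp_le)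
    qed (use real(1) in simp)
    have "integrable lborel (\<lambda>x. (\<eta> N x)\<^sup>2)"
    proof (rule Bochner_Integration.integrable_bound[OF ind_int[of "(real N)\<^sup>2"]])
      have "(\<eta> N x)\<^sup>2 \<le> (real N)\<^sup>2 * indicator {- (real N + 1)..real N + 1} x" for x
        using power_mono[of "\<bar>D x\<bar>" "real N" 2] by (auto simp: \<eta>_def indicator_def)
      then show "AE x in lborel. norm ((\<eta> N x)\<^sup>2) \<le> norm ((real N)\<^sup>2 * indicator {- (real N + 1)..real N + 1} x)"
        by (auto simp: abs_mult)
    qed auto
    then have "(\<integral>\<^sup>+x. ennreal ((\<eta> N x)\<^sup>2) \<partial>lborel) = ennreal (\<integral>x. (\<eta> N x)\<^sup>2 \<partial>lborel)"
      by (rule nn_integral_eq_integral) auto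
    with ** show ?thesis by (simp add: ennreal_leI)
  qed
  have "(\<integral>\<^sup>+x. ennreal ((D x)\<^sup>2) \<partial>lborel) = (\<integral>\<^sup>+x. liminf (\<lambda>N. ennreal ((\<eta> N x)\<^sup>2)) \<partial>lborel)"
  proof (intro nn_integral_cong)
    fix x
    obtain N0 where N0: "max \<bar>x\<bar> \<bar>D x\<bar> \<le> real N0" using real_arch_simple by blast
    have "eventually (\<lambda>N. ennreal ((\<eta> N x)\<^sup>2) = ennreal ((D x)\<^sup>2)) sequentially"
      using eventually_ge_at_top[of N0] by eventually_elim (use N0 in \<open>auto simp: \<eta>_def\<close>)
    then show "ennreal ((D x)\<^sup>2) = liminf (\<lambda>N. ennreal ((\<eta> N x)\<^sup>2))"
      by (intro lim_imp_Liminf[symmetric] tendsto_eventually) auto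
  qed
  also have "\<dots> \<le> liminf (\<lambda>N. \<integral>\<^sup>+x. ennreal ((\<eta> N x)\<^sup>2) \<partial>lborel)"
    by (rule nn_integral_liminf) measurable
  also have "\<dots> \<le> liminf (\<lambda>N::nat. ennreal (B / (2 * pi)))"
    by (intro Liminf_mono always_eventually allI \<eta>_le)
  finally have "(\<integral>\<^sup>+x. ennreal ((D x)\<^sup>2) \<partial>lborel) \<le> ennreal (B / (2 * pi))"
    by (simp add: Liminf_const)
  then have "ennreal (2 * pi) * (\<integral>\<^sup>+x. ennreal ((D x)\<^sup>2) \<partial>lborel) \<le> ennreal (2 * pi) * ennreal (B / (2 * pi))"
    by (rule mult_left_mono) simp
  also have "\<dots> = ennreal B"
    using real(1) by (simp add: ennreal_mult[symmetric])
  finally show ?thesis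
    by (simp add: real(2) D_def)
qed simp

subsection \<open>Sample means and the law of the observations\<close>

text \<open>Centred values at distinct coordinates are orthogonal under the product measure, so only
  the diagonal terms survive, and dropping the centring increases them. With complex values the
  lemma serves both the atom estimator and the empirical characteristic function.\<close>

lemma PiM_sample_mean_variance:
  fixes \<xi> :: "'a \<Rightarrow> complex" and J :: "'i set"
  assumes M: "prob_space M" and J: "finite J" "J \<noteq> {}"
    and [measurable]: "\<xi> \<in> borel_measurable M" and bd: "\<And>y. cmod (\<xi> y) \<le> B"
  shows "(\<integral>\<^sup>+x. ennreal ((cmod ((\<Sum>j\<in>J. \<xi> (x j)) / of_nat (card J) - (CLINT y|M. \<xi> y)))\<^sup>2) \<partial>PiM J (\<lambda>_. M))
     \<le> ennreal ((\<integral>y. (cmod (\<xi> y))\<^sup>2 \<partial>M) / card J)"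
proof -
  interpret M: prob_space M by fact
  interpret P: product_prob_space "\<lambda>_. M" J ..
  let ?P = "PiM J (\<lambda>_. M)"
  have cnj_meas [measurable]: "cnj \<in> borel_measurable borel"
    by (intro borel_measurable_continuous_onI continuous_intros)
  define m where "m = (CLINT y|M. \<xi> y)"
  define N where "N = card J"
  have N: "N > 0" using J by (simp add: N_def card_gt_0_iff)
  define \<zeta> where "\<zeta> y = \<xi> y - m" for y
  have [measurable]: "\<zeta> \<in> borel_measurable M" unfolding \<zeta>_def by measurable
  define B' where "B' = B + cmod m"
  have B': "cmod (\<zeta> y) \<le> B'" for y
    unfolding \<zeta>_def B'_def using bd[of y] norm_triangle_ineq4[of "\<xi> y" m] by linarith
  have B'0: "0 \<le> B'" using B'[of undefined] norm_ge_zero order_trans by blast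
  have \<xi>_int: "integrable M \<xi>" by (rule M.integrable_const_bound[where B=B]) (use bd in auto)
  have \<zeta>_int: "integrable M \<zeta>" unfolding \<zeta>_def using \<xi>_int by simp
  have \<zeta>0: "(CLINT y|M. \<zeta> y) = 0"
    unfolding \<zeta>_def using \<xi>_int by (simp add: M.prob_space m_def)
  have \<zeta>2_int: "integrable M (\<lambda>y. \<zeta> y * cnj (\<zeta> y))"
    by (rule M.integrable_const_bound[where B="B' * B'"])
       (use B' B'0 in \<open>auto simp: norm_mult simp del: complex_mult_cnj intro!: mult_mono\<close>)
  define V where "V = (CLINT y|M. \<zeta> y * cnj (\<zeta> y))"
  have cross: "(CLINT x|?P. \<zeta> (x i) * cnj (\<zeta> (x j))) = (if i = j then V else 0)" if "i \<in> J" "j \<in> J" for i j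
  proof -
    \<comment> \<open>The factors outside \<open>i\<close> and \<open>j\<close> are 1, which puts a
      product of two coordinates into the form of a product over all of \<open>J\<close>; the case
      \<open>i = j\<close> is covered as well.\<close>
    define f where "f k y = (if k = i then \<zeta> y else 1) * (if k = j then cnj (\<zeta> y) else 1)" for k y
    have f_int: "integrable M (f k)" for k
    proof -
      have "integrable M (\<lambda>y. cnj (\<zeta> y))" using \<zeta>_int by simp
      then show ?thesis
        using \<zeta>_int \<zeta>2_int by (cases "k = i"; cases "k = j") (simp_all add: f_def[abs_def] del: complex_mult_cnj)
    qed
    have "(CLINT x|?P. (\<Prod>k\<in>J. f k (x k))) = (\<Prod>k\<in>J. CLINT y|M. f k y)"
      by (rule P.product_integral_prod) (use J f_int in auto)
    also have "(\<lambda>x. \<Prod>k\<in>J. f k (x k)) = (\<lambda>x. \<zeta> (x i) * cnj (\<zeta> (x j)))"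
      using that J by (auto simp: f_def prod.distrib)
    also have "(\<Prod>k\<in>J. CLINT y|M. f k y) = (if i = j then V else 0)"
    proof (cases "i = j")
      case True
      have "(\<Prod>k\<in>J. CLINT y|M. f k y) = (\<Prod>k\<in>J. if k = i then V else 1)"
        by (intro prod.cong refl) (auto simp: f_def True V_def M.prob_space simp del: complex_mult_cnj)
      also have "\<dots> = V" using that J by simp
      finally show ?thesis using True by simp
    next
      case False
      then have "(CLINT y|M. f i y) = 0" by (simp add: f_def \<zeta>0)
      then show ?thesis using False that J by (auto intro!: prod_zero)
    qed
    finally show ?thesis .
  qed
  have cross_int: "integrable ?P (\<lambda>x. \<zeta> (x i) * cnj (\<zeta> (x j)))" if "i \<in> J" "j \<in> J" for i j
  proof -
    have "(\<lambda>x. \<zeta> (x i)) \<in> borel_measurable ?P" "(\<lambda>x. \<zeta> (x j)) \<in> borel_measurable ?P"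
      using that by (auto intro: measurable_compose[OF measurable_component_singleton])
    then show ?thesis
      by (intro P.P.integrable_const_bound[where B="B' * B'"])
         (use B' B'0 in \<open>auto simp: norm_mult simp del: complex_mult_cnj intro!: mult_mono\<close>)
  qed
  have sum_eq: "(\<Sum>j\<in>J. \<zeta> (x j)) * cnj (\<Sum>j\<in>J. \<zeta> (x j)) = (\<Sum>i\<in>J. \<Sum>j\<in>J. \<zeta> (x i) * cnj (\<zeta> (x j)))" for x
    by (simp add: sum_product cnj_sum)
  have S_int: "integrable ?P (\<lambda>x. (\<Sum>j\<in>J. \<zeta> (x j)) * cnj (\<Sum>j\<in>J. \<zeta> (x j)))"
    unfolding sum_eq by (intro Bochner_Integration.integrable_sum cross_int)
  have S_val: "(CLINT x|?P. (\<Sum>j\<in>J. \<zeta> (x j)) * cnj (\<Sum>j\<in>J. \<zeta> (x j))) = of_nat N * V"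
    unfolding sum_eq using J cross_int
    by (simp add: Bochner_Integration.integral_sum cross N_def cong: sum.cong)
  have sq: "(cmod z)\<^sup>2 = Re (z * cnj z)" for z by (simp add: complex_norm_square[symmetric] cmod_power2 power2_eq_square)
  have mean: "(\<Sum>j\<in>J. \<xi> (x j)) / of_nat N - m = (\<Sum>j\<in>J. \<zeta> (x j)) / of_nat N" for x
    using N by (simp add: \<zeta>_def sum_subtractf N_def field_simps)
  have "(\<integral>\<^sup>+x. ennreal ((cmod ((\<Sum>j\<in>J. \<xi> (x j)) / of_nat N - m))\<^sup>2) \<partial>?P)
      = (\<integral>\<^sup>+x. ennreal (Re ((\<Sum>j\<in>J. \<zeta> (x j)) * cnj (\<Sum>j\<in>J. \<zeta> (x j))) / (real N)\<^sup>2) \<partial>?P)"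
    by (simp only: mean norm_divide power_divide sq[of "sum _ _"] norm_of_nat)
  also have "\<dots> = ennreal (\<integral>x. Re ((\<Sum>j\<in>J. \<zeta> (x j)) * cnj (\<Sum>j\<in>J. \<zeta> (x j))) / (real N)\<^sup>2 \<partial>?P)"
    by (rule nn_integral_eq_integral[OF integrable_divide[OF integrable_Re[OF S_int]]])
       (intro AE_I2, simp only: sq[symmetric], simp)
  also have "(\<integral>x. Re ((\<Sum>j\<in>J. \<zeta> (x j)) * cnj (\<Sum>j\<in>J. \<zeta> (x j))) / (real N)\<^sup>2 \<partial>?P)
      = Re (of_nat N * V) / (real N)\<^sup>2"
    by (simp only: integral_divide_zero integral_Re[OF S_int] S_val)
  also have "\<dots> = Re V / N"
    using N by (simp add: power2_eq_square)
  also have "Re V \<le> (\<integral>y. (cmod (\<xi> y))\<^sup>2 \<partial>M)"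
  proof -
    have i1: "integrable M (\<lambda>y. (cmod (\<xi> y))\<^sup>2)"
      by (rule M.integrable_const_bound[where B="B\<^sup>2"]) (use bd in \<open>auto intro!: power_mono\<close>)
    have "Re V = (\<integral>y. Re (\<zeta> y * cnj (\<zeta> y)) \<partial>M)"
      unfolding V_def by (rule integral_Re[OF \<zeta>2_int, symmetric])
    also have "\<dots> = (\<integral>y. ((cmod (\<xi> y))\<^sup>2 - 2 * Re (\<xi> y * cnj m)) + (cmod m)\<^sup>2 \<partial>M)"
      by (intro Bochner_Integration.integral_cong refl)
         (simp only: sq[symmetric] \<zeta>_def, simp add: cmod_power2 power2_diff algebra_simps)
    also have "\<dots> = (\<integral>y. (cmod (\<xi> y))\<^sup>2 \<partial>M) - 2 * Re (m * cnj m) + (cmod m)\<^sup>2"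
    proof -
      have i2: "integrable M (\<lambda>y. \<xi> y * cnj m)" using \<xi>_int by simp
      define r where "r y = Re (\<xi> y * cnj m)" for y
      have "(\<integral>y. r y \<partial>M) = Re (m * cnj m)"
        unfolding r_def integral_Re[OF i2] by (simp add: m_def)
      moreover have "integrable M r"
        using integrable_Re[OF i2] by (simp only: r_def[abs_def])
      ultimately show ?thesis
        unfolding r_def[symmetric] using i1 by (simp only: Bochner_Integration.integral_add
          Bochner_Integration.integral_diff integrable_mult_right Bochner_Integration.integrable_diff
          integrable_const M.integrable_const integral_mult_right_zero) (simp add: M.prob_space)
    qed
    also have "\<dots> \<le> (\<integral>y. (cmod (\<xi> y))\<^sup>2 \<partial>M)" by (simp only: sq[symmetric]) simp
    finally show ?thesis .
  qed
  finally show ?thesis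
    by (simp add: N_def m_def divide_right_mono ennreal_leI)
qed

section \<open>Characteristic functions of the model and elementary bounds\<close>

lemma char_law_Y:
  assumes f: "prob_density f" and p: "0 \<le> p" "p \<le> 1"
  shows "char (law_Y p f) t = complex_of_real p + complex_of_real (1 - p) * fourier f t"
proof -
  let ?V = "density lborel (\<lambda>v. ennreal (f v))" and ?A = "measure_pmf (bernoulli_pmf (1 - p))"
  interpret V: real_distribution ?V by (rule real_distribution_density[OF f])
  interpret pair_prob_space ?A ?V ..
  have m: "(\<lambda>(a, v). of_bool a * v :: real) \<in> borel_measurable (?A \<Otimes>\<^sub>M ?V)" by measurable
  have int: "integrable (?A \<Otimes>\<^sub>M ?V) (\<lambda>(a, v). iexp (t * (of_bool a * v)))"
    by (rule integrable_const_bound[where B=1]) auto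
  have "char (law_Y p f) t = (CLINT z|?A \<Otimes>\<^sub>M ?V. iexp (t * (case z of (a, v) \<Rightarrow> of_bool a * v)))"
    unfolding char_def law_Y_def by (rule integral_distr[OF m]) measurable
  also have "\<dots> = (CLINT z|?A \<Otimes>\<^sub>M ?V. (case z of (a, v) \<Rightarrow> iexp (t * (of_bool a * v))))"
    by (simp only: case_prod_unfold)
  also have "\<dots> = (CLINT a|?A. CLINT v|?V. iexp (t * (of_bool a * v)))"
    by (subst integral_fst'[OF int, symmetric]) simp
  also have "\<dots> = p + (1 - p) * char ?V t"
    using p by (subst integral_measure_pmf[of UNIV])
      (auto simp: UNIV_bool char_def scaleR_conv_of_real V.prob_space[simplified])
  finally show ?thesis by (simp add: char_density_eq_fourier[OF f])
qed

lemma real_distribution_law_X: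
  "prob_density k \<Longrightarrow> prob_density f \<Longrightarrow> real_distribution (law_X k p f)"
  by (auto simp: real_distribution_def real_distribution_axioms_def law_X_def convolution_def
      intro: prob_space_law_X[unfolded law_X_def convolution_def])

lemma char_law_X:
  assumes k: "prob_density k" and f: "prob_density f" and p: "0 \<le> p" "p \<le> 1"
  shows "char (law_X k p f) t
    = (complex_of_real p + complex_of_real (1 - p) * fourier f t) * char (law_Z k) t"
proof -
  interpret Y: prob_space "law_Y p f" by (rule prob_space_law_Y[OF f])
  interpret Z: prob_space "law_Z k" unfolding law_Z_def by (rule prob_space_density[OF k])
  interpret pair_prob_space "law_Y p f" "law_Z k" ..
  have int: "integrable (law_Y p f \<Otimes>\<^sub>M law_Z k) (\<lambda>(y, z). iexp (t * y) * iexp (t * z))"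
    by (rule integrable_const_bound[where B=1]) (auto simp: norm_mult)
  have "char (law_X k p f) t = (CLINT x|law_Y p f \<Otimes>\<^sub>M law_Z k. iexp (t * (case x of (y, z) \<Rightarrow> y + z)))"
    unfolding char_def law_X_def convolution_def by (rule integral_distr) measurable
  also have "\<dots> = (CLINT x|law_Y p f \<Otimes>\<^sub>M law_Z k. (case x of (y, z) \<Rightarrow> iexp (t * y) * iexp (t * z)))"
    by (simp add: case_prod_unfold mult_exp_exp algebra_simps)
  also have "\<dots> = (CLINT y|law_Y p f. CLINT z|law_Z k. iexp (t * y) * iexp (t * z))"
    by (subst integral_fst'[OF int, symmetric]) simp
  also have "\<dots> = char (law_Y p f) t * char (law_Z k) t"
    by (simp add: char_def)
  finally show ?thesis by (simp only: char_law_Y[OF f p])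
qed

lemma emp_char_cong: "(\<And>j. j \<in> J \<Longrightarrow> x j = y j) \<Longrightarrow> emp_char J x = emp_char J y"
  by (auto simp: emp_char_def fun_eq_iff intro!: arg_cong[where f="\<lambda>z. z / _"] sum.cong)

lemma cmod_emp_char_le_1: "cmod (emp_char J x t) \<le> 1"
proof -
  have "cmod (\<Sum>j\<in>J. iexp (t * x j)) \<le> (\<Sum>j\<in>J. cmod (iexp (t * x j)))" by (rule norm_sum)
  also have "\<dots> = real (card J)" by simp
  finally show ?thesis by (cases "card J = 0") (auto simp: emp_char_def norm_divide divide_le_eq_1)
qed

lemma cmod_add3_square_le:
  "(cmod (a + b + c))\<^sup>2 \<le> 3 * (cmod a)\<^sup>2 + 3 * (cmod b)\<^sup>2 + 3 * (cmod c)\<^sup>2"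
proof -
  have "cmod (a + b + c) \<le> cmod a + cmod b + cmod c"
    by (meson norm_triangle_ineq norm_triangle_le add_mono order_refl order_trans)
  then have "(cmod (a + b + c))\<^sup>2 \<le> (cmod a + cmod b + cmod c)\<^sup>2"
    by (rule power_mono) simp
  also have "\<dots> = (cmod a)\<^sup>2 + (cmod b)\<^sup>2 + (cmod c)\<^sup>2
      + 2 * cmod a * cmod b + 2 * cmod a * cmod c + 2 * cmod b * cmod c"
    by (simp add: power2_eq_square algebra_simps)
  also have "\<dots> \<le> 3 * (cmod a)\<^sup>2 + 3 * (cmod b)\<^sup>2 + 3 * (cmod c)\<^sup>2"
    using sum_squares_bound[of "cmod a" "cmod b"] sum_squares_bound[of "cmod a" "cmod c"]
      sum_squares_bound[of "cmod b" "cmod c"] by linarith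
  finally show ?thesis .
qed

lemma emp_char_measurable [measurable]: "emp_char J x \<in> borel_measurable borel"
  unfolding emp_char_def[abs_def] by measurable

text \<open>\<open>b\<close> stands for the bias and \<open>D\<close> for the stochastic deviation.
  If \<open>\<bar>p - q\<bar>\<close> is at most \<open>(1 - ps) / 2\<close>, then
  \<open>1 - q\<close> is at least \<open>(1 - ps) / 2\<close> and \<open>\<epsilon>\<close> does
  not enter. If it is larger while \<open>b \<le> (1 - ps) / 4\<close>, at least half of it is due
  to \<open>D\<close>, so only \<open>D\<^sup>2\<close> is divided by
  \<open>\<epsilon>\<^sup>2\<close>. The indicator collects the remaining parameter values, where
  the trivial \<open>\<bar>p - q\<bar> \<le> 2\<close> is used.\<close>

lemma ratio_square_bound:
  fixes p ps \<epsilon> b D q :: real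
  assumes p: "0 \<le> p" "p \<le> ps" "ps < 1" and e: "0 < \<epsilon>" and b: "0 \<le> b"
    and q: "\<epsilon> \<le> 1 - q" "-1 \<le> q"
    and d: "ps \<le> 1 - \<epsilon> \<Longrightarrow> \<bar>p - q\<bar> \<le> b + \<bar>D\<bar>"
  shows "((p - q) / (1 - q))\<^sup>2 \<le> 8 / (1 - ps)\<^sup>2 * (b\<^sup>2 + D\<^sup>2) + 4 / \<epsilon>\<^sup>2 * D\<^sup>2
          + 4 / \<epsilon>\<^sup>2 * of_bool (ps > 1 - \<epsilon> \<or> b > (1 - ps) / 4)"
    (is "_ \<le> ?x + ?y + ?z")
proof -
  have nn: "0 \<le> ?x" "0 \<le> ?y" "0 \<le> ?z" by auto
  have base: "((p - q) / (1 - q))\<^sup>2 \<le> (p - q)\<^sup>2 / \<epsilon>\<^sup>2"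
    unfolding power_divide using q e by (intro divide_left_mono power_mono mult_pos_pos) auto
  consider "ps > 1 - \<epsilon> \<or> b > (1 - ps) / 4"
    | "ps \<le> 1 - \<epsilon>" "b \<le> (1 - ps) / 4" "\<bar>p - q\<bar> \<le> (1 - ps) / 2"
    | "ps \<le> 1 - \<epsilon>" "b \<le> (1 - ps) / 4" "\<bar>p - q\<bar> > (1 - ps) / 2"
    by linarith
  then show ?thesis
  proof cases
    case 1
    have "\<bar>p - q\<bar> \<le> \<bar>2\<bar>" using p q e by auto
    then have "(p - q)\<^sup>2 \<le> 4" by (subst (asm) abs_le_square_iff) simp
    then have "(p - q)\<^sup>2 / \<epsilon>\<^sup>2 \<le> 4 / \<epsilon>\<^sup>2" by (intro divide_right_mono) auto
    moreover have "?z = 4 / \<epsilon>\<^sup>2" using 1 by simp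
    ultimately show ?thesis using base nn by linarith
  next
    case 2
    have "(1 - ps) / 2 \<le> 1 - q" using 2(3) p abs_ge_minus_self[of "p - q"] by (simp add: field_simps)
    then have "((p - q) / (1 - q))\<^sup>2 \<le> (p - q)\<^sup>2 / ((1 - ps) / 2)\<^sup>2"
      unfolding power_divide[of "p - q"] using p q e by (intro divide_left_mono power_mono mult_pos_pos) auto
    also have "\<dots> \<le> (2 * (b\<^sup>2 + D\<^sup>2)) / ((1 - ps) / 2)\<^sup>2"
    proof (intro divide_right_mono)
      have "\<bar>p - q\<bar>\<^sup>2 \<le> (b + \<bar>D\<bar>)\<^sup>2" using d[OF 2(1)] by (intro power_mono) auto
      also have "\<dots> \<le> 2 * (b\<^sup>2 + D\<^sup>2)"
        using sum_squares_bound[of b "\<bar>D\<bar>"] by (simp add: power2_sum)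
      finally show "(p - q)\<^sup>2 \<le> 2 * (b\<^sup>2 + D\<^sup>2)" by simp
    qed auto
    also have "\<dots> = ?x" by (simp add: power_divide)
    finally show ?thesis using nn by linarith
  next
    case 3
    have "\<bar>p - q\<bar> \<le> 2 * \<bar>D\<bar>"
      using 3 d[OF 3(1)] by (auto simp: field_simps)
    then have "\<bar>p - q\<bar>\<^sup>2 \<le> (2 * \<bar>D\<bar>)\<^sup>2" by (intro power_mono) auto
    then have "(p - q)\<^sup>2 / \<epsilon>\<^sup>2 \<le> (4 * D\<^sup>2) / \<epsilon>\<^sup>2"
      by (intro divide_right_mono) (auto simp: power_mult_distrib)
    also have "(4 * D\<^sup>2) / \<epsilon>\<^sup>2 = ?y" by simp
    finally show ?thesis using base nn by linarith
  qed
qed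

lemma ennreal_mult3:
  "0 \<le> a \<Longrightarrow> 0 \<le> b \<Longrightarrow> 0 \<le> c \<Longrightarrow> ennreal a * (ennreal b * ennreal c) = ennreal (a * (b * c))"
  by (simp add: ennreal_mult)

lemma nn_integral_indicator_symmetric_interval:
  assumes "0 < (g::real)" "0 \<le> a"
  shows "(\<integral>\<^sup>+t. ennreal (a * indicator {-(1/g)..1/g} t) \<partial>lborel) = ennreal (a * (2 / g))"
proof -
  have "(\<integral>\<^sup>+t. ennreal (a * indicator {-(1/g)..1/g} t) \<partial>lborel)
      = (\<integral>\<^sup>+t. ennreal a * indicator {-(1/g)..1/g} t \<partial>lborel)"
    by (intro nn_integral_cong) (auto simp: indicator_def)
  also have "\<dots> = ennreal (a * (2 / g))"
    using assms by (subst nn_integral_cmult_indicator) (auto simp: ennreal_mult[symmetric])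
  finally show ?thesis .
qed

subsection \<open>The mean integrated squared error for fixed bandwidths\<close>

text \<open>Collects what stays fixed while \<open>p\<close> and \<open>f\<close> vary. Bounds
  phrased in these parameters alone are uniform over the class.\<close>

locale deconvolution =
  fixes \<alpha> K pstar U W :: real and \<phi>u \<phi>w :: "real \<Rightarrow> complex" and k :: "real \<Rightarrow> real"
  assumes \<alpha>: "0 < \<alpha>" and K: "0 < K" and pstar: "0 \<le> pstar" "pstar < 1" and U: "0 < U" and W: "0 < W"
    and u_meas [measurable]: "\<phi>u \<in> borel_measurable borel"
    and u_supp: "\<And>t. t \<notin> {-1..1} \<Longrightarrow> \<phi>u t = 0"
    and u_bound: "\<And>t. cmod (\<phi>u t) \<le> U * \<bar>t\<bar> powr \<alpha>"
    and u_int: "(CLINT t:{-1..1}|lborel. \<phi>u t) = 2"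
    and w_meas [measurable]: "\<phi>w \<in> borel_measurable borel"
    and w_supp: "\<And>t. t \<notin> {-1..1} \<Longrightarrow> \<phi>w t = 0"
    and w_bound: "\<And>t. cmod (\<phi>w t - 1) \<le> W * \<bar>t\<bar> powr \<alpha>"
    and k: "prob_density k"
    and Z_nz: "\<And>t. char (law_Z k) t \<noteq> 0"
    and Z_int: "integrable lborel (char (law_Z k))"
begin

abbreviation "\<phi>Z \<equiv> char (law_Z k)"

sublocale Z: real_distribution "law_Z k"
  unfolding law_Z_def by (rule real_distribution_density[OF k])

declare Z.char_measurable [measurable]

text \<open>The band is where a kernel transform rescaled by \<open>g\<close> can be nonzero. The
  product form bounds the reciprocal of \<open>cmod (\<phi>Z t)\<close> there without
  dividing.\<close>

definition "inverse_bound g Q \<longleftrightarrow> (\<forall>t. \<bar>t\<bar> \<le> 1 / g \<longrightarrow> 1 \<le> Q * cmod (\<phi>Z t))"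

definition "Z1 = (\<integral>t. cmod (\<phi>Z t) \<partial>lborel)"

lemma Z1_nonneg: "0 \<le> Z1" by (simp add: Z1_def)

lemma u_le: "cmod (\<phi>u t) \<le> U"
proof (cases "t \<in> {-1..1}")
  case True
  have "cmod (\<phi>u t) \<le> U * \<bar>t\<bar> powr \<alpha>" by (rule u_bound)
  also have "\<dots> \<le> U * 1"
    using True \<alpha> U by (intro mult_left_mono powr_le1) auto
  finally show ?thesis by simp
qed (use u_supp U in auto)

lemma w_le: "cmod (\<phi>w t) \<le> 1 + W"
proof (cases "t \<in> {-1..1}")
  case True
  have "cmod (\<phi>w t) \<le> 1 + cmod (\<phi>w t - 1)"
    using norm_triangle_ineq[of 1 "\<phi>w t - 1"] by simp
  also have "\<dots> \<le> 1 + W * \<bar>t\<bar> powr \<alpha>" by (intro add_left_mono w_bound)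
  also have "\<dots> \<le> 1 + W * 1"
    using True \<alpha> W by (intro add_left_mono mult_left_mono powr_le1) auto
  finally show ?thesis by simp
qed (use w_supp W in auto)

lemma w_le_indicator:
  assumes "0 < h"
  shows "cmod (\<phi>w (h * t)) \<le> (1 + W) * indicator {-(1/h)..1/h} t"
proof (cases "t \<in> {-(1/h)..1/h}")
  case False
  then have "h * t \<notin> {-1..1}" using assms by (auto simp: field_simps)
  then show ?thesis using False by (simp add: w_supp)
qed (use w_le in auto)

section \<open>The deconvolving kernel of the atom estimator and the explicit error bounds\<close>

definition "G g t = indicator {-(1/g)..1/g} t * \<phi>u (g * t) / \<phi>Z t"

lemma G_measurable [measurable]: "G g \<in> borel_measurable borel"
  unfolding G_def[abs_def] by measurable

lemma G_le:
  assumes Q: "inverse_bound g Q" and "0 < g"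
  shows "cmod (G g t) \<le> U * Q * indicator {-(1/g)..1/g} t"
proof (cases "t \<in> {-(1/g)..1/g}")
  case True
  then have "1 / cmod (\<phi>Z t) \<le> Q" using Q Z_nz[of t] by (auto simp: inverse_bound_def field_simps)
  then have "cmod (\<phi>u (g * t)) * (1 / cmod (\<phi>Z t)) \<le> U * Q"
    using U by (intro mult_mono u_le) auto
  with True show ?thesis by (simp add: G_def norm_mult norm_divide)
qed (simp add: G_def)

lemma G_int:
  assumes Q: "inverse_bound g Q" and g: "0 < g"
  shows "integrable lborel (G g)"
proof (rule Bochner_Integration.integrable_bound)
  show "integrable lborel (\<lambda>t. U * Q * indicator {-(1/g)..1/g} t :: real)"
    by (intro integrable_mult_right integrable_real_indicator) (auto simp: emeasure_lborel_Icc_eq)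
  show "AE t in lborel. norm (G g t) \<le> norm (U * Q * indicator {-(1/g)..1/g} t :: real)"
    using order_trans[OF G_le[OF Q g] abs_ge_self] by auto
qed simp

lemma G_L2:
  assumes Q: "inverse_bound g Q" and g: "0 < g"
  shows "(\<integral>\<^sup>+t. ennreal ((cmod (G g t))\<^sup>2) \<partial>lborel) \<le> ennreal (U\<^sup>2 * Q\<^sup>2 * (2 / g))"
proof -
  have "(cmod (G g t))\<^sup>2 \<le> U\<^sup>2 * Q\<^sup>2 * indicator {-(1/g)..1/g} t" for t
    using power_mono[OF G_le[OF Q g, of t] norm_ge_zero, of 2]
    by (auto simp: power_mult_distrib indicator_def split: if_splits)
  then have "(\<integral>\<^sup>+t. ennreal ((cmod (G g t))\<^sup>2) \<partial>lborel)
      \<le> (\<integral>\<^sup>+t. ennreal (U\<^sup>2 * Q\<^sup>2 * indicator {-(1/g)..1/g} t) \<partial>lborel)"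
    by (intro nn_integral_mono ennreal_leI)
  also have "\<dots> = ennreal (U\<^sup>2 * Q\<^sup>2 * (2 / g))"
    using g by (rule nn_integral_indicator_symmetric_interval) simp
  finally show ?thesis .
qed

text \<open>The atom estimator is the sample mean of \<open>xi g\<close>, the deconvolving kernel.\<close>
definition "xi g x = complex_of_real (g / 2) * (CLINT t|lborel. iexp (t * x) * G g t)"

lemma xi_measurable [measurable]: "xi g \<in> borel_measurable borel"
  unfolding xi_def[abs_def] by measurable

lemma xi_le: "0 < g \<Longrightarrow> cmod (xi g x) \<le> g / 2 * (\<integral>t. cmod (G g t) \<partial>lborel)"
  using mult_left_mono[OF cmod_fourier_integral_le[of x "G g"], of "g / 2"]
  by (simp add: xi_def norm_mult)

lemma atom_integral_eq_G:
  "atom_integral \<phi>u \<phi>Z g \<psi> = complex_of_real (g / 2) * (CLINT t|lborel. \<psi> t * G g t)"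
  unfolding atom_integral_def set_lebesgue_integral_def G_def
  by (intro arg_cong[where f="(*) _"] Bochner_Integration.integral_cong)
     (auto simp: indicator_def)

lemma atom_integral_emp_char:
  assumes Q: "inverse_bound g Q" and g: "0 < g"
  shows "atom_integral \<phi>u \<phi>Z g (emp_char J x) = (\<Sum>j\<in>J. xi g (x j)) / of_nat (card J)"
proof -
  have int: "integrable lborel (\<lambda>t. iexp (t * y) * G g t)" for y
    by (rule Bochner_Integration.integrable_bound[OF G_int[OF Q g]]) (auto simp: norm_mult)
  have "(CLINT t|lborel. emp_char J x t * G g t)
      = (CLINT t|lborel. (\<Sum>j\<in>J. iexp (t * x j) * G g t) / of_nat (card J))"
    by (simp add: emp_char_def sum_distrib_right)
  also have "\<dots> = (\<Sum>j\<in>J. CLINT t|lborel. iexp (t * x j) * G g t) / of_nat (card J)"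
    by (subst integral_divide_zero, subst Bochner_Integration.integral_sum) (use int in auto)
  finally show ?thesis
    by (simp add: atom_integral_eq_G xi_def sum_distrib_left)
qed

text \<open>Coefficients of the three error terms. The common 3 comes from squaring a sum of three;
  in \<open>atom_coeff\<close>, \<open>24 = 3 * 4 * 2\<close> with 4 from
  \<open>cmod (1 - \<phi>f t) \<le> 2\<close> and \<open>2 / h\<close> the length of the frequency
  band.\<close>

definition "bias_coeff h = 3 * W\<^sup>2 * K * h powr (2 * \<alpha>)"
definition "atom_coeff h = 24 * (1 + W)\<^sup>2 / h"
definition "noise_coeff Q = 3 * (1 + W)\<^sup>2 * Q\<^sup>2"

text \<open>Composed of \<open>(g / 2)\<^sup>2\<close> from \<open>xi\<close>, \<open>Z1\<close>
  bounding the integral of the characteristic function of the observations, and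
  \<open>U\<^sup>2 * Q\<^sup>2 * (2 / g)\<close> bounding the squared norm of \<open>G g\<close>,
  all divided by the sample size.\<close>

definition "var_bd g Q N = Z1 * U\<^sup>2 * g * Q\<^sup>2 / (2 * real N)"

definition "bias_sq g = U\<^sup>2 * K / 2 * g powr (2 * \<alpha> + 1)"

text \<open>\<open>ratio_square_bound\<close> in the mean, with \<open>b\<^sup>2\<close> replaced by
  \<open>bias_sq g\<close> and \<open>D\<^sup>2\<close> by the bound \<open>var_bd g Q N\<close> on
  its expectation.\<close>

definition "ratio_bd \<epsilon> g Q N = 8 / (1 - pstar)\<^sup>2 * (bias_sq g + var_bd g Q N) + 4 / \<epsilon>\<^sup>2 * var_bd g Q N
   + 4 / \<epsilon>\<^sup>2 * of_bool (pstar > 1 - \<epsilon> \<or> sqrt (bias_sq g) > (1 - pstar) / 4)"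

lemma var_bd_nonneg: "0 < g \<Longrightarrow> 0 \<le> var_bd g Q N"
  unfolding var_bd_def using Z1_nonneg by simp

lemma bias_sq_nonneg: "0 \<le> bias_sq g"
  unfolding bias_sq_def using K by simp

lemma ratio_bd_nonneg: "0 < g \<Longrightarrow> 0 \<le> ratio_bd \<epsilon> g Q N"
  unfolding ratio_bd_def using var_bd_nonneg[of g Q N] bias_sq_nonneg[of g] by simp

end

locale deconvolution_model = deconvolution +
  fixes p :: real and f :: "real \<Rightarrow> real"
  assumes p: "0 \<le> p" "p \<le> pstar" and f: "f \<in> density_class \<alpha> K"
begin

lemma f_density: "prob_density f"
  using f by (simp add: density_class_def)

abbreviation "\<phi>f \<equiv> fourier f"
abbreviation "X \<equiv> law_X k p f"
abbreviation "\<phi>X \<equiv> char X"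

sublocale X: real_distribution X
  by (rule real_distribution_law_X[OF k f_density])

sublocale V: real_distribution "density lborel (\<lambda>v. ennreal (f v))"
  by (rule real_distribution_density[OF f_density])

declare X.char_measurable [measurable]

lemma phif_measurable [measurable]: "\<phi>f \<in> borel_measurable borel"
  using V.char_measurable by (simp add: char_density_eq_fourier[OF f_density])

lemma phif_le: "cmod (\<phi>f t) \<le> 1"
  using V.cmod_char_le_1[of t] by (simp add: char_density_eq_fourier[OF f_density])

lemma phiX: "\<phi>X t = (complex_of_real p + complex_of_real (1 - p) * \<phi>f t) * \<phi>Z t"
  using p pstar by (intro char_law_X k f_density) auto

text \<open>\<open>\<phi>X\<close> is \<open>\<phi>Z\<close> times a convex combination of 1 and
  \<open>\<phi>f\<close>. Hence integrability of \<open>\<phi>Z\<close> passes to the law of the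
  observations, as \<open>fourier_L2_bound\<close> requires.\<close>

lemma phiX_le: "cmod (\<phi>X t) \<le> cmod (\<phi>Z t)"
proof -
  have "cmod (complex_of_real p + complex_of_real (1 - p) * \<phi>f t) \<le> p + (1 - p) * 1"
    using p pstar
    by (intro order_trans[OF norm_triangle_ineq] add_mono)
       (auto simp: norm_mult simp del: of_real_diff intro!: mult_left_le phif_le)
  then show ?thesis
    unfolding phiX norm_mult using mult_right_mono[of _ 1 "cmod (\<phi>Z t)"] by simp
qed

lemma phiX_integrable: "integrable lborel \<phi>X"
  by (rule Bochner_Integration.integrable_bound[OF Z_int]) (auto simp: phiX_le)

lemma phif_weighted: "(\<integral>\<^sup>+t. ennreal ((cmod (\<phi>f t) * \<bar>t\<bar> powr \<alpha>)\<^sup>2) \<partial>lborel) \<le> ennreal K"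
proof -
  have "(\<integral>\<^sup>+t. ennreal ((cmod (\<phi>f t) * \<bar>t\<bar> powr \<alpha>)\<^sup>2) \<partial>lborel)
     \<le> (\<integral>\<^sup>+t. ennreal ((cmod (\<phi>f t))\<^sup>2 * (1 + \<bar>t\<bar> powr (2 * \<alpha>))) \<partial>lborel)"
    by (intro nn_integral_mono ennreal_leI)
       (auto simp: power_mult_distrib power2_eq_square[of "_ powr _"] simp flip: powr_add intro!: mult_left_mono)
  also have "\<dots> \<le> ennreal K" using f by (simp add: density_class_def)
  finally show ?thesis .
qed

lemma atom_integral_char:
  assumes Q: "inverse_bound g Q" and g: "0 < g"
  shows "atom_integral \<phi>u \<phi>Z g \<phi>X = (CLINT x|X. xi g x)"
proof -
  have "(CLINT x|X. 1 * (CLINT t|lborel. iexp (t * x) * G g t)) = (CLINT t|lborel. G g t * (CLINT x|X. 1 * iexp (t * x)))"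
    by (rule integral_fourier_swap) (use G_int[OF Q g] in \<open>auto intro: X.sigma_finite_measure_axioms\<close>)
  then show ?thesis
    unfolding atom_integral_eq_G xi_def integral_mult_right_zero by (simp add: char_def mult.commute)
qed

text \<open>\<open>xi g\<close> is bounded by \<open>U * Q\<close>, which alone would give
  \<open>U\<^sup>2 * Q\<^sup>2\<close> over the sample size. Treating it as a Fourier transform in
  mean square with respect to the law of \<open>X\<close> gains the factor \<open>g\<close>.\<close>

lemma atom_variance:
  assumes Q: "inverse_bound g Q" and g: "0 < g"
    and J: "finite J" "J \<noteq> {}"
  shows "(\<integral>\<^sup>+x. ennreal ((cmod (atom_integral \<phi>u \<phi>Z g (emp_char J x) - atom_integral \<phi>u \<phi>Z g \<phi>X))\<^sup>2)
      \<partial>PiM J (\<lambda>_. X)) \<le> ennreal (var_bd g Q (card J))"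
proof -
  have "(\<integral>\<^sup>+x. ennreal ((cmod (atom_integral \<phi>u \<phi>Z g (emp_char J x) - atom_integral \<phi>u \<phi>Z g \<phi>X))\<^sup>2)
      \<partial>PiM J (\<lambda>_. X)) \<le> ennreal ((\<integral>y. (cmod (xi g y))\<^sup>2 \<partial>X) / card J)"
    unfolding atom_integral_emp_char[OF Q g] atom_integral_char[OF Q g]
    by (rule PiM_sample_mean_variance[OF X.prob_space_axioms J]) (auto intro: xi_le[OF g])
  also have "\<dots> \<le> ennreal (var_bd g Q (card J))"
  proof -
    have "(cmod (xi g y))\<^sup>2 \<le> (g / 2 * (\<integral>t. cmod (G g t) \<partial>lborel))\<^sup>2" for y
      by (intro power_mono xi_le[OF g] norm_ge_zero)
    then have "integrable X (\<lambda>y. (cmod (xi g y))\<^sup>2)"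
      by (intro X.integrable_const_bound[where B="(g / 2 * (\<integral>t. cmod (G g t) \<partial>lborel))\<^sup>2"]) auto
    then have "ennreal (\<integral>y. (cmod (xi g y))\<^sup>2 \<partial>X) = (\<integral>\<^sup>+y. ennreal ((cmod (xi g y))\<^sup>2) \<partial>X)"
      by (intro nn_integral_eq_integral[symmetric]) auto
    also have "\<dots> = ennreal ((g / 2)\<^sup>2) * (\<integral>\<^sup>+y. ennreal ((cmod (CLINT t|lborel. iexp (t * y) * G g t))\<^sup>2) \<partial>X)"
      by (subst nn_integral_cmult[symmetric])
         (auto simp: xi_def norm_mult norm_divide power_mult_distrib power_divide simp flip: ennreal_mult')
    also have "\<dots> \<le> ennreal ((g / 2)\<^sup>2) * (ennreal Z1 * ennreal (U\<^sup>2 * Q\<^sup>2 * (2 / g)))"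
    proof (intro mult_left_mono order_trans[OF fourier_L2_bound] mult_mono)
      have "(\<integral>\<^sup>+t. ennreal (cmod (\<phi>X t)) \<partial>lborel) \<le> (\<integral>\<^sup>+t. ennreal (cmod (\<phi>Z t)) \<partial>lborel)"
        by (intro nn_integral_mono ennreal_leI phiX_le)
      also have "\<dots> = ennreal Z1"
        unfolding Z1_def using Z_int by (intro nn_integral_eq_integral) auto
      finally show "(\<integral>\<^sup>+t. ennreal (cmod (\<phi>X t)) \<partial>lborel) \<le> ennreal Z1" .
    qed (use G_int[OF Q g] G_L2[OF Q g] phiX_integrable in \<open>auto intro: X.real_distribution_axioms\<close>)
    also have "\<dots> = ennreal (Z1 * U\<^sup>2 * g * Q\<^sup>2 / 2)"
    proof (subst ennreal_mult3)
      show "ennreal ((g / 2)\<^sup>2 * (Z1 * (U\<^sup>2 * Q\<^sup>2 * (2 / g)))) = ennreal (Z1 * U\<^sup>2 * g * Q\<^sup>2 / 2)"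
        using g by (simp add: power2_eq_square mult_ac)
    qed (use g Z1_nonneg in auto)
    finally have "(\<integral>y. (cmod (xi g y))\<^sup>2 \<partial>X) \<le> Z1 * U\<^sup>2 * g * Q\<^sup>2 / 2"
      using g Z1_nonneg by (subst (asm) ennreal_le_iff) auto
    then have "(\<integral>y. (cmod (xi g y))\<^sup>2 \<partial>X) / card J \<le> (Z1 * U\<^sup>2 * g * Q\<^sup>2 / 2) / card J"
      by (rule divide_right_mono) simp
    then show ?thesis
      unfolding var_bd_def by (intro ennreal_leI) simp
  qed
  finally show ?thesis .
qed

text \<open>The normalisation of \<open>\<phi>u\<close> reproduces \<open>p\<close> exactly. What is
  left is \<open>1 - p\<close> times an average of \<open>\<phi>f\<close> over the band, bounded by
  Cauchy-Schwarz with the weight \<open>\<bar>t\<bar> powr \<alpha>\<close> moved to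
  \<open>\<phi>f\<close>: the prefactor \<open>(g / 2)\<^sup>2\<close>, the decay
  \<open>g powr (2 * \<alpha>)\<close> and the band length \<open>2 / g\<close> combine to the
  exponent \<open>2 * \<alpha> + 1\<close>.\<close>

lemma atom_bias:
  assumes Q: "inverse_bound g Q" and g: "0 < g"
  shows "(cmod (atom_integral \<phi>u \<phi>Z g \<phi>X - complex_of_real p))\<^sup>2 \<le> U\<^sup>2 * K / 2 * g powr (2 * \<alpha> + 1)"
proof -
  let ?I = "\<lambda>t. indicator {-(1/g)..1/g} t :: real"
  have iu_le: "cmod (?I t *\<^sub>R \<phi>u (g * t)) \<le> norm (U * ?I t)" for t
    using u_le[of "g * t"] U by (auto simp: indicator_def)
  have I_int: "integrable lborel (\<lambda>t. U * ?I t)"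
    by (intro integrable_mult_right integrable_real_indicator) (auto simp: emeasure_lborel_Icc_eq)
  have iu: "integrable lborel (\<lambda>t. ?I t *\<^sub>R \<phi>u (g * t))"
    by (rule Bochner_Integration.integrable_bound[OF I_int]) (use iu_le in auto)
  have "cmod (\<phi>f t * (?I t *\<^sub>R \<phi>u (g * t))) \<le> cmod (?I t *\<^sub>R \<phi>u (g * t))" for t
    unfolding norm_mult[of "\<phi>f t"] by (intro mult_left_le_one_le phif_le) auto
  then have iuf: "integrable lborel (\<lambda>t. \<phi>f t * (?I t *\<^sub>R \<phi>u (g * t)))"
    by (intro Bochner_Integration.integrable_bound[OF iu]) auto
  have "(CLINT t|lborel. ?I t *\<^sub>R \<phi>u (g * t)) = (1 / g) *\<^sub>R (CLINT t:{-1..1}|lborel. \<phi>u t)"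
    unfolding set_lebesgue_integral_def
    using g by (subst (2) lborel_integral_real_affine[where c=g and t=0])
      (auto intro!: Bochner_Integration.integral_cong simp: indicator_def field_simps)
  then have norm1: "complex_of_real (g / 2) * (CLINT t|lborel. ?I t *\<^sub>R \<phi>u (g * t)) = 1"
    using g by (simp add: u_int scaleR_conv_of_real)
  define A B where "A = (CLINT t|lborel. ?I t *\<^sub>R \<phi>u (g * t))"
    and "B = (CLINT t|lborel. \<phi>f t * (?I t *\<^sub>R \<phi>u (g * t)))"
  have "(CLINT t|lborel. \<phi>X t * G g t)
      = (CLINT t|lborel. complex_of_real p * (?I t *\<^sub>R \<phi>u (g * t))
         + complex_of_real (1 - p) * (\<phi>f t * (?I t *\<^sub>R \<phi>u (g * t))))"
    by (intro Bochner_Integration.integral_cong refl)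
       (simp add: phiX G_def Z_nz scaleR_conv_of_real indicator_def field_simps)
  also have "\<dots> = complex_of_real p * A + complex_of_real (1 - p) * B"
    unfolding A_def B_def using iu iuf
    by (simp only: Bochner_Integration.integral_add integrable_mult_right integral_mult_right_zero)
  finally have "atom_integral \<phi>u \<phi>Z g \<phi>X
      = complex_of_real p * (complex_of_real (g / 2) * A) + complex_of_real (1 - p) * (complex_of_real (g / 2) * B)"
    unfolding atom_integral_eq_G by (simp only: distrib_left mult.left_commute)
  then have "atom_integral \<phi>u \<phi>Z g \<phi>X - complex_of_real p = complex_of_real (1 - p) * (complex_of_real (g / 2) * B)"
    using norm1 by (simp only: A_def) simp
  then have "cmod (atom_integral \<phi>u \<phi>Z g \<phi>X - complex_of_real p)
      = (1 - p) * (g / 2 * cmod (CLINT t|lborel. \<phi>f t * (?I t *\<^sub>R \<phi>u (g * t))))"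
    using p pstar g by (simp only: B_def norm_mult norm_of_real)
  also have "\<dots> \<le> g / 2 * cmod (CLINT t|lborel. \<phi>f t * (?I t *\<^sub>R \<phi>u (g * t)))"
    using p pstar g by (intro mult_left_le_one_le) auto
  finally have 1: "(cmod (atom_integral \<phi>u \<phi>Z g \<phi>X - complex_of_real p))\<^sup>2
      \<le> (g / 2)\<^sup>2 * (cmod (CLINT t|lborel. \<phi>f t * (?I t *\<^sub>R \<phi>u (g * t))))\<^sup>2"
    by (simp add: power_mono flip: power_mult_distrib)
  have "ennreal ((cmod (CLINT t|lborel. \<phi>f t * (?I t *\<^sub>R \<phi>u (g * t))))\<^sup>2)
      = (ennreal (cmod (CLINT t|lborel. \<phi>f t * (?I t *\<^sub>R \<phi>u (g * t)))))\<^sup>2"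
    by (simp add: ennreal_power)
  also have "\<dots> \<le> (\<integral>\<^sup>+t. ennreal (cmod (\<phi>f t) * \<bar>t\<bar> powr \<alpha>) * ennreal (U * g powr \<alpha> * ?I t) \<partial>lborel)\<^sup>2"
  proof (intro power_mono order_trans[OF norm_integral_le_nn_integral] nn_integral_mono)
    fix t
    have "cmod (\<phi>u (g * t)) \<le> U * (g powr \<alpha> * \<bar>t\<bar> powr \<alpha>)"
      using u_bound[of "g * t"] g by (simp add: abs_mult powr_mult)
    then have "cmod (\<phi>f t) * (?I t * cmod (\<phi>u (g * t))) \<le> cmod (\<phi>f t) * (?I t * (U * (g powr \<alpha> * \<bar>t\<bar> powr \<alpha>)))"
      by (intro mult_left_mono) auto
    then show "ennreal (cmod (\<phi>f t * (?I t *\<^sub>R \<phi>u (g * t))))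
        \<le> ennreal (cmod (\<phi>f t) * \<bar>t\<bar> powr \<alpha>) * ennreal (U * g powr \<alpha> * ?I t)"
      using U by (subst ennreal_mult[symmetric]) (auto simp: norm_mult mult_ac intro!: ennreal_leI)
  qed auto
  also have "\<dots> \<le> (\<integral>\<^sup>+t. (ennreal (cmod (\<phi>f t) * \<bar>t\<bar> powr \<alpha>))\<^sup>2 \<partial>lborel) * (\<integral>\<^sup>+t. (ennreal (U * g powr \<alpha> * ?I t))\<^sup>2 \<partial>lborel)"
    by (rule Cauchy_Schwarz_nn_integral) measurable
  also have "(\<integral>\<^sup>+t. (ennreal (U * g powr \<alpha> * ?I t))\<^sup>2 \<partial>lborel) = (\<integral>\<^sup>+t. ennreal ((U * g powr \<alpha>)\<^sup>2 * ?I t) \<partial>lborel)"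
    using U by (intro nn_integral_cong) (auto simp: ennreal_power indicator_def)
  also have "\<dots> = ennreal ((U * g powr \<alpha>)\<^sup>2 * (2 / g))"
    using g by (rule nn_integral_indicator_symmetric_interval) simp
  also have "(\<integral>\<^sup>+t. (ennreal (cmod (\<phi>f t) * \<bar>t\<bar> powr \<alpha>))\<^sup>2 \<partial>lborel) * ennreal ((U * g powr \<alpha>)\<^sup>2 * (2 / g))
      \<le> ennreal K * ennreal ((U * g powr \<alpha>)\<^sup>2 * (2 / g))"
    using phif_weighted by (intro mult_right_mono) (auto simp: ennreal_power)
  also have "\<dots> = ennreal (K * ((U * g powr \<alpha>)\<^sup>2 * (2 / g)))"
    using K g by (intro ennreal_mult[symmetric]) auto
  finally have 2: "(cmod (CLINT t|lborel. \<phi>f t * (?I t *\<^sub>R \<phi>u (g * t))))\<^sup>2 \<le> K * ((U * g powr \<alpha>)\<^sup>2 * (2 / g))"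
    using K g by (subst (asm) ennreal_le_iff) auto
  have "g powr (2 * \<alpha> + 1) = g powr \<alpha> * g powr \<alpha> * g powr 1"
    by (simp only: powr_add[symmetric]) simp
  then have "(g / 2)\<^sup>2 * (K * ((U * g powr \<alpha>)\<^sup>2 * (2 / g))) = U\<^sup>2 * K / 2 * g powr (2 * \<alpha> + 1)"
    using g by (simp add: power2_eq_square field_simps)
  with 1 2 show ?thesis
    using mult_left_mono[OF 2, of "(g / 2)\<^sup>2"] by simp
qed

section \<open>Integrated squared error of the density estimator\<close>

text \<open>Kept free of \<open>q\<close>, so that it depends on the data only through
  \<open>\<psi>\<close> and can be averaged separately from the atom estimator.\<close>

definition "noise_energy h \<psi> = (\<integral>\<^sup>+t. ennreal (indicator {-(1/h)..1/h} t * (cmod (\<psi> t - \<phi>X t))\<^sup>2) \<partial>lborel)"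

text \<open>Rests on \<open>p + (1 - p) * \<phi>f t - q = (1 - q) * \<phi>f t + (p - q) * (1 -
  \<phi>f t)\<close>, applied after dividing \<open>\<phi>X\<close> by
  \<open>\<phi>Z\<close>.\<close>

lemma error_decomposition:
  assumes "q \<noteq> 1"
  shows "(\<psi> - complex_of_real q * \<phi>Z t) / (complex_of_real (1 - q) * \<phi>Z t) * w - \<phi>f t
    = \<phi>f t * (w - 1) + complex_of_real ((p - q) / (1 - q)) * (1 - \<phi>f t) * w
      + (\<psi> - \<phi>X t) / (complex_of_real (1 - q) * \<phi>Z t) * w"
proof -
  have c: "complex_of_real (1 - q) \<noteq> 0" using assms by (simp del: of_real_diff)
  have z: "\<phi>Z t \<noteq> 0" by (rule Z_nz)
  have "(\<psi> - complex_of_real q * \<phi>Z t) / (complex_of_real (1 - q) * \<phi>Z t)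
      = (\<psi> - \<phi>X t) / (complex_of_real (1 - q) * \<phi>Z t)
        + (complex_of_real p + complex_of_real (1 - p) * \<phi>f t - complex_of_real q) / complex_of_real (1 - q)"
    using c z unfolding phiX by (simp add: divide_simps del: of_real_diff) (simp add: algebra_simps)
  also have "(complex_of_real p + complex_of_real (1 - p) * \<phi>f t - complex_of_real q) / complex_of_real (1 - q)
      = \<phi>f t + complex_of_real ((p - q) / (1 - q)) * (1 - \<phi>f t)"
    unfolding of_real_divide using c by (simp add: divide_simps del: of_real_diff) (simp add: algebra_simps)
  finally show ?thesis by (simp add: algebra_simps)
qed

text \<open>Deterministic: \<open>\<psi>\<close> is any measurable function bounded by 1 and
  \<open>q\<close> any number below 1. One bound thus serves both estimators, and all randomness is
  averaged afterwards.\<close>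

lemma dens_error:
  assumes Q: "inverse_bound h Q" and h: "0 < h" and \<psi> [measurable]: "\<psi> \<in> borel_measurable borel"
    and \<psi>_le: "\<And>t. cmod (\<psi> t) \<le> 1" and q: "q < 1"
  shows "(\<integral>\<^sup>+y. ennreal ((Re (dens_integral \<phi>w \<phi>Z h q \<psi> y) - f y)\<^sup>2) \<partial>lborel)
     \<le> ennreal (bias_coeff h) + ennreal (atom_coeff h * ((p - q) / (1 - q))\<^sup>2) + ennreal (noise_coeff Q / (1 - q)\<^sup>2) * noise_energy h \<psi>"
proof -
  let ?I = "\<lambda>t. indicator {-(1/h)..1/h} t :: real"
  let ?r = "(p - q) / (1 - q)"
  define \<Phi> where "\<Phi> t = (\<psi> t - complex_of_real q * \<phi>Z t) / (complex_of_real (1 - q) * \<phi>Z t) * \<phi>w (h * t)" for t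
  have [measurable]: "\<Phi> \<in> borel_measurable borel" unfolding \<Phi>_def[abs_def] by measurable
  have inv: "?I t / cmod (complex_of_real (1 - q) * \<phi>Z t) \<le> Q / (1 - q) * ?I t" for t
  proof (cases "t \<in> {-(1/h)..1/h}")
    case True
    then have "1 / cmod (\<phi>Z t) \<le> Q" using Q Z_nz[of t] by (auto simp: inverse_bound_def field_simps)
    then have "1 / cmod (\<phi>Z t) / (1 - q) \<le> Q / (1 - q)" using q by (intro divide_right_mono) auto
    then show ?thesis using True abs_of_pos[of "1 - q"] q by (simp add: norm_mult mult.commute del: of_real_diff)
  qed simp
  have Q0: "0 \<le> Q"
  proof (rule ccontr)
    assume "\<not> 0 \<le> Q"
    then have "Q * cmod (\<phi>Z 0) \<le> 0" by (intro mult_nonpos_nonneg) auto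
    then show False using Q h by (auto simp: inverse_bound_def dest!: spec[of _ 0])
  qed
  have wI: "cmod (\<phi>w (h * t)) \<le> (1 + W) * ?I t" for t by (rule w_le_indicator[OF h])
  have quot: "cmod (z / (complex_of_real (1 - q) * \<phi>Z t) * \<phi>w (h * t)) \<le> cmod z * (Q / (1 - q) * (1 + W) * ?I t)" for z t
  proof -
    have "cmod (z / (complex_of_real (1 - q) * \<phi>Z t) * \<phi>w (h * t))
        = cmod z * (cmod (\<phi>w (h * t)) / cmod (complex_of_real (1 - q) * \<phi>Z t))"
      by (simp add: norm_mult norm_divide del: of_real_diff)
    also have "\<dots> \<le> cmod z * (((1 + W) * ?I t) / cmod (complex_of_real (1 - q) * \<phi>Z t))"
      by (intro mult_left_mono divide_right_mono wI) auto
    also have "\<dots> = cmod z * ((1 + W) * (?I t / cmod (complex_of_real (1 - q) * \<phi>Z t)))" by simp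
    also have "\<dots> \<le> cmod z * ((1 + W) * (Q / (1 - q) * ?I t))"
      using W by (intro mult_left_mono inv) auto
    finally show ?thesis by (simp add: mult_ac)
  qed
  have \<Phi>_int: "integrable lborel \<Phi>"
  proof (rule Bochner_Integration.integrable_bound)
    show "integrable lborel (\<lambda>t. (1 + \<bar>q\<bar>) * (Q / (1 - q) * (1 + W)) * ?I t)"
      by (intro integrable_mult_right integrable_real_indicator) (auto simp: emeasure_lborel_Icc_eq)
    have "cmod (\<Phi> t) \<le> (1 + \<bar>q\<bar>) * (Q / (1 - q) * (1 + W)) * ?I t" for t
    proof -
      have "cmod (\<psi> t - complex_of_real q * \<phi>Z t) \<le> 1 + \<bar>q\<bar> * 1"
        using \<psi>_le[of t] mult_left_mono[OF Z.cmod_char_le_1[of t], of "\<bar>q\<bar>"]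
        by (intro order_trans[OF norm_triangle_ineq4]) (auto simp: norm_mult)
      then have "cmod (\<Phi> t) \<le> (1 + \<bar>q\<bar>) * (Q / (1 - q) * (1 + W) * ?I t)"
        unfolding \<Phi>_def using Q0 q W by (intro order_trans[OF quot] mult_right_mono) auto
      then show ?thesis by (simp only: mult.assoc)
    qed
    then show "AE t in lborel. norm (\<Phi> t) \<le> norm ((1 + \<bar>q\<bar>) * (Q / (1 - q) * (1 + W)) * ?I t)"
      unfolding real_norm_def by (blast intro: AE_I2 order_trans[OF _ abs_ge_self])
  qed simp
  have D: "dens_integral \<phi>w \<phi>Z h q \<psi> y = complex_of_real (1 / (2 * pi)) * (CLINT t|lborel. iexp (- (t * y)) * \<Phi> t)" for y
    unfolding dens_integral_def \<Phi>_def by (simp only: mult.assoc)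
  \<comment> \<open>The gain \<open>1 / (2 * pi)\<close> from inversion is given away; only
    \<open>2 * pi \<ge> 1\<close> is used.\<close>
  have "(\<integral>\<^sup>+y. ennreal ((Re (dens_integral \<phi>w \<phi>Z h q \<psi> y) - f y)\<^sup>2) \<partial>lborel)
     \<le> ennreal (2 * pi) * (\<integral>\<^sup>+y. ennreal ((Re (dens_integral \<phi>w \<phi>Z h q \<psi> y) - f y)\<^sup>2) \<partial>lborel)"
  proof -
    have "ennreal 1 \<le> ennreal (2 * pi)" using pi_gt3 by (intro ennreal_leI) simp
    from mult_right_mono[OF this] show ?thesis by simp
  qed
  also have "\<dots> \<le> (\<integral>\<^sup>+t. ennreal ((cmod (\<Phi> t - \<phi>f t))\<^sup>2) \<partial>lborel)"
    unfolding D by (rule fourier_inversion_L2_error[OF f_density \<Phi>_int])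
  also have "\<dots> \<le> (\<integral>\<^sup>+t. ennreal (3 * W\<^sup>2 * h powr (2 * \<alpha>)) * ennreal ((cmod (\<phi>f t) * \<bar>t\<bar> powr \<alpha>)\<^sup>2)
      + ennreal (12 * ?r\<^sup>2 * (1 + W)\<^sup>2 * ?I t)
      + ennreal (noise_coeff Q / (1 - q)\<^sup>2) * ennreal (?I t * (cmod (\<psi> t - \<phi>X t))\<^sup>2) \<partial>lborel)"
  proof (intro nn_integral_mono)
    fix t
    have Isq1: "(a * 2 * (b * ?I t))\<^sup>2 = 4 * a\<^sup>2 * b\<^sup>2 * ?I t"
      and Isq2: "(a * (b * ?I t))\<^sup>2 = b\<^sup>2 * (?I t * a\<^sup>2)" for a b
      by (auto simp: power_mult_distrib indicator_def)
    have t1: "(cmod (\<phi>f t * (\<phi>w (h * t) - 1)))\<^sup>2 \<le> W\<^sup>2 * h powr (2 * \<alpha>) * (cmod (\<phi>f t) * \<bar>t\<bar> powr \<alpha>)\<^sup>2"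
    proof -
      have "cmod (\<phi>f t * (\<phi>w (h * t) - 1)) \<le> cmod (\<phi>f t) * (W * \<bar>h * t\<bar> powr \<alpha>)"
        unfolding norm_mult by (intro mult_left_mono w_bound) auto
      also have "\<bar>h * t\<bar> powr \<alpha> = h powr \<alpha> * \<bar>t\<bar> powr \<alpha>"
        using h by (simp add: abs_mult powr_mult)
      finally have "(cmod (\<phi>f t * (\<phi>w (h * t) - 1)))\<^sup>2 \<le> (cmod (\<phi>f t) * (W * (h powr \<alpha> * \<bar>t\<bar> powr \<alpha>)))\<^sup>2"
        by (rule power_mono) simp
      also have "\<dots> = W\<^sup>2 * (h powr \<alpha>)\<^sup>2 * (cmod (\<phi>f t) * \<bar>t\<bar> powr \<alpha>)\<^sup>2"
        by (simp add: power_mult_distrib mult_ac)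
      also have "(h powr \<alpha>)\<^sup>2 = h powr (2 * \<alpha>)"
        by (simp add: power2_eq_square flip: powr_add)
      finally show ?thesis .
    qed
    have t2: "(cmod (complex_of_real ?r * (1 - \<phi>f t) * \<phi>w (h * t)))\<^sup>2 \<le> 4 * ?r\<^sup>2 * (1 + W)\<^sup>2 * ?I t"
    proof -
      have "cmod (1 - \<phi>f t) \<le> 2" using norm_triangle_ineq4[of 1 "\<phi>f t"] phif_le[of t] by simp
      then have "cmod (complex_of_real ?r * (1 - \<phi>f t) * \<phi>w (h * t)) \<le> \<bar>?r\<bar> * 2 * ((1 + W) * ?I t)"
        unfolding norm_mult norm_of_real using W by (intro mult_mono wI) auto
      then have "(cmod (complex_of_real ?r * (1 - \<phi>f t) * \<phi>w (h * t)))\<^sup>2 \<le> (\<bar>?r\<bar> * 2 * ((1 + W) * ?I t))\<^sup>2"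
        by (rule power_mono) simp
      also have "\<dots> = 4 * ?r\<^sup>2 * (1 + W)\<^sup>2 * ?I t"
        using Isq1[of "\<bar>?r\<bar>" "1 + W"] by (simp only: power2_abs)
      finally show ?thesis .
    qed
    have t3: "3 * (cmod ((\<psi> t - \<phi>X t) / (complex_of_real (1 - q) * \<phi>Z t) * \<phi>w (h * t)))\<^sup>2
        \<le> noise_coeff Q / (1 - q)\<^sup>2 * (?I t * (cmod (\<psi> t - \<phi>X t))\<^sup>2)"
    proof -
      have "(cmod ((\<psi> t - \<phi>X t) / (complex_of_real (1 - q) * \<phi>Z t) * \<phi>w (h * t)))\<^sup>2
          \<le> (cmod (\<psi> t - \<phi>X t) * (Q / (1 - q) * (1 + W) * ?I t))\<^sup>2"
        by (rule power_mono[OF quot]) simp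
      also have "\<dots> = (Q / (1 - q) * (1 + W))\<^sup>2 * (?I t * (cmod (\<psi> t - \<phi>X t))\<^sup>2)"
        by (rule Isq2)
      finally show ?thesis by (simp add: noise_coeff_def power_mult_distrib power_divide mult_ac)
    qed
    have "(cmod (\<Phi> t - \<phi>f t))\<^sup>2 \<le> 3 * W\<^sup>2 * h powr (2 * \<alpha>) * (cmod (\<phi>f t) * \<bar>t\<bar> powr \<alpha>)\<^sup>2
      + 12 * ?r\<^sup>2 * (1 + W)\<^sup>2 * ?I t + noise_coeff Q / (1 - q)\<^sup>2 * (?I t * (cmod (\<psi> t - \<phi>X t))\<^sup>2)"
      unfolding \<Phi>_def error_decomposition[OF less_imp_neq[OF q]]
      using t1 t2 t3 by (intro order_trans[OF cmod_add3_square_le]) linarith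
    then have "ennreal ((cmod (\<Phi> t - \<phi>f t))\<^sup>2) \<le> ennreal (3 * W\<^sup>2 * h powr (2 * \<alpha>) * (cmod (\<phi>f t) * \<bar>t\<bar> powr \<alpha>)\<^sup>2
      + 12 * ?r\<^sup>2 * (1 + W)\<^sup>2 * ?I t + noise_coeff Q / (1 - q)\<^sup>2 * (?I t * (cmod (\<psi> t - \<phi>X t))\<^sup>2))"
      by (rule ennreal_leI)
    also have "\<dots> = ennreal (3 * W\<^sup>2 * h powr (2 * \<alpha>)) * ennreal ((cmod (\<phi>f t) * \<bar>t\<bar> powr \<alpha>)\<^sup>2)
      + ennreal (12 * ?r\<^sup>2 * (1 + W)\<^sup>2 * ?I t)
      + ennreal (noise_coeff Q / (1 - q)\<^sup>2) * ennreal (?I t * (cmod (\<psi> t - \<phi>X t))\<^sup>2)"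
    proof -
      have nn: "0 \<le> 3 * W\<^sup>2 * h powr (2 * \<alpha>)" "0 \<le> (cmod (\<phi>f t) * \<bar>t\<bar> powr \<alpha>)\<^sup>2"
        "0 \<le> 12 * ?r\<^sup>2 * (1 + W)\<^sup>2 * ?I t" "0 \<le> noise_coeff Q / (1 - q)\<^sup>2" "0 \<le> ?I t * (cmod (\<psi> t - \<phi>X t))\<^sup>2"
        by (auto simp: noise_coeff_def)
      show ?thesis
        unfolding ennreal_mult[OF nn(1,2), symmetric] ennreal_mult[OF nn(4,5), symmetric]
          ennreal_plus[OF mult_nonneg_nonneg[OF nn(1,2)] nn(3), symmetric]
        by (rule ennreal_plus[OF add_nonneg_nonneg[OF mult_nonneg_nonneg[OF nn(1,2)] nn(3)] mult_nonneg_nonneg[OF nn(4,5)]])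
    qed
    finally show "ennreal ((cmod (\<Phi> t - \<phi>f t))\<^sup>2) \<le> \<dots>" .
  qed
  also have "\<dots> = ennreal (3 * W\<^sup>2 * h powr (2 * \<alpha>)) * (\<integral>\<^sup>+t. ennreal ((cmod (\<phi>f t) * \<bar>t\<bar> powr \<alpha>)\<^sup>2) \<partial>lborel)
      + (\<integral>\<^sup>+t. ennreal (12 * ?r\<^sup>2 * (1 + W)\<^sup>2 * ?I t) \<partial>lborel)
      + ennreal (noise_coeff Q / (1 - q)\<^sup>2) * noise_energy h \<psi>"
    unfolding noise_energy_def by (simp add: nn_integral_add nn_integral_cmult)
  also have "(\<integral>\<^sup>+t. ennreal (12 * ?r\<^sup>2 * (1 + W)\<^sup>2 * ?I t) \<partial>lborel) = ennreal (12 * ?r\<^sup>2 * (1 + W)\<^sup>2 * (2 / h))"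
    using h by (rule nn_integral_indicator_symmetric_interval) simp
  also have "12 * ?r\<^sup>2 * (1 + W)\<^sup>2 * (2 / h) = atom_coeff h * ?r\<^sup>2"
    by (simp add: atom_coeff_def)
  also have "ennreal (3 * W\<^sup>2 * h powr (2 * \<alpha>)) * (\<integral>\<^sup>+t. ennreal ((cmod (\<phi>f t) * \<bar>t\<bar> powr \<alpha>)\<^sup>2) \<partial>lborel)
      + ennreal (atom_coeff h * ?r\<^sup>2) + ennreal (noise_coeff Q / (1 - q)\<^sup>2) * noise_energy h \<psi>
    \<le> ennreal (3 * W\<^sup>2 * h powr (2 * \<alpha>)) * ennreal K
      + ennreal (atom_coeff h * ?r\<^sup>2) + ennreal (noise_coeff Q / (1 - q)\<^sup>2) * noise_energy h \<psi>"
    by (intro add_right_mono mult_left_mono phif_weighted) auto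
  also have "ennreal (3 * W\<^sup>2 * h powr (2 * \<alpha>)) * ennreal K = ennreal (bias_coeff h)"
    using K by (subst ennreal_mult[symmetric]) (auto simp: bias_coeff_def mult_ac)
  finally show ?thesis .
qed

lemma component_measurable:
  assumes "j \<in> I"
  shows "(\<lambda>x. x j) \<in> borel_measurable (PiM I (\<lambda>_. X))"
  using measurable_component_singleton[OF assms, of "\<lambda>_. X"]
  by (simp only: measurable_cong_sets[OF refl X.events_eq_borel])

lemma emp_char_pair_measurable:
  assumes "finite J" "J \<subseteq> I"
  shows "(\<lambda>z. emp_char J (fst z) (snd z)) \<in> borel_measurable (PiM I (\<lambda>_. X) \<Otimes>\<^sub>M lborel)"
proof -
  have [measurable]: "(\<lambda>z. fst z j) \<in> borel_measurable (PiM I (\<lambda>_. X) \<Otimes>\<^sub>M lborel)" if "j \<in> J" for j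
    by (rule measurable_compose[OF measurable_fst component_measurable]) (use that assms in auto)
  show ?thesis
    unfolding emp_char_def
    by (intro borel_measurable_divide borel_measurable_sum borel_measurable_const) measurable
qed

lemma noise_energy_measurable:
  assumes "finite J" "J \<subseteq> I"
  shows "(\<lambda>x. noise_energy h (emp_char J x)) \<in> borel_measurable (PiM I (\<lambda>_. X))"
proof -
  note [measurable] = emp_char_pair_measurable[OF assms]
  show ?thesis
    unfolding noise_energy_def by (rule lborel.borel_measurable_nn_integral) (simp add: case_prod_unfold)
qed

text \<open>At each frequency the variance is at most \<open>1 / card J\<close>, because
  \<open>iexp\<close> has modulus 1; Tonelli multiplies this by the band length
  \<open>2 / h\<close>.\<close>

lemma noise_energy_expectation:
  assumes J: "finite J" "J \<noteq> {}" and h: "0 < h"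
  shows "(\<integral>\<^sup>+x. noise_energy h (emp_char J x) \<partial>PiM J (\<lambda>_. X)) \<le> ennreal (2 / (h * card J))"
proof -
  note [measurable] = emp_char_pair_measurable[OF J(1) subset_refl]
  interpret P: product_prob_space "\<lambda>_. X" J ..
  interpret pair_sigma_finite "PiM J (\<lambda>_. X)" lborel ..
  let ?I = "\<lambda>t. indicator {-(1/h)..1/h} t :: real"
  have var: "(\<integral>\<^sup>+x. ennreal ((cmod (emp_char J x t - \<phi>X t))\<^sup>2) \<partial>PiM J (\<lambda>_. X)) \<le> ennreal (1 / card J)" for t
  proof -
    have "(\<integral>\<^sup>+x. ennreal ((cmod ((\<Sum>j\<in>J. iexp (t * x j)) / of_nat (card J) - (CLINT y|X. iexp (t * y))))\<^sup>2) \<partial>PiM J (\<lambda>_. X))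
       \<le> ennreal ((\<integral>y. (cmod (iexp (t * y)))\<^sup>2 \<partial>X) / card J)"
      by (rule PiM_sample_mean_variance[OF X.prob_space_axioms J, where B=1]) auto
    then show ?thesis
      using X.prob_space by (simp add: emp_char_def char_def)
  qed
  have "(\<integral>\<^sup>+x. noise_energy h (emp_char J x) \<partial>PiM J (\<lambda>_. X))
      = (\<integral>\<^sup>+t. \<integral>\<^sup>+x. ennreal (?I t * (cmod (emp_char J x t - \<phi>X t))\<^sup>2) \<partial>PiM J (\<lambda>_. X) \<partial>lborel)"
    unfolding noise_energy_def by (rule Fubini'[symmetric]) (simp add: case_prod_unfold)
  also have "\<dots> \<le> (\<integral>\<^sup>+t. ennreal (1 / card J * ?I t) \<partial>lborel)"
  proof (intro nn_integral_mono)
    fix t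
    show "(\<integral>\<^sup>+x. ennreal (?I t * (cmod (emp_char J x t - \<phi>X t))\<^sup>2) \<partial>PiM J (\<lambda>_. X)) \<le> ennreal (1 / card J * ?I t)"
      using var[of t] by (cases "t \<in> {-(1/h)..1/h}") auto
  qed
  also have "\<dots> = ennreal (1 / card J * (2 / h))"
    using h by (rule nn_integral_indicator_symmetric_interval) simp
  finally show ?thesis by (simp add: mult.commute)
qed

definition "ratio_sq \<epsilon> g \<psi> = ((p - atom_est \<phi>u \<phi>Z \<epsilon> g \<psi>) / (1 - atom_est \<phi>u \<phi>Z \<epsilon> g \<psi>))\<^sup>2"

lemma atom_est_le: "0 < \<epsilon> \<Longrightarrow> \<epsilon> < 1 \<Longrightarrow> \<epsilon> \<le> 1 - atom_est \<phi>u \<phi>Z \<epsilon> g \<psi>"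
  by (auto simp: atom_est_def)

lemma ratio_sq_measurable:
  assumes "inverse_bound g Q" "0 < g" "finite J" "J \<subseteq> I"
  shows "(\<lambda>x. ratio_sq \<epsilon> g (emp_char J x)) \<in> borel_measurable (PiM I (\<lambda>_. X))"
proof -
  have [measurable]: "(\<lambda>x. x j) \<in> measurable (PiM I (\<lambda>_. X)) borel" if "j \<in> J" for j
    using that assms by (intro component_measurable) auto
  have [measurable]: "(\<lambda>x. (\<Sum>j\<in>J. xi g (x j)) / complex_of_nat (card J)) \<in> borel_measurable (PiM I (\<lambda>_. X))"
    by (intro borel_measurable_divide borel_measurable_sum borel_measurable_const) measurable
  show ?thesis
    unfolding ratio_sq_def atom_est_def atom_integral_emp_char[OF assms(1,2)] by measurable
qed

lemma ratio_sq_expectation: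
  assumes Q: "inverse_bound g Q" and g: "0 < g" and e: "0 < \<epsilon>" "\<epsilon> < 1"
    and J: "finite J" "J \<noteq> {}"
  shows "(\<integral>\<^sup>+x. ennreal (ratio_sq \<epsilon> g (emp_char J x)) \<partial>PiM J (\<lambda>_. X)) \<le> ennreal (ratio_bd \<epsilon> g Q (card J))"
proof -
  interpret P: product_prob_space "\<lambda>_. X" J ..
  define m where "m = atom_integral \<phi>u \<phi>Z g \<phi>X"
  define D where "D x = cmod (atom_integral \<phi>u \<phi>Z g (emp_char J x) - m)" for x
  define A where "A = 8 / (1 - pstar)\<^sup>2 * bias_sq g
    + 4 / \<epsilon>\<^sup>2 * of_bool (pstar > 1 - \<epsilon> \<or> sqrt (bias_sq g) > (1 - pstar) / 4)"
  define B where "B = 8 / (1 - pstar)\<^sup>2 + 4 / \<epsilon>\<^sup>2"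
  have nn: "0 \<le> A" "0 \<le> B" unfolding A_def B_def using bias_sq_nonneg[of g] by auto
  have D_meas [measurable]: "D \<in> borel_measurable (PiM J (\<lambda>_. X))"
  proof -
    have [measurable]: "(\<lambda>x. x j) \<in> measurable (PiM J (\<lambda>_. X)) borel" if "j \<in> J" for j
      using that by (rule component_measurable)
    have [measurable]: "(\<lambda>x. (\<Sum>j\<in>J. xi g (x j)) / complex_of_nat (card J)) \<in> borel_measurable (PiM J (\<lambda>_. X))"
      by (intro borel_measurable_divide borel_measurable_sum borel_measurable_const) measurable
    show ?thesis
      unfolding D_def[abs_def] atom_integral_emp_char[OF Q g] by measurable
  qed
  have pw: "ratio_sq \<epsilon> g (emp_char J x) \<le> A + B * (D x)\<^sup>2" for x
  proof -
    define P where "P = atom_integral \<phi>u \<phi>Z g (emp_char J x)"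
    define q where "q = atom_est \<phi>u \<phi>Z \<epsilon> g (emp_char J x)"
    have q_eq: "q = max (- 1 + \<epsilon>) (min (Re P) (1 - \<epsilon>))" by (simp add: q_def atom_est_def P_def)
    have bias: "\<bar>Re m - p\<bar> \<le> sqrt (bias_sq g)"
    proof -
      have "\<bar>Re m - p\<bar> \<le> cmod (m - complex_of_real p)"
        using abs_Re_le_cmod[of "m - complex_of_real p"] by simp
      also have "\<dots> \<le> sqrt (bias_sq g)"
        using atom_bias[OF Q g] by (intro real_le_rsqrt) (simp add: m_def bias_sq_def)
      finally show ?thesis .
    qed
    have dev: "\<bar>Re P - Re m\<bar> \<le> \<bar>D x\<bar>"
      using abs_Re_le_cmod[of "P - m"] by (simp add: D_def P_def)
    \<comment> \<open>Once \<open>pstar \<le> 1 - \<epsilon>\<close>, the clipping interval contains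
      \<open>p\<close>, so clipping cannot increase the distance to \<open>p\<close>.\<close>
    have d: "\<bar>p - q\<bar> \<le> sqrt (bias_sq g) + \<bar>D x\<bar>" if "pstar \<le> 1 - \<epsilon>"
    proof -
      have "\<bar>p - q\<bar> \<le> \<bar>p - Re P\<bar>" using that p e unfolding q_eq by (auto simp: max_def min_def abs_if)
      then show ?thesis using bias dev by linarith
    qed
    have "ratio_sq \<epsilon> g (emp_char J x) \<le> 8 / (1 - pstar)\<^sup>2 * ((sqrt (bias_sq g))\<^sup>2 + (D x)\<^sup>2) + 4 / \<epsilon>\<^sup>2 * (D x)\<^sup>2
          + 4 / \<epsilon>\<^sup>2 * of_bool (pstar > 1 - \<epsilon> \<or> sqrt (bias_sq g) > (1 - pstar) / 4)"
      unfolding ratio_sq_def q_def[symmetric]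
      by (rule ratio_square_bound)
         (use p pstar e d bias_sq_nonneg in \<open>auto simp: q_eq\<close>)
    also have "\<dots> = A + B * (D x)\<^sup>2"
      unfolding A_def B_def using bias_sq_nonneg[of g] by (simp add: algebra_simps add_divide_distrib)
    finally show ?thesis .
  qed
  have "(\<integral>\<^sup>+x. ennreal (ratio_sq \<epsilon> g (emp_char J x)) \<partial>PiM J (\<lambda>_. X))
      \<le> (\<integral>\<^sup>+x. ennreal A + ennreal B * ennreal ((D x)\<^sup>2) \<partial>PiM J (\<lambda>_. X))"
  proof (intro nn_integral_mono)
    fix x
    show "ennreal (ratio_sq \<epsilon> g (emp_char J x)) \<le> ennreal A + ennreal B * ennreal ((D x)\<^sup>2)"
      using ennreal_leI[OF pw[of x]] nn by (simp add: ennreal_mult)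
  qed
  also have "\<dots> = ennreal A + ennreal B * (\<integral>\<^sup>+x. ennreal ((D x)\<^sup>2) \<partial>PiM J (\<lambda>_. X))"
    by (simp add: nn_integral_add nn_integral_cmult P.P.emeasure_space_1)
  also have "\<dots> \<le> ennreal A + ennreal B * ennreal (var_bd g Q (card J))"
    using atom_variance[OF Q g J] by (intro add_left_mono mult_left_mono) (auto simp: D_def m_def)
  also have "\<dots> = ennreal (A + B * var_bd g Q (card J))"
    using nn var_bd_nonneg[OF g] by (simp add: ennreal_mult)
  also have "A + B * var_bd g Q (card J) = ratio_bd \<epsilon> g Q (card J)"
    by (simp add: A_def B_def ratio_bd_def algebra_simps add_divide_distrib)
  finally show ?thesis .
qed

text \<open>Trades the worst case \<open>1 / \<epsilon>\<^sup>2\<close> for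
  \<open>1 + r\<^sup>2\<close>, with \<open>r\<close> the atom ratio, whose mean square stays
  bounded under the bandwidths of the polynomial case. The factor 2 is from
  \<open>(1 - r)\<^sup>2 \<le> 2 * (1 + r\<^sup>2)\<close>.\<close>

lemma inverse_clip_square_le:
  assumes "q < 1"
  shows "1 / (1 - q)\<^sup>2 \<le> 2 / (1 - pstar)\<^sup>2 * (1 + ((p - q) / (1 - q))\<^sup>2)"
proof -
  let ?r = "(p - q) / (1 - q)"
  have "1 - ?r = (1 - p) / (1 - q)"
    using assms by (simp add: field_simps)
  then have "1 / (1 - q) = (1 - ?r) / (1 - p)"
    using p pstar by simp
  then have "1 / (1 - q)\<^sup>2 = (1 - ?r)\<^sup>2 / (1 - p)\<^sup>2"
    by (metis power_divide power_one)
  also have "\<dots> \<le> (2 * (1 + ?r\<^sup>2)) / (1 - pstar)\<^sup>2"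
  proof (intro frac_le power_mono)
    show "(1 - ?r)\<^sup>2 \<le> 2 * (1 + ?r\<^sup>2)"
      using zero_le_power2[of "1 + ?r"] by (simp add: power2_sum power2_diff)
  qed (use p pstar in auto)
  finally show ?thesis by simp
qed

section \<open>Expected error under the two sampling schemes\<close>

text \<open>\<open>q\<close> and the noise come from the same observations, so
  \<open>1 / (1 - q)\<^sup>2\<close> is replaced by its worst value
  \<open>1 / \<epsilon>\<^sup>2\<close> before expectations are taken.\<close>

lemma mise_full_le:
  assumes n: "1 \<le> n" and e: "0 < \<epsilon>" "\<epsilon> < 1" and h: "0 < h" and g: "0 < g"
    and Qh: "inverse_bound h Qh" and Qg: "inverse_bound g Qg"
  shows "mise k n (full_est \<phi>u \<phi>w \<phi>Z \<epsilon> h g n) p f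
     \<le> ennreal (bias_coeff h + atom_coeff h * ratio_bd \<epsilon> g Qg n + noise_coeff Qh / \<epsilon>\<^sup>2 * (2 / (h * n)))"
proof -
  define J where "J = {1..n}"
  have J: "finite J" "J \<noteq> {}" "card J = n" using n by (auto simp: J_def)
  let ?P = "PiM J (\<lambda>_. X)"
  interpret P: product_prob_space "\<lambda>_. X" J ..
  note [measurable] = noise_energy_measurable[OF J(1) subset_refl, of h] ratio_sq_measurable[OF Qg g J(1) subset_refl, of \<epsilon>]
  have nn: "0 \<le> bias_coeff h" "0 \<le> atom_coeff h" "0 \<le> noise_coeff Qh" using K h by (auto simp: bias_coeff_def atom_coeff_def noise_coeff_def)
  have "mise k n (full_est \<phi>u \<phi>w \<phi>Z \<epsilon> h g n) p f
     \<le> (\<integral>\<^sup>+x. ennreal (bias_coeff h) + ennreal (atom_coeff h) * ennreal (ratio_sq \<epsilon> g (emp_char J x))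
          + ennreal (noise_coeff Qh / \<epsilon>\<^sup>2) * noise_energy h (emp_char J x) \<partial>?P)"
    unfolding mise_def sample_law_def J_def[symmetric]
  proof (intro nn_integral_mono)
    fix x
    define q where "q = atom_est \<phi>u \<phi>Z \<epsilon> g (emp_char J x)"
    have q: "\<epsilon> \<le> 1 - q" unfolding q_def by (rule atom_est_le[OF e])
    have "(\<integral>\<^sup>+y. ennreal ((full_est \<phi>u \<phi>w \<phi>Z \<epsilon> h g n x y - f y)\<^sup>2) \<partial>lborel)
       \<le> ennreal (bias_coeff h) + ennreal (atom_coeff h * ((p - q) / (1 - q))\<^sup>2) + ennreal (noise_coeff Qh / (1 - q)\<^sup>2) * noise_energy h (emp_char J x)"
      unfolding full_est_def J_def[symmetric] q_def[symmetric]
      by (rule dens_error[OF Qh h]) (use q e cmod_emp_char_le_1 in auto)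
    also have "\<dots> \<le> ennreal (bias_coeff h) + ennreal (atom_coeff h) * ennreal (ratio_sq \<epsilon> g (emp_char J x))
          + ennreal (noise_coeff Qh / \<epsilon>\<^sup>2) * noise_energy h (emp_char J x)"
    proof (intro add_mono mult_right_mono ennreal_leI divide_left_mono power_mono)
      show "ennreal (atom_coeff h * ((p - q) / (1 - q))\<^sup>2) \<le> ennreal (atom_coeff h) * ennreal (ratio_sq \<epsilon> g (emp_char J x))"
        using nn by (simp add: ratio_sq_def q_def ennreal_mult)
    qed (use q e nn in auto)
    finally show "(\<integral>\<^sup>+y. ennreal ((full_est \<phi>u \<phi>w \<phi>Z \<epsilon> h g n x y - f y)\<^sup>2) \<partial>lborel) \<le> \<dots>" .
  qed
  also have "\<dots> = ennreal (bias_coeff h) + ennreal (atom_coeff h) * (\<integral>\<^sup>+x. ennreal (ratio_sq \<epsilon> g (emp_char J x)) \<partial>?P)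
      + ennreal (noise_coeff Qh / \<epsilon>\<^sup>2) * (\<integral>\<^sup>+x. noise_energy h (emp_char J x) \<partial>?P)"
    by (simp add: nn_integral_add nn_integral_cmult P.P.emeasure_space_1)
  also have "\<dots> \<le> ennreal (bias_coeff h) + ennreal (atom_coeff h) * ennreal (ratio_bd \<epsilon> g Qg n)
      + ennreal (noise_coeff Qh / \<epsilon>\<^sup>2) * ennreal (2 / (h * n))"
    using ratio_sq_expectation[OF Qg g e J(1,2)] noise_energy_expectation[OF J(1,2) h]
    by (intro add_mono mult_left_mono) (auto simp: J(3))
  also have "\<dots> = ennreal (bias_coeff h + atom_coeff h * ratio_bd \<epsilon> g Qg n + noise_coeff Qh / \<epsilon>\<^sup>2 * (2 / (h * n)))"
  proof -
    have "0 \<le> atom_coeff h * ratio_bd \<epsilon> g Qg n" "0 \<le> noise_coeff Qh / \<epsilon>\<^sup>2" "0 \<le> 2 / (h * n)"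
      using nn ratio_bd_nonneg[OF g] h by auto
    then show ?thesis
      using nn ratio_bd_nonneg[OF g]
      by (simp only: ennreal_mult[symmetric] ennreal_plus[symmetric] add_nonneg_nonneg mult_nonneg_nonneg)
  qed
  finally show ?thesis .
qed

text \<open>\<open>q\<close> depends only on the coordinates in \<open>I\<close> and the noise only
  on those in \<open>J\<close>. Integrating over \<open>J\<close> first turns the mean of
  \<open>(1 + R x) * V x\<close> into a product of means.\<close>

lemma mise_split_le:
  assumes n: "2 \<le> n" and e: "0 < \<epsilon>" "\<epsilon> < 1" and h: "0 < h" and g: "0 < g"
    and Qh: "inverse_bound h Qh" and Qg: "inverse_bound g Qg"
  shows "mise k n (split_est \<phi>u \<phi>w \<phi>Z \<epsilon> h g n) p f
     \<le> ennreal (bias_coeff h + atom_coeff h * ratio_bd \<epsilon> g Qg (n div 2)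
         + noise_coeff Qh * (2 / (1 - pstar)\<^sup>2) * (1 + ratio_bd \<epsilon> g Qg (n div 2)) * (2 / (h * real (n - n div 2))))"
proof -
  define I J where "I = {1..n div 2}" and "J = {n div 2 + 1..n}"
  have I: "finite I" "I \<noteq> {}" "card I = n div 2" and J: "finite J" "J \<noteq> {}" "card J = n - n div 2"
    using n by (auto simp: I_def J_def)
  let ?PI = "PiM I (\<lambda>_. X)" and ?PJ = "PiM J (\<lambda>_. X)" and ?P = "PiM (I \<union> J) (\<lambda>_. X)"
  have IJ: "{1..n} = I \<union> J" "I \<inter> J = {}" using n by (auto simp: I_def J_def)
  interpret PI: product_prob_space "\<lambda>_. X" I ..
  interpret PJ: product_prob_space "\<lambda>_. X" J ..
  define R where "R x = ennreal (ratio_sq \<epsilon> g (emp_char I x))" for x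
  define V where "V x = noise_energy h (emp_char J x)" for x
  have R_meas [measurable]: "R \<in> borel_measurable ?P" "R \<in> borel_measurable ?PI"
    unfolding R_def[abs_def] using ratio_sq_measurable[OF Qg g I(1), of _ \<epsilon>] by auto
  have V_meas [measurable]: "V \<in> borel_measurable ?P" "V \<in> borel_measurable ?PJ"
    unfolding V_def[abs_def] by (auto intro!: noise_energy_measurable J(1))
  define split_coeff where "split_coeff = noise_coeff Qh * (2 / (1 - pstar)\<^sup>2)"
  have nn: "0 \<le> bias_coeff h" "0 \<le> atom_coeff h" "0 \<le> noise_coeff Qh" "0 \<le> split_coeff" using K h by (auto simp: bias_coeff_def atom_coeff_def noise_coeff_def split_coeff_def)
  define H where "H x = ennreal (bias_coeff h) + ennreal (atom_coeff h) * R x + ennreal split_coeff * (1 + R x) * V x" for x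
  have [measurable]: "H \<in> borel_measurable ?P" unfolding H_def[abs_def] by measurable
  have "mise k n (split_est \<phi>u \<phi>w \<phi>Z \<epsilon> h g n) p f \<le> (\<integral>\<^sup>+x. H x \<partial>?P)"
    unfolding mise_def sample_law_def IJ(1)
  proof (intro nn_integral_mono)
    fix x
    define q where "q = atom_est \<phi>u \<phi>Z \<epsilon> g (emp_char I x)"
    have q: "\<epsilon> \<le> 1 - q" unfolding q_def by (rule atom_est_le[OF e])
    have "(\<integral>\<^sup>+y. ennreal ((split_est \<phi>u \<phi>w \<phi>Z \<epsilon> h g n x y - f y)\<^sup>2) \<partial>lborel)
       \<le> ennreal (bias_coeff h) + ennreal (atom_coeff h * ((p - q) / (1 - q))\<^sup>2) + ennreal (noise_coeff Qh / (1 - q)\<^sup>2) * V x"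
      unfolding split_est_def I_def[symmetric] J_def[symmetric] q_def[symmetric] V_def
      by (rule dens_error[OF Qh h]) (use q e cmod_emp_char_le_1 in auto)
    also have "\<dots> \<le> H x"
      unfolding H_def
    proof (intro add_mono mult_right_mono order_refl)
      show "ennreal (atom_coeff h * ((p - q) / (1 - q))\<^sup>2) \<le> ennreal (atom_coeff h) * R x"
        using nn by (simp add: R_def ratio_sq_def q_def ennreal_mult)
      have "noise_coeff Qh * (1 / (1 - q)\<^sup>2) \<le> noise_coeff Qh * (2 / (1 - pstar)\<^sup>2 * (1 + ((p - q) / (1 - q))\<^sup>2))"
        by (intro mult_left_mono inverse_clip_square_le nn) (use q e in auto)
      then have "ennreal (noise_coeff Qh / (1 - q)\<^sup>2) \<le> ennreal (split_coeff * (1 + ((p - q) / (1 - q))\<^sup>2))"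
        by (intro ennreal_leI) (simp only: split_coeff_def mult.assoc mult_1_right times_divide_eq_right times_divide_eq_left)
      also have "\<dots> = ennreal split_coeff * (1 + R x)"
        unfolding R_def ratio_sq_def q_def[symmetric]
        by (subst ennreal_mult[OF nn(4)]) auto
      finally show "ennreal (noise_coeff Qh / (1 - q)\<^sup>2) \<le> ennreal split_coeff * (1 + R x)" .
    qed auto
    finally show "(\<integral>\<^sup>+y. ennreal ((split_est \<phi>u \<phi>w \<phi>Z \<epsilon> h g n x y - f y)\<^sup>2) \<partial>lborel) \<le> H x" .
  qed
  \<comment> \<open>Independence of the two halves, in the form of Fubini on the product over
    \<open>I \<union> J\<close>.\<close>
  also have "\<dots> = (\<integral>\<^sup>+x. \<integral>\<^sup>+y. H (merge I J (x, y)) \<partial>?PJ \<partial>?PI)"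
    by (rule PI.product_nn_integral_fold) (use IJ I J in auto)
  also have "\<dots> = (\<integral>\<^sup>+x. \<integral>\<^sup>+y. ennreal (bias_coeff h) + ennreal (atom_coeff h) * R x + ennreal split_coeff * (1 + R x) * V y \<partial>?PJ \<partial>?PI)"
  proof (intro nn_integral_cong)
    fix x y
    have "emp_char I (merge I J (x, y)) = emp_char I x" "emp_char J (merge I J (x, y)) = emp_char J y"
      using IJ(2) by (auto intro!: emp_char_cong simp: merge_def)
    then show "H (merge I J (x, y)) = ennreal (bias_coeff h) + ennreal (atom_coeff h) * R x + ennreal split_coeff * (1 + R x) * V y"
      by (simp add: H_def R_def V_def)
  qed
  also have "\<dots> = (\<integral>\<^sup>+x. ennreal (bias_coeff h) + ennreal (atom_coeff h) * R x + ennreal split_coeff * (1 + R x) * (\<integral>\<^sup>+y. V y \<partial>?PJ) \<partial>?PI)"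
    by (intro nn_integral_cong) (simp add: nn_integral_add nn_integral_cmult PJ.P.emeasure_space_1)
  also have "\<dots> = ennreal (bias_coeff h) + ennreal (atom_coeff h) * (\<integral>\<^sup>+x. R x \<partial>?PI)
      + ennreal split_coeff * (1 + (\<integral>\<^sup>+x. R x \<partial>?PI)) * (\<integral>\<^sup>+y. V y \<partial>?PJ)"
    by (simp add: nn_integral_add nn_integral_cmult nn_integral_multc PI.P.emeasure_space_1)
  also have "\<dots> \<le> ennreal (bias_coeff h) + ennreal (atom_coeff h) * ennreal (ratio_bd \<epsilon> g Qg (n div 2))
      + ennreal split_coeff * (1 + ennreal (ratio_bd \<epsilon> g Qg (n div 2))) * ennreal (2 / (h * real (n - n div 2)))"
  proof -
    have "(\<integral>\<^sup>+x. R x \<partial>?PI) \<le> ennreal (ratio_bd \<epsilon> g Qg (n div 2))"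
      unfolding R_def using ratio_sq_expectation[OF Qg g e I(1,2)] by (simp only: I(3))
    moreover have "(\<integral>\<^sup>+y. V y \<partial>?PJ) \<le> ennreal (2 / (h * real (n - n div 2)))"
      unfolding V_def using noise_energy_expectation[OF J(1,2) h] by (simp only: J(3))
    ultimately show ?thesis by (intro add_mono mult_mono) auto
  qed
  also have "\<dots> = ennreal (bias_coeff h + atom_coeff h * ratio_bd \<epsilon> g Qg (n div 2)
         + split_coeff * (1 + ratio_bd \<epsilon> g Qg (n div 2)) * (2 / (h * real (n - n div 2))))"
  proof -
    have "0 \<le> ratio_bd \<epsilon> g Qg (n div 2)" "0 \<le> 2 / (h * real (n - n div 2))"
      using ratio_bd_nonneg[OF g] h by auto
    then show ?thesis
      using nn unfolding ennreal_1[symmetric]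
      by (simp only: ennreal_mult[symmetric] ennreal_plus[symmetric] add_nonneg_nonneg mult_nonneg_nonneg zero_le_one)
  qed
  finally show ?thesis unfolding split_coeff_def .
qed

end

subsection \<open>Rates\<close>

lemma ln_powr_le_powr:
  fixes e s x :: real
  assumes "0 < e" "0 < s" "1 < x"
  shows "ln x powr e \<le> ((e / s) powr (e / s)) powr s * x powr s"
proof -
  have "ln x powr e = (ln x powr (e / s)) powr s"
    using assms by (simp add: powr_powr)
  also have "\<dots> \<le> ((e / s) powr (e / s) * x) powr s"
    using assms by (intro powr_mono2 ln_powr_bound2) auto
  finally show ?thesis using assms by (simp add: powr_mult)
qed

lemma one_plus_ln_square_le_powr:
  fixes s :: real
  assumes "0 < s"
  obtains c where "0 < c" "\<And>n::nat. 2 \<le> n \<Longrightarrow> 1 + (ln (3 * real n))\<^sup>2 \<le> c * real n powr s"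
proof
  let ?c = "((2 / s) powr (2 / s)) powr s * 3 powr s"
  show "0 < 1 + ?c" by (simp add: add_pos_nonneg)
  fix n :: nat assume n: "2 \<le> n"
  have "(ln (3 * real n))\<^sup>2 = ln (3 * real n) powr 2"
    using n by (simp add: powr_numeral)
  also have "\<dots> \<le> ((2 / s) powr (2 / s)) powr s * (3 * real n) powr s"
    using assms n by (intro ln_powr_le_powr) auto
  also have "\<dots> = ?c * real n powr s" by (simp add: powr_mult)
  finally have "(ln (3 * real n))\<^sup>2 \<le> ?c * real n powr s" .
  moreover have "1 \<le> real n powr s" using assms n by (intro ge_one_powr_ge_zero) auto
  ultimately show "1 + (ln (3 * real n))\<^sup>2 \<le> (1 + ?c) * real n powr s"
    by (simp add: algebra_simps)
qed

text \<open>The rates are claimed for every \<open>n \<ge> 2\<close>, while some terms vanish only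
  from some \<open>n\<close> on; the finitely many earlier values are absorbed into the
  constant.\<close>

lemma eventually_zero_bound:
  fixes F :: "nat \<Rightarrow> real"
  assumes "eventually (\<lambda>n. F n = 0) sequentially" and G: "\<forall>n\<ge>2. 0 < G n"
  shows "\<exists>c>0. \<forall>n\<ge>2. F n \<le> c * G n"
proof -
  have "(\<lambda>n. F n / G n) \<longlonglongrightarrow> 0"
    by (rule tendsto_eventually) (use assms(1) in \<open>auto elim: eventually_mono\<close>)
  then have "Bseq (\<lambda>n. F n / G n)" by (intro convergent_imp_Bseq) (auto simp: convergent_def)
  then obtain c where c: "0 < c" "\<And>n. norm (F n / G n) \<le> c" by (auto simp: Bseq_def)
  have "F n \<le> c * G n" if "2 \<le> n" for n
  proof -
    have "F n / G n \<le> c" using c(2)[of n] by (metis abs_ge_self order_trans real_norm_def)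
    with G that show ?thesis by (simp add: divide_le_eq)
  qed
  with c(1) show ?thesis by blast
qed

lemma eps_bounds:
  assumes "2 \<le> n"
  shows "0 < 1 / ln (3 * real n)" "1 / ln (3 * real n) < 1"
proof -
  \<comment> \<open>\<open>exp 1 \<le> 3 < 3 * n\<close>, which puts the clipping level strictly
    below 1.\<close>
  have "ln (exp 1) < ln (3 * real n)"
    using assms exp_le by (intro ln_less_cancel_iff[THEN iffD2]) auto
  then show "0 < 1 / ln (3 * real n)" "1 / ln (3 * real n) < 1" by auto
qed

lemma eps_tendsto_0: "(\<lambda>n. 1 / ln (3 * real n)) \<longlonglongrightarrow> 0"
proof -
  have "filterlim (\<lambda>n. 3 * real n) at_top sequentially"
    by (rule filterlim_tendsto_pos_mult_at_top[OF tendsto_const _ filterlim_real_sequentially]) simp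
  then have "filterlim (\<lambda>n. ln (3 * real n)) at_top sequentially"
    by (rule filterlim_compose[OF ln_at_top])
  then show ?thesis
    using tendsto_divide_0[OF tendsto_const filterlim_at_top_imp_at_infinity] by blast
qed

lemma is_fourier_transform_measurable:
  assumes "is_fourier_transform u \<phi>"
  shows "\<phi> \<in> borel_measurable borel"
  using assms unfolding is_fourier_transform_def
proof
  assume *: "integrable lborel u \<and> \<phi> = fourier u"
  then have "(\<lambda>x. complex_of_real (u x)) \<in> borel_measurable borel"
    using borel_measurable_integrable[of lborel u] by simp
  from borel_measurable_fourier_integral[OF this] * show ?thesis
    by (simp add: fourier_def[abs_def] mult.commute)
qed simp

text \<open>Away from 0 this is the ratio bound. At 0 the ratio is replaced by its limit, which does
  not mention \<open>\<phi> 0\<close>; continuity and the decay of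
  \<open>U * \<bar>t\<bar> powr \<alpha>\<close> force \<open>\<phi> 0 = 0\<close>.\<close>

lemma bound_of_ratio_bound:
  fixes \<phi> :: "real \<Rightarrow> complex"
  assumes "0 < \<alpha>" "0 < U" and cont: "\<exists>\<delta>>0. continuous_on {-\<delta><..<\<delta>} \<phi>"
    and ratio: "\<exists>L. ((\<lambda>t. \<phi> t / complex_of_real (\<bar>t\<bar> powr \<alpha>)) \<longlongrightarrow> L) (at 0) \<and>
      (\<forall>t. cmod (if t = 0 then L else \<phi> t / complex_of_real (\<bar>t\<bar> powr \<alpha>)) \<le> U)"
  shows "cmod (\<phi> t) \<le> U * \<bar>t\<bar> powr \<alpha>"
proof -
  obtain L where L: "((\<lambda>t. \<phi> t / complex_of_real (\<bar>t\<bar> powr \<alpha>)) \<longlongrightarrow> L) (at 0)"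
    and le: "\<And>t. cmod (if t = 0 then L else \<phi> t / complex_of_real (\<bar>t\<bar> powr \<alpha>)) \<le> U"
    using ratio by blast
  obtain \<delta> where \<delta>: "0 < \<delta>" "continuous_on {-\<delta><..<\<delta>} \<phi>" using cont by blast
  have nz: "cmod (\<phi> t) \<le> U * \<bar>t\<bar> powr \<alpha>" if "t \<noteq> 0" for t
    using le[of t] that by (simp add: norm_divide divide_le_eq)
  have "\<phi> 0 = 0"
  proof (rule tendsto_unique[OF trivial_limit_at])
    have "isCont \<phi> 0" using \<delta> by (auto simp: continuous_on_eq_continuous_at)
    then show "(\<phi> \<longlongrightarrow> \<phi> 0) (at 0)" by (simp add: isCont_def)
    have "((\<lambda>t::real. \<bar>t\<bar>) \<longlongrightarrow> 0) (at 0)"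
      by (rule tendsto_rabs_zero) (rule tendsto_ident_at)
    then have "((\<lambda>t::real. \<bar>t\<bar> powr \<alpha>) \<longlongrightarrow> 0) (at 0)"
      by (rule tendsto_zero_powrI[OF _ tendsto_const]) (use assms in auto)
    then have "((\<lambda>t::real. U * \<bar>t\<bar> powr \<alpha>) \<longlongrightarrow> 0) (at 0)"
      by (rule tendsto_mult_right_zero)
    then show "(\<phi> \<longlongrightarrow> 0) (at 0)"
      by (rule Lim_null_comparison[rotated]) (use nz in \<open>auto simp: eventually_at_filter\<close>)
  qed
  then show ?thesis using nz[of t] by (cases "t = 0") auto
qed

context deconvolution
begin

text \<open>The right side is free of \<open>p\<close> and \<open>f\<close>, so
  \<open>deconvolution_model\<close> can be instantiated at each point of the class
  separately.\<close>

lemma SUP_mise_split_le: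
  assumes "2 \<le> n" "0 < \<epsilon>" "\<epsilon> < 1" "0 < h" "0 < g" "inverse_bound h Qh" "inverse_bound g Qg"
  shows "(SUP (p, f) \<in> {0..pstar} \<times> density_class \<alpha> K. mise k n (split_est \<phi>u \<phi>w \<phi>Z \<epsilon> h g n) p f)
     \<le> ennreal (bias_coeff h + atom_coeff h * ratio_bd \<epsilon> g Qg (n div 2)
         + noise_coeff Qh * (2 / (1 - pstar)\<^sup>2) * (1 + ratio_bd \<epsilon> g Qg (n div 2)) * (2 / (h * real (n - n div 2))))"
proof (intro SUP_least, clarify)
  fix p f assume "p \<in> {0..pstar}" "f \<in> density_class \<alpha> K"
  then interpret deconvolution_model \<alpha> K pstar U W \<phi>u \<phi>w k p f by unfold_locales auto
  show "mise k n (split_est \<phi>u \<phi>w \<phi>Z \<epsilon> h g n) p f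
     \<le> ennreal (bias_coeff h + atom_coeff h * ratio_bd \<epsilon> g Qg (n div 2)
         + noise_coeff Qh * (2 / (1 - pstar)\<^sup>2) * (1 + ratio_bd \<epsilon> g Qg (n div 2)) * (2 / (h * real (n - n div 2))))"
    by (rule mise_split_le[OF assms])
qed

lemma SUP_mise_full_le:
  assumes "1 \<le> n" "0 < \<epsilon>" "\<epsilon> < 1" "0 < h" "0 < g" "inverse_bound h Qh" "inverse_bound g Qg"
  shows "(SUP (p, f) \<in> {0..pstar} \<times> density_class \<alpha> K. mise k n (full_est \<phi>u \<phi>w \<phi>Z \<epsilon> h g n) p f)
     \<le> ennreal (bias_coeff h + atom_coeff h * ratio_bd \<epsilon> g Qg n + noise_coeff Qh / \<epsilon>\<^sup>2 * (2 / (h * real n)))"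
proof (intro SUP_least, clarify)
  fix p f assume "p \<in> {0..pstar}" "f \<in> density_class \<alpha> K"
  then interpret deconvolution_model \<alpha> K pstar U W \<phi>u \<phi>w k p f by unfold_locales auto
  show "mise k n (full_est \<phi>u \<phi>w \<phi>Z \<epsilon> h g n) p f
     \<le> ennreal (bias_coeff h + atom_coeff h * ratio_bd \<epsilon> g Qg n + noise_coeff Qh / \<epsilon>\<^sup>2 * (2 / (h * real n)))"
    by (rule mise_full_le[OF assms])
qed

section \<open>Growth of the reciprocal of the noise characteristic function\<close>

text \<open>The tail hypotheses speak only of large \<open>\<bar>t\<bar>\<close>; on the rest,
  continuity, compactness and non-vanishing of \<open>\<phi>Z\<close> take over.\<close>

lemma phiZ_bounded_below:
  obtains m where "0 < m" "\<And>t. \<bar>t\<bar> \<le> T \<Longrightarrow> m \<le> cmod (\<phi>Z t)"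
proof (cases "0 \<le> T")
  case True
  have "continuous_on {-T..T} (\<lambda>t. cmod (\<phi>Z t))"
    by (intro continuous_on_norm continuous_at_imp_continuous_on ballI Z.isCont_char)
  moreover have "{-T..T} \<noteq> {}" using True by auto
  ultimately obtain s where s: "s \<in> {-T..T}" "\<And>t. t \<in> {-T..T} \<Longrightarrow> cmod (\<phi>Z s) \<le> cmod (\<phi>Z t)"
    using continuous_attains_inf[of "{-T..T}" "\<lambda>t. cmod (\<phi>Z t)"] by auto
  show ?thesis
    by (rule that[of "cmod (\<phi>Z s)"]) (use s(1) Z_nz in \<open>auto simp: abs_le_iff intro!: s(2)\<close>)
next
  case False
  then show ?thesis by (intro that[of 1]) auto
qed

text \<open>Beyond \<open>T'\<close> the tail bound, evaluated at the band edge, gives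
  \<open>s powr (- \<beta>)\<close>. On the compact part the reciprocal is merely bounded; there
  \<open>s \<le> d\<close> makes \<open>s powr (- \<beta>)\<close> at least
  \<open>d powr (- \<beta>)\<close>, which the first entry of the maximum \<open>c\<close>
  compensates.\<close>

lemma inverse_bound_polynomial:
  assumes "0 < d0" "0 < \<beta>" "0 < d"
    and T: "\<And>t. T \<le> \<bar>t\<bar> \<Longrightarrow> d0 * \<bar>t\<bar> powr (- \<beta>) \<le> cmod (\<phi>Z t)"
  obtains c where "0 < c" "\<And>s. 0 < s \<Longrightarrow> s \<le> d \<Longrightarrow> inverse_bound s (c * s powr (- \<beta>))"
proof -
  define T' where "T' = max T 1"
  obtain m where m: "0 < m" "\<And>t. \<bar>t\<bar> \<le> T' \<Longrightarrow> m \<le> cmod (\<phi>Z t)"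
    using phiZ_bounded_below[of T'] by blast
  define c where "c = max (d powr \<beta> / m) (1 / d0)"
  have c: "0 < c" using assms by (simp add: c_def less_max_iff_disj)
  show ?thesis
  proof (rule that[OF c])
    fix s assume s: "0 < s" "s \<le> d"
    show "inverse_bound s (c * s powr (- \<beta>))"
      unfolding inverse_bound_def
    proof (intro allI impI)
      fix t assume t: "\<bar>t\<bar> \<le> 1 / s"
      show "1 \<le> c * s powr (- \<beta>) * cmod (\<phi>Z t)"
      proof (cases "\<bar>t\<bar> \<le> T'")
        case True
        have "1 = (d powr \<beta> / m) * d powr (- \<beta>) * m"
          using m assms by (simp add: powr_minus)
        also have "\<dots> \<le> c * s powr (- \<beta>) * cmod (\<phi>Z t)"
          using s m True c assms by (intro mult_mono powr_mono2') (auto simp: c_def)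
        finally show ?thesis .
      next
        case False
        then have t': "T \<le> \<bar>t\<bar>" "1 \<le> \<bar>t\<bar>" by (auto simp: T'_def)
        have "\<bar>t\<bar> powr \<beta> \<le> (1 / s) powr \<beta>" using t assms by (intro powr_mono2) auto
        also have "\<dots> = s powr (- \<beta>)" using s by (simp add: powr_divide powr_minus field_simps)
        finally have ts: "\<bar>t\<bar> powr \<beta> \<le> s powr (- \<beta>)" .
        have "1 = (1 / d0) * \<bar>t\<bar> powr \<beta> * (d0 * \<bar>t\<bar> powr (- \<beta>))"
          using t' assms by (simp add: powr_minus)
        also have "\<dots> \<le> c * s powr (- \<beta>) * cmod (\<phi>Z t)"
          using ts T[OF t'(1)] c assms by (intro mult_mono) (auto simp: c_def)
        finally show ?thesis .
      qed
    qed
  qed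
qed

text \<open>Beyond \<open>T'\<close>, where \<open>\<bar>t\<bar> \<ge> 1\<close>, the exponent
  \<open>\<bar>\<beta>0\<bar> + 1\<close> covers either sign of \<open>\<beta>0\<close>; it is
  positive, as the later comparison with powers of \<open>n\<close> requires. The added 1 and the
  exponential keep their factors at least 1 for every \<open>s\<close>, which takes care of the
  compact part.\<close>

lemma inverse_bound_exponential:
  assumes "0 < d0" "0 < \<beta>" "0 < \<gamma>"
    and T: "\<And>t. T \<le> \<bar>t\<bar> \<Longrightarrow> d0 * \<bar>t\<bar> powr \<beta>0 * exp (- (\<bar>t\<bar> powr \<beta>) / \<gamma>) \<le> cmod (\<phi>Z t)"
  obtains c where "0 < c" "\<And>s. 0 < s \<Longrightarrow>
    inverse_bound s (c * (1 + (1 / s) powr (\<bar>\<beta>0\<bar> + 1)) * exp ((1 / s) powr \<beta> / \<gamma>))"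
proof -
  define T' where "T' = max T 1"
  obtain m where m: "0 < m" "\<And>t. \<bar>t\<bar> \<le> T' \<Longrightarrow> m \<le> cmod (\<phi>Z t)"
    using phiZ_bounded_below[of T'] by blast
  define c where "c = max (1 / m) (1 / d0)"
  have c: "0 < c" using assms by (simp add: c_def less_max_iff_disj)
  show ?thesis
  proof (rule that[OF c])
    fix s :: real assume s: "0 < s"
    show "inverse_bound s (c * (1 + (1 / s) powr (\<bar>\<beta>0\<bar> + 1)) * exp ((1 / s) powr \<beta> / \<gamma>))"
      unfolding inverse_bound_def
    proof (intro allI impI)
      fix t assume t: "\<bar>t\<bar> \<le> 1 / s"
      show "1 \<le> c * (1 + (1 / s) powr (\<bar>\<beta>0\<bar> + 1)) * exp ((1 / s) powr \<beta> / \<gamma>) * cmod (\<phi>Z t)"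
      proof (cases "\<bar>t\<bar> \<le> T'")
        case True
        have "1 = (1 / m) * 1 * 1 * m"
          using m by simp
        also have "\<dots> \<le> c * (1 + (1 / s) powr (\<bar>\<beta>0\<bar> + 1)) * exp ((1 / s) powr \<beta> / \<gamma>) * cmod (\<phi>Z t)"
          using m(1) m(2)[OF True] c assms by (intro mult_mono) (auto simp: c_def)
        finally show ?thesis .
      next
        case False
        then have t': "T \<le> \<bar>t\<bar>" "1 \<le> \<bar>t\<bar>" by (auto simp: T'_def)
        have "\<bar>t\<bar> powr (- \<beta>0) \<le> \<bar>t\<bar> powr (\<bar>\<beta>0\<bar> + 1)" using t' by (intro powr_mono) auto
        also have "\<dots> \<le> (1 / s) powr (\<bar>\<beta>0\<bar> + 1)" using t by (intro powr_mono2) auto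
        finally have t1: "\<bar>t\<bar> powr (- \<beta>0) \<le> 1 + (1 / s) powr (\<bar>\<beta>0\<bar> + 1)" by simp
        have t2: "exp (\<bar>t\<bar> powr \<beta> / \<gamma>) \<le> exp ((1 / s) powr \<beta> / \<gamma>)"
          using t assms by (auto intro!: divide_right_mono powr_mono2)
        have "1 = (1 / d0) * \<bar>t\<bar> powr (- \<beta>0) * exp (\<bar>t\<bar> powr \<beta> / \<gamma>) * (d0 * \<bar>t\<bar> powr \<beta>0 * exp (- (\<bar>t\<bar> powr \<beta>) / \<gamma>))"
          using t' assms(1-3) by (simp add: powr_minus exp_minus field_simps)
        also have "\<dots> \<le> c * (1 + (1 / s) powr (\<bar>\<beta>0\<bar> + 1)) * exp ((1 / s) powr \<beta> / \<gamma>) * cmod (\<phi>Z t)"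
          using t1 t2 T[OF t'(1)] c assms by (intro mult_mono) (auto simp: c_def)
        finally show ?thesis .
      qed
    qed
  qed
qed

section \<open>The polynomial and the logarithmic rate\<close>

text \<open>The indicator part of \<open>ratio_bd\<close> at
  \<open>\<epsilon> = 1 / ln (3 * n)\<close>. It is split off because along bandwidths tending to 0
  it is zero for all large \<open>n\<close>, whereas for small \<open>n\<close> it need not be
  small.\<close>

definition "clip_excess g n = 4 * (ln (3 * real n))\<^sup>2 *
  of_bool (pstar > 1 - 1 / ln (3 * real n) \<or> sqrt (bias_sq g) > (1 - pstar) / 4)"

lemma eventually_clip_excess:
  assumes "g \<longlonglongrightarrow> 0" and "\<And>n. 0 \<le> g n"
  shows "eventually (\<lambda>n. clip_excess (g n) n = 0) sequentially"
proof -
  have "(\<lambda>n. 1 - 1 / ln (3 * real n)) \<longlonglongrightarrow> 1 - 0"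
    by (intro tendsto_intros eps_tendsto_0)
  then have 1: "eventually (\<lambda>n. pstar < 1 - 1 / ln (3 * real n)) sequentially"
    using pstar by (intro order_tendstoD(1)[of _ 1]) auto
  have "(\<lambda>n. sqrt (bias_sq (g n))) \<longlonglongrightarrow> sqrt (U\<^sup>2 * K / 2 * 0)"
    unfolding bias_sq_def
    by (intro tendsto_intros tendsto_zero_powrI[OF assms(1) tendsto_const]) (use \<alpha> assms(2) in auto)
  then have 2: "eventually (\<lambda>n. sqrt (bias_sq (g n)) < (1 - pstar) / 4) sequentially"
    using pstar by (intro order_tendstoD(2)[of _ 0]) auto
  from 1 2 show ?thesis
    by eventually_elim (auto simp: clip_excess_def)
qed

lemma ratio_bd_le:
  "ratio_bd (1 / ln (3 * real n)) g Q N \<le>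
     (8 / (1 - pstar)\<^sup>2 + 4) * (bias_sq g + (1 + (ln (3 * real n))\<^sup>2) * var_bd g Q N) + clip_excess g n"
  if "0 < g"
proof -
  have "0 \<le> 8 / (1 - pstar)\<^sup>2 * ((ln (3 * real n))\<^sup>2 * var_bd g Q N) + 4 * bias_sq g + 4 * var_bd g Q N"
    using var_bd_nonneg[OF that, of Q N] bias_sq_nonneg[of g] by (intro add_nonneg_nonneg mult_nonneg_nonneg) auto
  then show ?thesis
    unfolding ratio_bd_def clip_excess_def by (simp add: power_divide algebra_simps add_divide_distrib)
qed

text \<open>All powers of \<open>n\<close> are traded for powers of the bandwidths. Bias and noise
  of the density step are both of order \<open>h powr (2 * \<alpha>)\<close>; the work lies in
  showing that the atom ratio is small enough to survive the factor \<open>1 / h\<close> in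
  \<open>atom_coeff\<close>.\<close>

theorem split_rate:
  fixes d0 \<beta> d T :: real
  assumes pos: "0 < d0" "0 < \<beta>" "0 < d"
    and T: "\<And>t. T \<le> \<bar>t\<bar> \<Longrightarrow> d0 * \<bar>t\<bar> powr (- \<beta>) \<le> cmod (\<phi>Z t)"
  defines "h \<equiv> \<lambda>n. d * real (n - n div 2) powr (- 1 / (2 * \<alpha> + 2 * \<beta> + 1))"
    and "g \<equiv> \<lambda>n. d * real (n div 2) powr (- 1 / (2 * \<alpha> + 2 * \<beta>))"
  shows "\<exists>C. \<forall>n\<ge>2. (SUP (p, f) \<in> {0..pstar} \<times> density_class \<alpha> K.
        mise k n (split_est \<phi>u \<phi>w \<phi>Z (1 / ln (3 * real n)) (h n) (g n) n) p f)
      \<le> ennreal (C * real n powr (- 2 * \<alpha> / (2 * \<alpha> + 2 * \<beta> + 1)))"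
proof -
  define E1 where "E1 = 2 * \<alpha> + 2 * \<beta> + 1"
  define E0 where "E0 = 2 * \<alpha> + 2 * \<beta>"
  have E: "0 < E0" "0 < E1" "E0 < E1" using \<alpha> pos by (auto simp: E0_def E1_def)
  \<comment> \<open>The worst case for the first half is \<open>n = 3\<close>, where
    \<open>n div 2\<close> is exactly a third of \<open>n\<close>.\<close>
  have n12: "1 \<le> real (n div 2)" "real n / 3 \<le> real (n div 2)" "real n / 2 \<le> real (n - n div 2)"
    "real (n - n div 2) \<le> real n" "1 \<le> real (n - n div 2)" if "2 \<le> n" for n
  proof -
    have "n \<le> 3 * (n div 2)" "n \<le> 2 * (n - n div 2)" "1 \<le> n div 2" "1 \<le> n - n div 2" using that by linarith+
    then have "real n \<le> real (3 * (n div 2))" "real n \<le> real (2 * (n - n div 2))"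
      "real 1 \<le> real (n div 2)" "real 1 \<le> real (n - n div 2)"
      by (simp_all only: of_nat_le_iff)
    then show "1 \<le> real (n div 2)" "real n / 3 \<le> real (n div 2)" "real n / 2 \<le> real (n - n div 2)"
      "real (n - n div 2) \<le> real n" "1 \<le> real (n - n div 2)"
      by (simp_all del: of_nat_diff)
  qed
  have h_powr: "h n powr e = d powr e * real (n - n div 2) powr (- (e / E1))" for n e
    using pos by (simp add: h_def E1_def powr_mult powr_powr)
  have g_powr: "g n powr e = d powr e * real (n div 2) powr (- (e / E0))" for n e
    using pos by (simp add: g_def E0_def powr_mult powr_powr)
  have h: "0 < h n" "h n \<le> d" if "2 \<le> n" for n
  proof -
    show "0 < h n" using n12(5)[OF that] pos by (simp add: h_def)
    have "real (n - n div 2) powr (- 1 / E1) \<le> real (n - n div 2) powr 0"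
      using n12(5)[OF that] E by (intro powr_mono) auto
    then show "h n \<le> d" using n12(5)[OF that] pos unfolding h_def E1_def[symmetric] by simp
  qed
  have g: "0 < g n" "g n \<le> d" if "2 \<le> n" for n
  proof -
    show "0 < g n" using n12(1)[OF that] pos by (simp add: g_def)
    have "real (n div 2) powr (- 1 / E0) \<le> real (n div 2) powr 0"
      using n12(1)[OF that] E by (intro powr_mono) auto
    then show "g n \<le> d" using n12(1)[OF that] pos unfolding g_def E0_def[symmetric] by simp
  qed
  have inv_n2: "1 / real (n - n div 2) = h n powr E1 / d powr E1" if "2 \<le> n" for n
    using n12(5)[OF that] E pos by (simp add: h_powr powr_minus divide_inverse del: of_nat_diff)
  have inv_n1: "1 / real (n div 2) = g n powr E0 / d powr E0" if "2 \<le> n" for n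
    using n12(1)[OF that] E pos by (simp add: g_powr powr_minus divide_inverse)
  obtain c where c: "0 < c" "\<And>s. 0 < s \<Longrightarrow> s \<le> d \<Longrightarrow> inverse_bound s (c * s powr (- \<beta>))"
    using inverse_bound_polynomial[OF pos T] by blast
  define v where "v = Z1 * U\<^sup>2 * c\<^sup>2 / (2 * d powr E0)"
  define b where "b = U\<^sup>2 * K / 2"
  have vb: "0 \<le> v" "0 \<le> b" using Z1_nonneg K by (auto simp: v_def b_def)
  \<comment> \<open>The square of the reciprocal bound contributes
    \<open>g powr (- 2 * \<beta>)\<close> and the sample size
    \<open>g powr (2 * \<alpha> + 2 * \<beta>)\<close>, so with the factor \<open>g\<close> the
    variance has the order of the squared bias.\<close>
  have var: "var_bd (g n) (c * g n powr (- \<beta>)) (n div 2) = v * g n powr (2 * \<alpha> + 1)" if "2 \<le> n" for n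
  proof -
    have "var_bd (g n) (c * g n powr (- \<beta>)) (n div 2)
        = Z1 * U\<^sup>2 * c\<^sup>2 / 2 * (g n powr 1 * (g n powr (- \<beta>) * g n powr (- \<beta>)) * (1 / real (n div 2)))"
      using g(1)[OF that] by (simp add: var_bd_def power_mult_distrib power2_eq_square)
    also have "\<dots> = Z1 * U\<^sup>2 * c\<^sup>2 / 2 * ((g n powr 1 * (g n powr (- \<beta>) * g n powr (- \<beta>)) * g n powr E0) / d powr E0)"
      by (simp only: inv_n1[OF that] times_divide_eq_right)
    also have "g n powr 1 * (g n powr (- \<beta>) * g n powr (- \<beta>)) * g n powr E0 = g n powr (2 * \<alpha> + 1)"
      by (simp only: powr_add[symmetric]) (simp add: E0_def add.commute)
    finally show ?thesis by (simp add: v_def)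
  qed
  \<comment> \<open>Exponents of the reciprocal sample sizes in
    \<open>g powr (2 * \<alpha> + 1)\<close> and \<open>h powr (2 * \<alpha> + 1)\<close>. The gap
    \<open>a - bb\<close> is positive because \<open>E0 < E1\<close>, and it absorbs the squared
    logarithm.\<close>
  define a bb where "a = (2 * \<alpha> + 1) / E0" and "bb = (2 * \<alpha> + 1) / E1"
  have ab: "0 < a" "0 < bb" "0 < a - bb"
    using E \<alpha> by (auto simp: a_def bb_def intro!: divide_strict_left_mono)
  obtain c0 where c0: "0 < c0" "\<And>n. 2 \<le> n \<Longrightarrow> 1 + (ln (3 * real n))\<^sup>2 \<le> c0 * real n powr (a - bb)"
    using one_plus_ln_square_le_powr[OF ab(3)] by blast
  have L_g: "(1 + (ln (3 * real n))\<^sup>2) * g n powr (2 * \<alpha> + 1) \<le> c0 * 3 powr a * h n powr (2 * \<alpha> + 1)" if n: "2 \<le> n" for n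
  proof -
    have "real (n div 2) powr (- a) \<le> (real n / 3) powr (- a)"
      using n12[OF n] ab n by (intro powr_mono2') auto
    also have "\<dots> = 3 powr a * real n powr (- a)"
      by (simp add: powr_divide powr_minus field_simps)
    finally have 1: "g n powr (2 * \<alpha> + 1) \<le> d powr (2 * \<alpha> + 1) * (3 powr a * real n powr (- a))"
      unfolding g_powr a_def[symmetric] by (intro mult_left_mono) auto
    have "real n powr (- bb) \<le> real (n - n div 2) powr (- bb)"
      using n12[OF n] ab by (intro powr_mono2') auto
    then have 2: "d powr (2 * \<alpha> + 1) * real n powr (- bb) \<le> h n powr (2 * \<alpha> + 1)"
      unfolding h_powr bb_def[symmetric] by (intro mult_left_mono) auto
    have "(1 + (ln (3 * real n))\<^sup>2) * g n powr (2 * \<alpha> + 1)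
        \<le> (c0 * real n powr (a - bb)) * (d powr (2 * \<alpha> + 1) * (3 powr a * real n powr (- a)))"
      using c0 n by (intro mult_mono 1) auto
    also have "\<dots> = c0 * 3 powr a * (d powr (2 * \<alpha> + 1) * (real n powr (a - bb) * real n powr (- a)))"
      by simp
    also have "real n powr (a - bb) * real n powr (- a) = real n powr (- bb)"
      by (simp flip: powr_add)
    also have "c0 * 3 powr a * (d powr (2 * \<alpha> + 1) * real n powr (- bb)) \<le> c0 * 3 powr a * h n powr (2 * \<alpha> + 1)"
      using c0 by (intro mult_left_mono 2) auto
    finally show ?thesis .
  qed
  have g_lim: "g \<longlonglongrightarrow> 0"
  proof -
    have "filterlim (\<lambda>n::nat. n div 2) at_top sequentially"
      unfolding filterlim_at_top
    proof
      fix Z :: nat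
      show "eventually (\<lambda>n. Z \<le> n div 2) sequentially"
        using eventually_ge_at_top[of "2 * Z"] by eventually_elim auto
    qed
    then have "filterlim (\<lambda>n. real (n div 2)) at_top sequentially"
      by (rule filterlim_compose[OF filterlim_real_sequentially])
    then have "(\<lambda>n. real (n div 2) powr (- 1 / E0)) \<longlonglongrightarrow> 0"
      using E by (intro tendsto_neg_powr) auto
    then show ?thesis
      using tendsto_mult_left[of _ 0 _ d] unfolding g_def E0_def by fastforce
  qed
  have g_nn: "0 \<le> g n" for n using pos by (simp add: g_def)
  have h_pos: "\<forall>n\<ge>2. 0 < h n powr (2 * \<alpha> + 1)"
    using h(1) by (auto simp: less_imp_neq[THEN not_sym])
  obtain c6 where c6: "0 < c6" "\<And>n. 2 \<le> n \<Longrightarrow> clip_excess (g n) n \<le> c6 * h n powr (2 * \<alpha> + 1)"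
    using eventually_zero_bound[of "\<lambda>n. clip_excess (g n) n", OF eventually_clip_excess[OF g_lim g_nn] h_pos]
    by blast
  define A where "A = 8 / (1 - pstar)\<^sup>2 + 4"
  have A: "0 < A" by (simp add: A_def add_nonneg_pos)
  define R where "R = A * ((b + v) * (c0 * 3 powr a)) + c6"
  have R: "0 \<le> R" using A vb c0 c6 by (auto simp: R_def intro!: add_nonneg_nonneg mult_nonneg_nonneg)
  have ratio: "ratio_bd (1 / ln (3 * real n)) (g n) (c * g n powr (- \<beta>)) (n div 2) \<le> R * h n powr (2 * \<alpha> + 1)"
    if n: "2 \<le> n" for n
  proof -
    let ?L = "1 + (ln (3 * real n))\<^sup>2" and ?G = "g n powr (2 * \<alpha> + 1)"
    have "ratio_bd (1 / ln (3 * real n)) (g n) (c * g n powr (- \<beta>)) (n div 2)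
        \<le> A * (b * ?G + ?L * (v * ?G)) + clip_excess (g n) n"
      using ratio_bd_le[OF g(1)[OF n], of n "c * g n powr (- \<beta>)" "n div 2"]
      by (simp only: A_def var[OF n] bias_sq_def b_def)
    also have "\<dots> \<le> A * (?L * (b * ?G) + ?L * (v * ?G)) + clip_excess (g n) n"
      using A vb by (intro add_right_mono mult_left_mono) (auto simp: mult_le_cancel_right1 distrib_right)
    also have "\<dots> = A * ((b + v) * (?L * ?G)) + clip_excess (g n) n"
      by (simp add: algebra_simps)
    also have "\<dots> \<le> A * ((b + v) * (c0 * 3 powr a * h n powr (2 * \<alpha> + 1))) + c6 * h n powr (2 * \<alpha> + 1)"
      using A vb by (intro add_mono mult_left_mono L_g c6 n) auto
    finally show ?thesis by (simp add: R_def algebra_simps)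
  qed
  define C1 where "C1 = 3 * W\<^sup>2 * K + 24 * (1 + W)\<^sup>2 * R
    + 12 * (1 + W)\<^sup>2 * c\<^sup>2 / (1 - pstar)\<^sup>2 / d powr E1 * (1 + R * d powr (2 * \<alpha> + 1))"
  have C1: "0 \<le> C1" using K R by (auto simp: C1_def intro!: add_nonneg_nonneg mult_nonneg_nonneg)
  define C where "C = C1 * (d powr (2 * \<alpha>) * 2 powr (2 * \<alpha> / E1))"
  show ?thesis
  proof (intro exI[of _ C] allI impI)
    fix n :: nat assume n: "2 \<le> n"
    define r where "r = ratio_bd (1 / ln (3 * real n)) (g n) (c * g n powr (- \<beta>)) (n div 2)"
    have r: "r \<le> R * h n powr (2 * \<alpha> + 1)" "0 \<le> r"
      using ratio[OF n] ratio_bd_nonneg[OF g(1)[OF n]] by (auto simp: r_def)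
    have hn: "0 < h n" by (rule h(1)[OF n])
    have "atom_coeff (h n) * r \<le> 24 * (1 + W)\<^sup>2 / h n * (R * h n powr (2 * \<alpha> + 1))"
      unfolding atom_coeff_def using hn by (intro mult_left_mono r) auto
    also have "\<dots> = 24 * (1 + W)\<^sup>2 * R * h n powr (2 * \<alpha>)"
      using hn by (simp add: powr_add)
    finally have t2: "atom_coeff (h n) * r \<le> 24 * (1 + W)\<^sup>2 * R * h n powr (2 * \<alpha>)" .
    have "noise_coeff (c * h n powr (- \<beta>)) * (2 / (1 - pstar)\<^sup>2) * (1 + r) * (2 / (h n * real (n - n div 2)))
        = 12 * (1 + W)\<^sup>2 * c\<^sup>2 / (1 - pstar)\<^sup>2 * (h n powr (- \<beta>) * h n powr (- \<beta>) * (1 / h n) * (1 / real (n - n div 2))) * (1 + r)"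
      by (simp add: noise_coeff_def power_mult_distrib power2_eq_square)
    also have "h n powr (- \<beta>) * h n powr (- \<beta>) * (1 / h n) * (1 / real (n - n div 2)) = h n powr (2 * \<alpha>) / d powr E1"
    proof -
      have "h n powr (- \<beta>) * h n powr (- \<beta>) * (1 / h n) * h n powr E1
          = h n powr (- \<beta>) * h n powr (- \<beta>) * h n powr (- 1) * h n powr E1"
        using hn by (simp add: powr_minus_divide)
      also have "\<dots> = h n powr (2 * \<alpha>)"
        by (simp only: powr_add[symmetric]) (simp add: E1_def)
      finally show ?thesis by (simp only: inv_n2[OF n] times_divide_eq_right)
    qed
    \<comment> \<open>Here \<open>r\<close> need only be bounded, for which
      \<open>h n \<le> d\<close> suffices.\<close>
    also have "12 * (1 + W)\<^sup>2 * c\<^sup>2 / (1 - pstar)\<^sup>2 * (h n powr (2 * \<alpha>) / d powr E1) * (1 + r)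
        \<le> 12 * (1 + W)\<^sup>2 * c\<^sup>2 / (1 - pstar)\<^sup>2 * (h n powr (2 * \<alpha>) / d powr E1) * (1 + R * d powr (2 * \<alpha> + 1))"
    proof (intro mult_left_mono add_left_mono order_trans[OF r(1)])
      show "h n powr (2 * \<alpha> + 1) \<le> d powr (2 * \<alpha> + 1)"
        using h[OF n] \<alpha> by (intro powr_mono2) auto
    qed (use R in auto)
    finally have t3: "noise_coeff (c * h n powr (- \<beta>)) * (2 / (1 - pstar)\<^sup>2) * (1 + r) * (2 / (h n * real (n - n div 2)))
        \<le> 12 * (1 + W)\<^sup>2 * c\<^sup>2 / (1 - pstar)\<^sup>2 * (h n powr (2 * \<alpha>) / d powr E1) * (1 + R * d powr (2 * \<alpha> + 1))" .
    have "bias_coeff (h n) + atom_coeff (h n) * r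
         + noise_coeff (c * h n powr (- \<beta>)) * (2 / (1 - pstar)\<^sup>2) * (1 + r) * (2 / (h n * real (n - n div 2)))
       \<le> 3 * W\<^sup>2 * K * h n powr (2 * \<alpha>) + 24 * (1 + W)\<^sup>2 * R * h n powr (2 * \<alpha>)
         + 12 * (1 + W)\<^sup>2 * c\<^sup>2 / (1 - pstar)\<^sup>2 * (h n powr (2 * \<alpha>) / d powr E1) * (1 + R * d powr (2 * \<alpha> + 1))"
      by (intro add_mono t2 t3) (simp add: bias_coeff_def)
    also have "\<dots> = C1 * h n powr (2 * \<alpha>)"
      by (simp add: C1_def algebra_simps)
    also have "\<dots> \<le> C1 * (d powr (2 * \<alpha>) * (2 powr (2 * \<alpha> / E1) * real n powr (- (2 * \<alpha> / E1))))"
    proof (intro mult_left_mono C1)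
      have "real (n - n div 2) powr (- (2 * \<alpha> / E1)) \<le> (real n / 2) powr (- (2 * \<alpha> / E1))"
        using n12[OF n] n E \<alpha> by (intro powr_mono2') auto
      also have "\<dots> = 2 powr (2 * \<alpha> / E1) * real n powr (- (2 * \<alpha> / E1))"
        by (simp add: powr_divide powr_minus field_simps)
      finally show "h n powr (2 * \<alpha>) \<le> d powr (2 * \<alpha>) * (2 powr (2 * \<alpha> / E1) * real n powr (- (2 * \<alpha> / E1)))"
        unfolding h_powr by (intro mult_left_mono) auto
    qed
    also have "\<dots> = C * real n powr (- 2 * \<alpha> / (2 * \<alpha> + 2 * \<beta> + 1))"
      by (simp add: C_def E1_def)
    finally have "ennreal (bias_coeff (h n) + atom_coeff (h n) * r
         + noise_coeff (c * h n powr (- \<beta>)) * (2 / (1 - pstar)\<^sup>2) * (1 + r) * (2 / (h n * real (n - n div 2))))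
       \<le> ennreal (C * real n powr (- 2 * \<alpha> / (2 * \<alpha> + 2 * \<beta> + 1)))"
      by (rule ennreal_leI)
    with SUP_mise_split_le[OF n eps_bounds[OF n] h(1)[OF n] g(1)[OF n] c(2)[OF h[OF n]] c(2)[OF g[OF n]]]
    show "(SUP (p, f) \<in> {0..pstar} \<times> density_class \<alpha> K.
        mise k n (split_est \<phi>u \<phi>w \<phi>Z (1 / ln (3 * real n)) (h n) (g n) n) p f)
      \<le> ennreal (C * real n powr (- 2 * \<alpha> / (2 * \<alpha> + 2 * \<beta> + 1)))"
      unfolding r_def[symmetric] by (rule order_trans)
  qed
qed

text \<open>At the band edge \<open>1 / h n\<close> the exponential in the reciprocal of
  \<open>\<phi>Z\<close> equals \<open>n powr (1 / 4)\<close>; this is the effect of the constant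
  \<open>4 / \<gamma>\<close>. Variances are therefore of order \<open>n powr (- 1 / 2)\<close> up
  to logarithms and negligible against the bias \<open>h powr (2 * \<alpha>)\<close>, which is the
  claimed rate.\<close>

theorem full_rate:
  fixes \<beta>0 d0 \<beta> \<gamma> T :: real
  assumes pos: "0 < d0" "0 < \<beta>" "0 < \<gamma>"
    and T: "\<And>t. T \<le> \<bar>t\<bar> \<Longrightarrow> d0 * \<bar>t\<bar> powr \<beta>0 * exp (- (\<bar>t\<bar> powr \<beta>) / \<gamma>) \<le> cmod (\<phi>Z t)"
  defines "h \<equiv> \<lambda>n. (4 / \<gamma>) powr (1 / \<beta>) * ln (real n) powr (- 1 / \<beta>)"
  shows "\<exists>C. \<forall>n\<ge>2. (SUP (p, f) \<in> {0..pstar} \<times> density_class \<alpha> K.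
        mise k n (full_est \<phi>u \<phi>w \<phi>Z (1 / ln (3 * real n)) (h n) (h n) n) p f)
      \<le> ennreal (C * ln (real n) powr (- 2 * \<alpha> / \<beta>))"
proof -
  have ln_pos: "0 < ln (real n)" if "2 \<le> n" for n using that by simp
  have h: "0 < h n" if "2 \<le> n" for n using that pos by (simp add: h_def)
  define B where "B = \<bar>\<beta>0\<bar> + 1"
  have B: "0 < B" by (simp add: B_def)
  have H: "(1 / h n) powr e = (\<gamma> / 4) powr (e / \<beta>) * ln (real n) powr (e / \<beta>)" if "2 \<le> n" for n e
    using pos ln_pos[OF that]
    by (simp add: h_def powr_mult powr_divide powr_powr powr_minus field_simps)
  obtain c where c: "0 < c" "\<And>s. 0 < s \<Longrightarrow>
      inverse_bound s (c * (1 + (1 / s) powr B) * exp ((1 / s) powr \<beta> / \<gamma>))"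
    using inverse_bound_exponential[OF pos T] unfolding B_def by blast
  define Q where "Q n = c * (1 + (1 / h n) powr B) * real n powr (1 / 4)" for n
  have Q: "inverse_bound (h n) (Q n)" if n: "2 \<le> n" for n
  proof -
    have "(1 / h n) powr \<beta> / \<gamma> = 1 / 4 * ln (real n)"
      using H[OF n, of \<beta>] pos ln_pos[OF n] by simp
    then have "exp ((1 / h n) powr \<beta> / \<gamma>) = real n powr (1 / 4)"
      using n by (simp add: powr_def)
    with c(2)[OF h[OF n]] show ?thesis by (simp add: Q_def)
  qed
  \<comment> \<open>Powers of \<open>1 / h n\<close> are powers of \<open>ln n\<close>, hence below
    every positive power of \<open>n\<close>.\<close>
  have growth: "\<exists>k>0. \<forall>n\<ge>2. 1 + (1 / h n) powr e \<le> k * real n powr s" if "0 < e" "0 < s" for e s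
  proof -
    define k where "k = (\<gamma> / 4) powr (e / \<beta>) * ((e / \<beta> / s) powr (e / \<beta> / s)) powr s"
    have "1 + (1 / h n) powr e \<le> (1 + k) * real n powr s" if n: "2 \<le> n" for n
    proof -
      have "(1 / h n) powr e \<le> (\<gamma> / 4) powr (e / \<beta>) * (((e / \<beta> / s) powr (e / \<beta> / s)) powr s * real n powr s)"
        unfolding H[OF n] using \<open>0 < e\<close> \<open>0 < s\<close> pos n by (intro mult_left_mono ln_powr_le_powr) auto
      moreover have "1 \<le> real n powr s" using \<open>0 < s\<close> n by (intro ge_one_powr_ge_zero) auto
      ultimately show ?thesis by (simp add: k_def algebra_simps)
    qed
    moreover have "0 < 1 + k" by (simp add: k_def add_pos_nonneg)
    ultimately show ?thesis by blast
  qed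
  \<comment> \<open>Four logarithmic factors, bounded by \<open>n powr (1 / 16)\<close> each, cost
    \<open>n powr (1 / 4)\<close> and leave \<open>n powr (- 1 / 4)\<close> of the available
    \<open>n powr (- 1 / 2)\<close>.\<close>
  obtain k1 where k1: "0 < k1" "\<And>n. 2 \<le> n \<Longrightarrow> 1 + (ln (3 * real n))\<^sup>2 \<le> k1 * real n powr (1 / 16)"
    using one_plus_ln_square_le_powr[of "1 / 16"] by auto
  obtain k2 where k2: "0 < k2" "\<And>n. 2 \<le> n \<Longrightarrow> 1 + (1 / h n) powr 1 \<le> k2 * real n powr (1 / 16)"
    using growth[of 1 "1 / 16"] by auto
  obtain k3 where k3: "0 < k3" "\<And>n. 2 \<le> n \<Longrightarrow> 1 + (1 / h n) powr B \<le> k3 * real n powr (1 / 16)"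
    using growth[OF B, of "1 / 16"] by auto
  \<comment> \<open>Trades the remaining negative power of \<open>n\<close> for the target power of
    \<open>ln n\<close>.\<close>
  define k4 where "k4 = ((2 * \<alpha> / \<beta> / (1 / 4)) powr (2 * \<alpha> / \<beta> / (1 / 4))) powr (1 / 4 :: real)"
  have k4: "real n powr (- (1 / 4)) \<le> k4 * ln (real n) powr (- (2 * \<alpha> / \<beta>))" if n: "2 \<le> n" for n
  proof -
    have "ln (real n) powr (2 * \<alpha> / \<beta>) \<le> k4 * real n powr (1 / 4)"
      unfolding k4_def using \<alpha> pos n by (intro ln_powr_le_powr) auto
    then show ?thesis
      using n ln_pos[OF n] by (simp add: powr_minus field_simps)
  qed
  define M where "M = c\<^sup>2 * (k1 * k2 * k3 * k3) * k4"
  have S: "(1 + (ln (3 * real n))\<^sup>2) * (1 + 1 / h n) * (Q n)\<^sup>2 / real n \<le> M * ln (real n) powr (- (2 * \<alpha> / \<beta>))"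
    if n: "2 \<le> n" for n
  proof -
    let ?n = "real n"
    have "(1 + (ln (3 * real n))\<^sup>2) * (1 + 1 / h n) * (1 + (1 / h n) powr B) * (1 + (1 / h n) powr B)
        \<le> (k1 * ?n powr (1 / 16)) * (k2 * ?n powr (1 / 16)) * (k3 * ?n powr (1 / 16)) * (k3 * ?n powr (1 / 16))"
      using k1(2)[OF n] k2(2)[OF n] k3(2)[OF n] k1(1) k2(1) k3(1) h[OF n]
      by (intro mult_mono) (auto intro!: add_nonneg_nonneg mult_nonneg_nonneg)
    also have "\<dots> = (k1 * k2 * k3 * k3) * (?n powr (1 / 16) * ?n powr (1 / 16) * ?n powr (1 / 16) * ?n powr (1 / 16))"
      by (simp only: mult_ac)
    also have "?n powr (1 / 16) * ?n powr (1 / 16) * ?n powr (1 / 16) * ?n powr (1 / 16) = ?n powr (1 / 4)"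
      by (simp flip: powr_add)
    finally have 1: "(1 + (ln (3 * real n))\<^sup>2) * (1 + 1 / h n) * (1 + (1 / h n) powr B) * (1 + (1 / h n) powr B)
        \<le> (k1 * k2 * k3 * k3) * ?n powr (1 / 4)" .
    have n1: "?n powr (1 / 4) * ?n powr (1 / 4) / ?n = ?n powr (- (1 / 2))"
    proof -
      have "?n powr (1 / 4) * ?n powr (1 / 4) / ?n = ?n powr (1 / 4) * ?n powr (1 / 4) * ?n powr (- 1)"
        using n by (simp add: powr_minus_divide)
      also have "\<dots> = ?n powr (- (1 / 2))" by (simp only: powr_add[symmetric]) simp
      finally show ?thesis .
    qed
    have "(1 + (ln (3 * real n))\<^sup>2) * (1 + 1 / h n) * (Q n)\<^sup>2 / real n
        = c\<^sup>2 * ((1 + (ln (3 * real n))\<^sup>2) * (1 + 1 / h n) * (1 + (1 / h n) powr B) * (1 + (1 / h n) powr B))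
          * (?n powr (1 / 4) * ?n powr (1 / 4) / ?n)"
      by (simp add: Q_def power2_eq_square mult_ac)
    also have "\<dots> \<le> c\<^sup>2 * ((k1 * k2 * k3 * k3) * ?n powr (1 / 4)) * ?n powr (- (1 / 2))"
      unfolding n1 by (intro mult_left_mono mult_right_mono 1) auto
    also have "\<dots> = c\<^sup>2 * (k1 * k2 * k3 * k3) * (?n powr (1 / 4) * ?n powr (- (1 / 2)))"
      by (simp only: mult_ac)
    also have "?n powr (1 / 4) * ?n powr (- (1 / 2)) = ?n powr (- (1 / 4))"
      by (simp flip: powr_add)
    also have "c\<^sup>2 * (k1 * k2 * k3 * k3) * ?n powr (- (1 / 4))
        \<le> c\<^sup>2 * (k1 * k2 * k3 * k3) * (k4 * ln (real n) powr (- (2 * \<alpha> / \<beta>)))"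
      using k1(1) k2(1) k3(1) by (intro mult_left_mono k4 n) auto
    finally show ?thesis by (simp only: M_def mult_ac)
  qed
  have h_lim: "h \<longlonglongrightarrow> 0"
  proof -
    have "filterlim (\<lambda>n. ln (real n)) at_top sequentially"
      by (rule filterlim_compose[OF ln_at_top filterlim_real_sequentially])
    then have "(\<lambda>n. ln (real n) powr (- 1 / \<beta>)) \<longlonglongrightarrow> 0"
      using pos by (intro tendsto_neg_powr) auto
    then show ?thesis unfolding h_def by (rule tendsto_mult_right_zero)
  qed
  have h_nn: "0 \<le> h n" for n by (simp add: h_def)
  have ev: "eventually (\<lambda>n. clip_excess (h n) n / h n = 0) sequentially"
    using eventually_clip_excess[OF h_lim h_nn] by eventually_elim simp
  have rate_pos: "\<forall>n::nat\<ge>2. 0 < ln (real n) powr (- (2 * \<alpha> / \<beta>))"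
    by auto
  obtain c6 where c6: "0 < c6"
    "\<And>n. 2 \<le> n \<Longrightarrow> clip_excess (h n) n / h n \<le> c6 * ln (real n) powr (- (2 * \<alpha> / \<beta>))"
    using eventually_zero_bound[of "\<lambda>n. clip_excess (h n) n / h n", OF ev rate_pos] by blast
  have h_powr: "h n powr (2 * \<alpha>) = (4 / \<gamma>) powr (2 * \<alpha> / \<beta>) * ln (real n) powr (- (2 * \<alpha> / \<beta>))" for n
    \<comment> \<open>For \<open>n < 2\<close> the logarithm is 0 and both sides vanish, as
      \<open>0 powr x = 0\<close>.\<close>
    by (cases "2 \<le> n") (use pos in \<open>simp_all add: h_def powr_mult powr_powr\<close>)
  define A where "A = 8 / (1 - pstar)\<^sup>2 + 4"
  have A: "0 < A" by (simp add: A_def add_nonneg_pos)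
  define \<kappa> where "\<kappa> = (4 / \<gamma>) powr (2 * \<alpha> / \<beta>)"
  define C where "C = 3 * W\<^sup>2 * K * \<kappa> + 24 * (1 + W)\<^sup>2 * (A * (U\<^sup>2 * K / 2 * \<kappa> + Z1 * U\<^sup>2 / 2 * M) + c6)
    + 6 * (1 + W)\<^sup>2 * M"
  show ?thesis
  proof (intro exI[of _ C] allI impI)
    fix n :: nat assume n: "2 \<le> n"
    define r where "r = ratio_bd (1 / ln (3 * real n)) (h n) (Q n) n"
    define \<rho> where "\<rho> = ln (real n) powr (- (2 * \<alpha> / \<beta>))"
    let ?L = "(ln (3 * real n))\<^sup>2"
    have hn: "0 < h n" by (rule h[OF n])
    have hp: "h n powr (2 * \<alpha>) = \<kappa> * \<rho>" by (simp add: h_powr \<kappa>_def \<rho>_def)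
    have Sn: "(1 + ?L) * (1 + 1 / h n) * (Q n)\<^sup>2 / real n \<le> M * \<rho>" using S[OF n] by (simp add: \<rho>_def)
    have S1: "(1 + ?L) * (Q n)\<^sup>2 / real n \<le> M * \<rho>"
    proof (rule order_trans[OF _ Sn], intro divide_right_mono mult_right_mono)
      show "1 + ?L \<le> (1 + ?L) * (1 + 1 / h n)"
        using mult_left_mono[of 1 "1 + 1 / h n" "1 + ?L"] hn by (simp add: add_nonneg_nonneg)
    qed auto
    have S2: "?L * (1 / h n) * (Q n)\<^sup>2 / real n \<le> M * \<rho>"
      by (rule order_trans[OF _ Sn], intro divide_right_mono mult_right_mono mult_mono) (use hn in auto)
    \<comment> \<open>\<open>r\<close> is estimated after division by \<open>h n\<close>, the
      denominator in \<open>atom_coeff\<close>: the factor \<open>h n\<close> in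
      \<open>var_bd\<close> cancels it, and \<open>bias_sq\<close> drops to the order
      \<open>h powr (2 * \<alpha>)\<close>.\<close>
    have "r / h n \<le> (A * (bias_sq (h n) + (1 + ?L) * var_bd (h n) (Q n) n) + clip_excess (h n) n) / h n"
      unfolding r_def A_def using hn by (intro divide_right_mono ratio_bd_le) auto
    also have "\<dots> = A * (bias_sq (h n) / h n + (1 + ?L) * (var_bd (h n) (Q n) n / h n)) + clip_excess (h n) n / h n"
      by (simp add: add_divide_distrib distrib_left)
    also have "bias_sq (h n) / h n = U\<^sup>2 * K / 2 * (\<kappa> * \<rho>)"
      using hn by (simp add: bias_sq_def powr_add flip: hp)
    also have "(1 + ?L) * (var_bd (h n) (Q n) n / h n) = Z1 * U\<^sup>2 / 2 * ((1 + ?L) * (Q n)\<^sup>2 / real n)"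
    proof -
      have "x * (z * h n * q / (2 * m) / h n) = z / 2 * (x * q / m)" for x z q m :: real
        using hn by simp
      then show ?thesis unfolding var_bd_def .
    qed
    also have "A * (U\<^sup>2 * K / 2 * (\<kappa> * \<rho>) + Z1 * U\<^sup>2 / 2 * ((1 + ?L) * (Q n)\<^sup>2 / real n)) + clip_excess (h n) n / h n
        \<le> A * (U\<^sup>2 * K / 2 * (\<kappa> * \<rho>) + Z1 * U\<^sup>2 / 2 * (M * \<rho>)) + c6 * \<rho>"
      using A Z1_nonneg c6(2)[OF n] by (intro add_left_mono add_mono mult_left_mono S1) (auto simp: \<rho>_def)
    finally have r: "r / h n \<le> (A * (U\<^sup>2 * K / 2 * \<kappa> + Z1 * U\<^sup>2 / 2 * M) + c6) * \<rho>"
      by (simp add: algebra_simps)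
    have t2: "atom_coeff (h n) * r \<le> 24 * (1 + W)\<^sup>2 * ((A * (U\<^sup>2 * K / 2 * \<kappa> + Z1 * U\<^sup>2 / 2 * M) + c6) * \<rho>)"
      using mult_left_mono[OF r, of "24 * (1 + W)\<^sup>2"] by (simp add: atom_coeff_def)
    have "noise_coeff (Q n) / (1 / ln (3 * real n))\<^sup>2 * (2 / (h n * real n)) = 6 * (1 + W)\<^sup>2 * (?L * (1 / h n) * (Q n)\<^sup>2 / real n)"
      by (simp add: noise_coeff_def power_divide)
    also have "\<dots> \<le> 6 * (1 + W)\<^sup>2 * (M * \<rho>)"
      by (intro mult_left_mono S2) auto
    finally have "bias_coeff (h n) + atom_coeff (h n) * r + noise_coeff (Q n) / (1 / ln (3 * real n))\<^sup>2 * (2 / (h n * real n))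
        \<le> 3 * W\<^sup>2 * K * (\<kappa> * \<rho>)
          + 24 * (1 + W)\<^sup>2 * ((A * (U\<^sup>2 * K / 2 * \<kappa> + Z1 * U\<^sup>2 / 2 * M) + c6) * \<rho>) + 6 * (1 + W)\<^sup>2 * (M * \<rho>)"
      by (intro add_mono t2) (simp_all add: bias_coeff_def hp)
    also have "\<dots> = C * \<rho>" by (simp add: C_def distrib_right mult.assoc)
    also have "\<dots> = C * ln (real n) powr (- 2 * \<alpha> / \<beta>)" by (simp add: \<rho>_def)
    finally have "ennreal (bias_coeff (h n) + atom_coeff (h n) * r + noise_coeff (Q n) / (1 / ln (3 * real n))\<^sup>2 * (2 / (h n * real n)))
       \<le> ennreal (C * ln (real n) powr (- 2 * \<alpha> / \<beta>))"
      by (rule ennreal_leI)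
    moreover have "1 \<le> n" using n by simp
    note SUP_mise_full_le[OF this eps_bounds[OF n] hn hn Q[OF n] Q[OF n], folded r_def]
    ultimately show "(SUP (p, f) \<in> {0..pstar} \<times> density_class \<alpha> K.
        mise k n (full_est \<phi>u \<phi>w \<phi>Z (1 / ln (3 * real n)) (h n) (h n) n) p f)
      \<le> ennreal (C * ln (real n) powr (- 2 * \<alpha> / \<beta>))"
      by (rule order_trans[rotated])
  qed
qed

end

theorem theorem2:
  fixes \<alpha> K pstar U W :: real
    and u w k :: "real \<Rightarrow> real"
    and \<phi>u \<phi>w \<phi>Z :: "real \<Rightarrow> complex"
    and \<epsilon> :: "nat \<Rightarrow> real"
  assumes "\<alpha> > 0" and "K > 0" and "0 \<le> pstar" and "pstar < 1" and "U > 0" and "W > 0"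
    and u_fourier: "is_fourier_transform u \<phi>u"
    and u_sym: "\<forall>t. \<phi>u (- t) = \<phi>u t"
    and u_real: "\<forall>t. \<phi>u t \<in> \<real>"
    and u_cont: "\<exists>\<delta>>0. continuous_on {-\<delta><..<\<delta>} \<phi>u"
    and u_supp: "\<forall>t. t \<notin> {-1..1} \<longrightarrow> \<phi>u t = 0"
    and u_int: "(CLINT t:{-1..1}|lborel. \<phi>u t) = 2"
    and u_ratio: "\<exists>L. ((\<lambda>t. \<phi>u t / complex_of_real (\<bar>t\<bar> powr \<alpha>)) \<longlongrightarrow> L) (at 0) \<and>
      (\<forall>t. cmod (if t = 0 then L else \<phi>u t / complex_of_real (\<bar>t\<bar> powr \<alpha>)) \<le> U)"
    and w_fourier: "is_fourier_transform w \<phi>w"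
    and w_sym: "\<forall>t. \<phi>w (- t) = \<phi>w t"
    and w_real: "\<forall>t. \<phi>w t \<in> \<real>"
    and w_supp: "\<forall>t. t \<notin> {-1..1} \<longrightarrow> \<phi>w t = 0"
    and w_0: "\<phi>w 0 = 1"
    and w_bound: "\<forall>t. cmod (\<phi>w t - 1) \<le> W * \<bar>t\<bar> powr \<alpha>"
    and w_L2: "set_integrable lborel {-1..1} (\<lambda>t. (cmod (\<phi>w t))\<^sup>2)"
    and eps: "\<forall>n. \<epsilon> n = 1 / ln (3 * real n)"
    and k_density: "prob_density k"
    and Z_char: "\<phi>Z = char (law_Z k)"
  shows
   "(\<forall>d0 \<beta> d :: real.
       (\<forall>t. \<phi>Z t \<noteq> 0) \<and> integrable lborel \<phi>Z \<and> d0 > 0 \<and> \<beta> > 0 \<and> d > 0 \<and>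
       (\<exists>T. \<forall>t. \<bar>t\<bar> \<ge> T \<longrightarrow> d0 * \<bar>t\<bar> powr (- \<beta>) \<le> cmod (\<phi>Z t)) \<longrightarrow>
       (\<exists>C :: real. \<forall>n \<ge> 2.
          (let h = d * real (n - n div 2) powr (- 1 / (2 * \<alpha> + 2 * \<beta> + 1));
               g = d * real (n div 2) powr (- 1 / (2 * \<alpha> + 2 * \<beta>))
           in (SUP (p, f) \<in> {0..pstar} \<times> density_class \<alpha> K.
                 mise k n (split_est \<phi>u \<phi>w \<phi>Z (\<epsilon> n) h g n) p f)
              \<le> ennreal (C * real n powr (- 2 * \<alpha> / (2 * \<alpha> + 2 * \<beta> + 1)))))) \<and>
    (\<forall>\<beta>0 d0 \<beta> \<gamma> :: real.
       (\<forall>t. \<phi>Z t \<noteq> 0) \<and> integrable lborel \<phi>Z \<and> d0 > 0 \<and> \<beta> > 0 \<and> \<gamma> > 0 \<and>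
       (\<exists>T. \<forall>t. \<bar>t\<bar> \<ge> T \<longrightarrow>
          d0 * \<bar>t\<bar> powr \<beta>0 * exp (- (\<bar>t\<bar> powr \<beta>) / \<gamma>) \<le> cmod (\<phi>Z t)) \<longrightarrow>
       (\<exists>C :: real. \<forall>n \<ge> 2.
          (let h = (4 / \<gamma>) powr (1 / \<beta>) * ln (real n) powr (- 1 / \<beta>)
           in (SUP (p, f) \<in> {0..pstar} \<times> density_class \<alpha> K.
                 mise k n (full_est \<phi>u \<phi>w \<phi>Z (\<epsilon> n) h h n) p f)
              \<le> ennreal (C * ln (real n) powr (- 2 * \<alpha> / \<beta>)))))"
proof -
  \<comment> \<open>Brings the kernel hypotheses into the form of the locale: transforms are Borel
    measurable, and the ratio bound becomes a pointwise bound that holds at 0 too.\<close>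
  have Z: "(\<forall>t. \<phi>Z t \<noteq> 0) \<Longrightarrow> integrable lborel \<phi>Z \<Longrightarrow> deconvolution \<alpha> K pstar U W \<phi>u \<phi>w k"
    using assms(1-6) u_supp u_int w_supp w_bound k_density
      is_fourier_transform_measurable[OF u_fourier] is_fourier_transform_measurable[OF w_fourier]
      bound_of_ratio_bound[OF \<open>\<alpha> > 0\<close> \<open>U > 0\<close> u_cont u_ratio]
    unfolding Z_char by unfold_locales auto
  have eps': "\<epsilon> = (\<lambda>n. 1 / ln (3 * real n))"
    using eps by (simp add: fun_eq_iff)
  show ?thesis
    unfolding Let_def eps'
  proof (intro conjI allI impI; elim conjE exE)
    fix d0 \<beta> d T :: real
    assume a: "\<forall>t. \<phi>Z t \<noteq> 0" "integrable lborel \<phi>Z" "0 < d0" "0 < \<beta>" "0 < d"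
      and T: "\<forall>t. T \<le> \<bar>t\<bar> \<longrightarrow> d0 * \<bar>t\<bar> powr (- \<beta>) \<le> cmod (\<phi>Z t)"
    interpret deconvolution \<alpha> K pstar U W \<phi>u \<phi>w k by (rule Z[OF a(1,2)])
    show "\<exists>C. \<forall>n\<ge>2. (SUP (p, f) \<in> {0..pstar} \<times> density_class \<alpha> K.
        mise k n (split_est \<phi>u \<phi>w \<phi>Z (1 / ln (3 * real n))
          (d * real (n - n div 2) powr (- 1 / (2 * \<alpha> + 2 * \<beta> + 1)))
          (d * real (n div 2) powr (- 1 / (2 * \<alpha> + 2 * \<beta>))) n) p f)
      \<le> ennreal (C * real n powr (- 2 * \<alpha> / (2 * \<alpha> + 2 * \<beta> + 1)))"
      using split_rate[OF a(3-5), of T] T unfolding Z_char by blast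
  next
    fix \<beta>0 d0 \<beta> \<gamma> T :: real
    assume a: "\<forall>t. \<phi>Z t \<noteq> 0" "integrable lborel \<phi>Z" "0 < d0" "0 < \<beta>" "0 < \<gamma>"
      and T: "\<forall>t. T \<le> \<bar>t\<bar> \<longrightarrow> d0 * \<bar>t\<bar> powr \<beta>0 * exp (- (\<bar>t\<bar> powr \<beta>) / \<gamma>) \<le> cmod (\<phi>Z t)"
    interpret deconvolution \<alpha> K pstar U W \<phi>u \<phi>w k by (rule Z[OF a(1,2)])
    show "\<exists>C. \<forall>n\<ge>2. (SUP (p, f) \<in> {0..pstar} \<times> density_class \<alpha> K.
        mise k n (full_est \<phi>u \<phi>w \<phi>Z (1 / ln (3 * real n))
          ((4 / \<gamma>) powr (1 / \<beta>) * ln (real n) powr (- 1 / \<beta>))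
          ((4 / \<gamma>) powr (1 / \<beta>) * ln (real n) powr (- 1 / \<beta>)) n) p f)
      \<le> ennreal (C * ln (real n) powr (- 2 * \<alpha> / \<beta>))"
      using full_rate[OF a(3-5), of T \<beta>0] T unfolding Z_char by blast
  qed
qed

end
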